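(* Let $M$ be an oriented non-maximal space-like surface in the Minkowski space $\mathbb E^4_1$. Then the Gauss map $\nu$ of $M$ is harmonic if and only if $M$ is flat in $\mathbb E^4_1$ with light-like and parallel mean curvature vector.
   Context: $\mathbb E^4_1$ is $\mathbb R^4$ with the metric $-dx_1^2+dx_2^2+dx_3^2+dx_4^2$. A vector $v$ is light-like if $v\neq0$ and $\langle v,v\rangle=0$. A surface $M$ in $\mathbb E^4_1$ is space-like if every nonzero tangent vector $v$ satisfies $\langle v,v\rangle>0$. Let $\widetilde\nabla$ and $\nabla$ be the Levi-Civita connections of $\mathbb E^4_1$ and $M$. The second fundamental form $h$, shape operators $A_\xi$ and normal connection $D$ are defined by $\widetilde\nabla_XY=\nabla_XY+h(X,Y)$ and $\widetilde\nabla_X\xi=-A_\xi(X)+D_X\xi$, for $X,Y$ tangent and $\xi$ normal. The mean curvature vector is $H=\frac12(h(e_1,e_1)+h(e_2,e_2))$ for an orthonormal tangent frame $\{e_1,e_2\}$. $M$ is called maximal if $H=0$, and non-maximal if it is not maximal; $H$ is parallel if $DH=0$ identically; $H$ is light-like if it is light-like at each point. $M$ is flat if its Gaussian curvature vanishes identically. The Gauss map is $\nu=e_3\wedge e_4:M\to\bigwedge^2\mathbb E^4_1$, where $\{e_1,e_2,e_3,e_4\}$ is an oriented local orthonormal frame with $e_1,e_2$ tangent and $e_3,e_4$ normal to $M$; $\bigwedge^2\mathbb E^4_1$ is identified with a pseudo-Euclidean space via $\langle f_1\wedge f_2,g_1\wedge g_2\rangle=\det(\langle f_i,g_j\rangle)$.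 The Laplacian $\Delta=\sum_{i=1}^2(\nabla_{e_i}e_i-e_ie_i)$ of $M$ acts componentwise on $\nu$, and $\nu$ is harmonic if $\Delta\nu=0$.
   Formalization: The surface M is assumed connected; otherwise the claim fails, e.g. for the disjoint union of a space-like plane and a flat surface with parallel light-like mean curvature vector: it is non-maximal with harmonic Gauss map, but H vanishes on the plane. *)

theory Defs
  imports "HOL-Analysis.Analysis"
begin

section \<open>Smooth maps\<close>

text \<open>The sets are meant to be open, so that derivatives at their points are unrestricted.\<close>

primrec Ck_on ::
  "nat \<Rightarrow> 'a::real_normed_vector set \<Rightarrow> ('a \<Rightarrow> 'b::real_normed_vector) \<Rightarrow> bool" where
  "Ck_on 0 S f \<longleftrightarrow> continuous_on S f"
| "Ck_on (Suc k) S f \<longleftrightarrow> (\<forall>u\<in>S. f differentiable (at u)) \<and>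
     (\<forall>v. Ck_on k S (\<lambda>u. frechet_derivative f (at u) v))"

definition smooth_on ::
  "'a::real_normed_vector set \<Rightarrow> ('a \<Rightarrow> 'b::real_normed_vector) \<Rightarrow> bool" where
  "smooth_on S f \<longleftrightarrow> (\<forall>k. Ck_on k S f)"


section \<open>Minkowski space and its bivectors\<close>

definition lorentz :: "real^4 \<Rightarrow> real^4 \<Rightarrow> real" where
  "lorentz v w = - (v$1 * w$1) + v$2 * w$2 + v$3 * w$3 + v$4 * w$4"

definition light_like :: "real^4 \<Rightarrow> bool" where
  "light_like v \<longleftrightarrow> v \<noteq> 0 \<and> lorentz v v = 0"

text \<open>
  The exterior square is realised as the space of antisymmetric 4 by 4 matrices, with
  \<open>v \<and> w = v \<otimes> w - w \<otimes> v\<close>; the entries with \<open>i < j\<close> are the Pluecker coordinates. The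
  pseudo-Euclidean scalar product on bivectors plays no role for a componentwise Laplacian.
\<close>

definition wedge :: "real^4 \<Rightarrow> real^4 \<Rightarrow> real^4^4" where
  "wedge v w = (\<chi> i j. v$i * w$j - v$j * w$i)"


section \<open>Oriented surfaces\<close>

text \<open>
  A surface is an abstract two-dimensional manifold \<open>M\<close>, given by an atlas \<open>A\<close> of local
  parametrisations \<open>(V, \<psi>)\<close>, i.e. of inverses of charts. It is oriented by the atlas: all
  transition maps have positive Jacobian. As usual, manifolds are connected.
\<close>

definition oriented_surface ::
  "'p topology \<Rightarrow> ((real^2) set \<times> (real^2 \<Rightarrow> 'p)) set \<Rightarrow> bool" where
  "oriented_surface M A \<longleftrightarrow>
     Hausdorff_space M \<and> second_countable M \<and> connected_space M \<and>
     topspace M = (\<Union>(V, \<psi>)\<in>A. \<psi> ` V) \<and>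
     (\<forall>(V, \<psi>)\<in>A. open V \<and> openin M (\<psi> ` V) \<and> embedding_map (top_of_set V) M \<psi>) \<and>
     (\<forall>(V, \<psi>)\<in>A. \<forall>(W, \<phi>)\<in>A.
        let S = V \<inter> \<psi> -` (\<phi> ` W); \<tau> = inv_into W \<phi> \<circ> \<psi> in
        smooth_on S \<tau> \<and> (\<forall>u\<in>S. det (matrix (frechet_derivative \<tau> (at u))) > 0))"


section \<open>Geometry of a parametrised surface\<close>

text \<open>
  Here \<open>f :: real^2 \<Rightarrow> real^4\<close> is a local parametrisation of the surface in Minkowski space.
  A tangent vector field \<open>X\<close> is given by its components \<open>real^2 \<Rightarrow> real^2\<close> with respect to the
  coordinate fields; the vector field along \<open>f\<close> it stands for is \<open>push f X\<close>.
\<close>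

definition push :: "(real^2 \<Rightarrow> real^4) \<Rightarrow> (real^2 \<Rightarrow> real^2) \<Rightarrow> real^2 \<Rightarrow> real^4" where
  "push f X u = frechet_derivative f (at u) (X u)"

definition tangent_space :: "(real^2 \<Rightarrow> real^4) \<Rightarrow> real^2 \<Rightarrow> (real^4) set" where
  "tangent_space f u = range (frechet_derivative f (at u))"

definition normal_space :: "(real^2 \<Rightarrow> real^4) \<Rightarrow> real^2 \<Rightarrow> (real^4) set" where
  "normal_space f u = {\<xi>. \<forall>v\<in>tangent_space f u. lorentz \<xi> v = 0}"

definition coord_field :: "2 \<Rightarrow> real^2 \<Rightarrow> real^2" where
  "coord_field i = (\<lambda>u. axis i 1)"

definition partial_deriv :: "2 \<Rightarrow> (real^2 \<Rightarrow> 'b::real_normed_vector) \<Rightarrow> real^2 \<Rightarrow> 'b" where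
  "partial_deriv i F u = frechet_derivative F (at u) (axis i 1)"

definition induced_metric ::
  "(real^2 \<Rightarrow> real^4) \<Rightarrow> (real^2 \<Rightarrow> real^2) \<Rightarrow> (real^2 \<Rightarrow> real^2) \<Rightarrow> real^2 \<Rightarrow> real" where
  "induced_metric f X Y u = lorentz (push f X u) (push f Y u)"

definition metric_matrix :: "(real^2 \<Rightarrow> real^4) \<Rightarrow> real^2 \<Rightarrow> real^2^2" where
  "metric_matrix f u = (\<chi> i j. induced_metric f (coord_field i) (coord_field j) u)"

definition christoffel :: "(real^2 \<Rightarrow> real^4) \<Rightarrow> 2 \<Rightarrow> 2 \<Rightarrow> 2 \<Rightarrow> real^2 \<Rightarrow> real" where
  "christoffel f k i j u = (1/2) * (\<Sum>l\<in>UNIV. matrix_inv (metric_matrix f u) $ k $ l *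
     (partial_deriv i (\<lambda>w. metric_matrix f w $ j $ l) u
      + partial_deriv j (\<lambda>w. metric_matrix f w $ i $ l) u
      - partial_deriv l (\<lambda>w. metric_matrix f w $ i $ j) u))"

text \<open>The Levi-Civita connection of the induced metric.\<close>

definition cov_deriv ::
  "(real^2 \<Rightarrow> real^4) \<Rightarrow> (real^2 \<Rightarrow> real^2) \<Rightarrow> (real^2 \<Rightarrow> real^2) \<Rightarrow> real^2 \<Rightarrow> real^2" where
  "cov_deriv f X Y u = frechet_derivative Y (at u) (X u)
     + (\<chi> k. \<Sum>i\<in>UNIV. \<Sum>j\<in>UNIV. christoffel f k i j u * X u $ i * Y u $ j)"

text \<open>
  The Gaussian curvature is the sectional curvature of the induced metric,
  \<open>K = \<langle>R(X, Y) Y, X\<rangle> / (\<langle>X, X\<rangle> \<langle>Y, Y\<rangle> - \<langle>X, Y\<rangle>\<^sup>2)\<close>, evaluated on the coordinate fields, whose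
  Lie bracket vanishes.
\<close>

definition gaussian_curvature :: "(real^2 \<Rightarrow> real^4) \<Rightarrow> real^2 \<Rightarrow> real" where
  "gaussian_curvature f u =
     (let X = coord_field 1; Y = coord_field 2;
          R = (\<lambda>w. cov_deriv f X (cov_deriv f Y Y) w - cov_deriv f Y (cov_deriv f X Y) w)
      in induced_metric f R X u / det (metric_matrix f u))"

text \<open>
  The connection of Minkowski space is the flat one, so for a vector field \<open>\<xi>\<close> along \<open>f\<close> its
  derivative in direction \<open>X\<close> is the ordinary directional derivative.
\<close>

definition ambient_deriv ::
  "(real^2 \<Rightarrow> real^2) \<Rightarrow> (real^2 \<Rightarrow> real^4) \<Rightarrow> real^2 \<Rightarrow> real^4" where
  "ambient_deriv X \<xi> u = frechet_derivative \<xi> (at u) (X u)"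

text \<open>Gauss formula.\<close>

definition second_form ::
  "(real^2 \<Rightarrow> real^4) \<Rightarrow> (real^2 \<Rightarrow> real^2) \<Rightarrow> (real^2 \<Rightarrow> real^2) \<Rightarrow> real^2 \<Rightarrow> real^4" where
  "second_form f X Y u = ambient_deriv X (push f Y) u - push f (cov_deriv f X Y) u"

text \<open>
  Weingarten formula: for a normal field \<open>\<xi>\<close>, the ambient derivative splits uniquely as a
  tangent vector (minus the shape operator) plus the normal vector \<open>D\<^sub>X \<xi>\<close>.
\<close>

definition normal_deriv ::
  "(real^2 \<Rightarrow> real^4) \<Rightarrow> (real^2 \<Rightarrow> real^2) \<Rightarrow> (real^2 \<Rightarrow> real^4) \<Rightarrow> real^2 \<Rightarrow> real^4" where
  "normal_deriv f X \<xi> u =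
     (THE n. n \<in> normal_space f u \<and> ambient_deriv X \<xi> u - n \<in> tangent_space f u)"


subsection \<open>Local orthonormal frames\<close>

definition tangent_frame ::
  "(real^2 \<Rightarrow> real^4) \<Rightarrow> (real^2) set \<Rightarrow> (real^2 \<Rightarrow> real^2) \<Rightarrow> (real^2 \<Rightarrow> real^2) \<Rightarrow> bool" where
  "tangent_frame f W e1 e2 \<longleftrightarrow> open W \<and> smooth_on W e1 \<and> smooth_on W e2 \<and>
     (\<forall>u\<in>W. induced_metric f e1 e1 u = 1 \<and> induced_metric f e2 e2 u = 1 \<and>
            induced_metric f e1 e2 u = 0)"

text \<open>
  The normal spaces of a space-like surface are Lorentzian planes; either of \<open>e3\<close>, \<open>e4\<close> may be
  the time-like one. Orientedness means that \<open>(e1, e2)\<close> is positive on the surface and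
  \<open>(e1, e2, e3, e4)\<close> is positive in \<open>real^4\<close>, which orients the normal planes.
\<close>

definition oriented_frame ::
  "(real^2 \<Rightarrow> real^4) \<Rightarrow> (real^2) set \<Rightarrow> (real^2 \<Rightarrow> real^2) \<Rightarrow> (real^2 \<Rightarrow> real^2) \<Rightarrow>
   (real^2 \<Rightarrow> real^4) \<Rightarrow> (real^2 \<Rightarrow> real^4) \<Rightarrow> bool" where
  "oriented_frame f W e1 e2 e3 e4 \<longleftrightarrow> tangent_frame f W e1 e2 \<and>
     smooth_on W e3 \<and> smooth_on W e4 \<and>
     (\<forall>u\<in>W. e3 u \<in> normal_space f u \<and> e4 u \<in> normal_space f u \<and>
            \<bar>lorentz (e3 u) (e3 u)\<bar> = 1 \<and> \<bar>lorentz (e4 u) (e4 u)\<bar> = 1 \<and>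
            lorentz (e3 u) (e4 u) = 0 \<and>
            det (vector [e1 u, e2 u] :: real^2^2) > 0 \<and>
            det (vector [push f e1 u, push f e2 u, e3 u, e4 u] :: real^4^4) > 0)"

definition mean_curvature ::
  "(real^2 \<Rightarrow> real^4) \<Rightarrow> (real^2 \<Rightarrow> real^2) \<Rightarrow> (real^2 \<Rightarrow> real^2) \<Rightarrow> real^2 \<Rightarrow> real^4" where
  "mean_curvature f e1 e2 u = (1/2) *\<^sub>R (second_form f e1 e1 u + second_form f e2 e2 u)"

definition dir_deriv ::
  "(real^2 \<Rightarrow> real^2) \<Rightarrow> (real^2 \<Rightarrow> 'b::real_normed_vector) \<Rightarrow> real^2 \<Rightarrow> 'b" where
  "dir_deriv X F u = frechet_derivative F (at u) (X u)"

text \<open>\<open>\<Delta> = \<Sum>\<^sub>i (\<nabla>\<^bsub>e\<^sub>i\<^esub> e\<^sub>i - e\<^sub>i e\<^sub>i)\<close>; for vector-valued functions this is componentwise.\<close>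

definition laplacian ::
  "(real^2 \<Rightarrow> real^4) \<Rightarrow> (real^2 \<Rightarrow> real^2) \<Rightarrow> (real^2 \<Rightarrow> real^2) \<Rightarrow>
   (real^2 \<Rightarrow> 'b::real_normed_vector) \<Rightarrow> real^2 \<Rightarrow> 'b" where
  "laplacian f e1 e2 F u =
     (dir_deriv (cov_deriv f e1 e1) F u - dir_deriv e1 (dir_deriv e1 F) u)
   + (dir_deriv (cov_deriv f e2 e2) F u - dir_deriv e2 (dir_deriv e2 F) u)"


section \<open>Space-like surfaces in Minkowski space\<close>

text \<open>
  The surface \<open>M\<close> lies in Minkowski space by an immersion \<open>x\<close> (possibly an inclusion). Geometric
  properties are those of all the local parametrisations \<open>x \<circ> \<psi>\<close>; the mean curvature vector and
  the Laplacian do not depend on the local orthonormal frame, and such frames exist around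
  every point, so properties of them are stated for all frames.
\<close>

definition spacelike_immersion ::
  "((real^2) set \<times> (real^2 \<Rightarrow> 'p)) set \<Rightarrow> ('p \<Rightarrow> real^4) \<Rightarrow> bool" where
  "spacelike_immersion A x \<longleftrightarrow> (\<forall>(V, \<psi>)\<in>A. smooth_on V (x \<circ> \<psi>) \<and>
     (\<forall>u\<in>V. inj (frechet_derivative (x \<circ> \<psi>) (at u)) \<and>
            (\<forall>v\<in>tangent_space (x \<circ> \<psi>) u. v \<noteq> 0 \<longrightarrow> lorentz v v > 0)))"

definition maximal_surface ::
  "((real^2) set \<times> (real^2 \<Rightarrow> 'p)) set \<Rightarrow> ('p \<Rightarrow> real^4) \<Rightarrow> bool" where
  "maximal_surface A x \<longleftrightarrow>
     (\<forall>(V, \<psi>)\<in>A. \<forall>W e1 e2. W \<subseteq> V \<and> tangent_frame (x \<circ> \<psi>) W e1 e2 \<longrightarrow>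
        (\<forall>u\<in>W. mean_curvature (x \<circ> \<psi>) e1 e2 u = 0))"

definition lightlike_mean_curvature ::
  "((real^2) set \<times> (real^2 \<Rightarrow> 'p)) set \<Rightarrow> ('p \<Rightarrow> real^4) \<Rightarrow> bool" where
  "lightlike_mean_curvature A x \<longleftrightarrow>
     (\<forall>(V, \<psi>)\<in>A. \<forall>W e1 e2. W \<subseteq> V \<and> tangent_frame (x \<circ> \<psi>) W e1 e2 \<longrightarrow>
        (\<forall>u\<in>W. light_like (mean_curvature (x \<circ> \<psi>) e1 e2 u)))"

definition parallel_mean_curvature ::
  "((real^2) set \<times> (real^2 \<Rightarrow> 'p)) set \<Rightarrow> ('p \<Rightarrow> real^4) \<Rightarrow> bool" where
  "parallel_mean_curvature A x \<longleftrightarrow>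
     (\<forall>(V, \<psi>)\<in>A. \<forall>W e1 e2. W \<subseteq> V \<and> tangent_frame (x \<circ> \<psi>) W e1 e2 \<longrightarrow>
        (\<forall>X. \<forall>u\<in>W. normal_deriv (x \<circ> \<psi>) X (mean_curvature (x \<circ> \<psi>) e1 e2) u = 0))"

definition flat_surface ::
  "((real^2) set \<times> (real^2 \<Rightarrow> 'p)) set \<Rightarrow> ('p \<Rightarrow> real^4) \<Rightarrow> bool" where
  "flat_surface A x \<longleftrightarrow> (\<forall>(V, \<psi>)\<in>A. \<forall>u\<in>V. gaussian_curvature (x \<circ> \<psi>) u = 0)"

text \<open>
  On a space-like oriented surface \<open>e3 \<and> e4\<close> at \<open>p\<close> is the same for all oriented frames around
  \<open>p\<close>, hence \<open>THE\<close>.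
\<close>

definition gauss_map ::
  "((real^2) set \<times> (real^2 \<Rightarrow> 'p)) set \<Rightarrow> ('p \<Rightarrow> real^4) \<Rightarrow> 'p \<Rightarrow> real^4^4" where
  "gauss_map A x p = (THE \<omega>. \<exists>(V, \<psi>)\<in>A. \<exists>W e1 e2 e3 e4. \<exists>u\<in>W. W \<subseteq> V \<and> \<psi> u = p \<and>
     oriented_frame (x \<circ> \<psi>) W e1 e2 e3 e4 \<and> \<omega> = wedge (e3 u) (e4 u))"

definition harmonic_on_surface ::
  "((real^2) set \<times> (real^2 \<Rightarrow> 'p)) set \<Rightarrow> ('p \<Rightarrow> real^4) \<Rightarrow> ('p \<Rightarrow> 'b::real_normed_vector) \<Rightarrow> bool"
  where
  "harmonic_on_surface A x F \<longleftrightarrow>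
     (\<forall>(V, \<psi>)\<in>A. \<forall>W e1 e2. W \<subseteq> V \<and> tangent_frame (x \<circ> \<psi>) W e1 e2 \<longrightarrow>
        (\<forall>u\<in>W. laplacian (x \<circ> \<psi>) e1 e2 (F \<circ> \<psi>) u = 0))"

end

theory Submission
  imports Defs
begin

text \<open>
  The Gauss map \<open>\<nu> = e3 \<and> e4\<close> is the Hodge dual \<open>\<star>(e1 \<and> e2)\<close>. With \<open>h\<^bsub>ij\<^esub> = h(e\<^sub>i, e\<^sub>j)\<close>, the Codazzi equation gives
  \<open>- \<Delta> \<nu> = 2 \<star>(D\<^bsub>e1\<^esub> H \<and> e2 + e1 \<and> D\<^bsub>e2\<^esub> H) - |h|\<^sup>2 \<nu> + 2 \<star>((h\<^sub>1\<^sub>1 - h\<^sub>2\<^sub>2) \<and> h\<^sub>1\<^sub>2)\<close>,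
  where \<open>|h|\<^sup>2 = 4 \<langle>H, H\<rangle> - 2 K\<close> by the Gauss equation. The terms are linearly independent, so \<open>\<nu>\<close> is
  harmonic iff \<open>D H = 0\<close>, \<open>K = 2 \<langle>H, H\<rangle>\<close> and \<open>(h\<^sub>1\<^sub>1 - h\<^sub>2\<^sub>2) \<and> h\<^sub>1\<^sub>2 = 0\<close>.

  If \<open>\<nu>\<close> is harmonic and \<open>\<langle>H, H\<rangle> \<noteq> 0\<close> somewhere, then \<open>a = (h\<^sub>1\<^sub>1 - h\<^sub>2\<^sub>2)/2\<close> and \<open>b = h\<^sub>1\<^sub>2\<close> are
  proportional, with \<open>\<langle>a, a\<rangle> + \<langle>b, b\<rangle> = - \<langle>H, H\<rangle> \<noteq> 0\<close>; differentiating these relations and using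
  Codazzi, the traceless part of \<open>h\<close> is parallel, so the Ricci identity gives \<open>K a = K b = 0\<close> and
  \<open>K = 0 = 2 \<langle>H, H\<rangle>\<close>, a contradiction. The zero set of the parallel field \<open>H\<close> is open and closed, so a
  non-maximal surface has \<open>H \<noteq> 0\<close> everywhere. Conversely, for light-like parallel \<open>H\<close> the Ricci identity
  \<open>\<langle>H, b\<rangle> a = \<langle>H, a\<rangle> b\<close> forces \<open>a\<close> and \<open>b\<close> to be proportional.
\<close>

section \<open>Smooth maps\<close>

text \<open>The structure equations all come from one identity, \<open>commutator\<close>: applied
  to \<open>E1\<close> and \<open>E2\<close> it yields Codazzi together with Gauss, applied to a
  normal field it yields Ricci. It is formulated in the frame, so Christoffel symbols matter only
  until \<open>cov_deriv\<close> is recognised as a tangential projection.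

  The indefinite normal plane shapes the argument twice. Constancy of <H, H> cannot keep a parallel
  H away from 0, because light-like vectors have the same square as 0; openness of the zero set is
  instead a Gronwall estimate in the Euclidean norm. And a vector that is both orthogonal and
  proportional to v need vanish only if v is not null, which is what <H, H> \<noteq> 0 supplies; the
  light-like case uses that a null line is its own orthogonal complement.

  Tangent frames may have either orientation, varying over \<open>W\<close>, whereas the Gauss map
  is fixed by the atlas. The two are compared through \<open>gauss_bivector\<close>, a coordinate
  expression that agrees with \<star>(e1 \<and> e2) up to a locally constant sign.\<close>

lemma Ck_on_cong:
  assumes "open S" "\<And>u. u \<in> S \<Longrightarrow> f u = g u"
  shows "Ck_on k S f \<longleftrightarrow> Ck_on k S g"
  using assms(2)
proof (induction k arbitrary: f g)
  case 0
  then show ?case by (simp cong: continuous_on_cong)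
next
  case (Suc k)
  have *: "f differentiable (at u) \<longleftrightarrow> g differentiable (at u)" if "u \<in> S" for u
    using has_derivative_transform_within_open[OF _ assms(1) that] Suc.prems
    unfolding differentiable_def by metis
  \<comment> \<open>Agreement holds without differentiability as well:
    \<open>frechet_derivative\<close> chooses from a predicate that is the same for both
    functions.\<close>
  have d: "frechet_derivative f (at u) = frechet_derivative g (at u)" if "u \<in> S" for u
  proof -
    have "(f has_derivative f') (at u) \<longleftrightarrow> (g has_derivative f') (at u)" for f'
      using has_derivative_transform_within_open[OF _ assms(1) that] Suc.prems by metis
    then show ?thesis unfolding frechet_derivative_def by simp
  qed
  have "Ck_on k S (\<lambda>u. frechet_derivative f (at u) v) \<longleftrightarrow>
        Ck_on k S (\<lambda>u. frechet_derivative g (at u) v)" for v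
    using d by (intro Suc.IH) auto
  with * show ?case by auto
qed

text \<open>Derivatives at points of an open set are unique, so any exhibited derivative may replace
  \<open>frechet_derivative\<close>. The closure properties below are inductions on \<open>k\<close>
  over such a formula.\<close>

lemma Ck_on_SucI:
  assumes "open S" "\<And>u. u \<in> S \<Longrightarrow> (f has_derivative f' u) (at u)" "\<And>v. Ck_on k S (\<lambda>u. f' u v)"
  shows "Ck_on (Suc k) S f"
proof -
  have "Ck_on k S (\<lambda>u. frechet_derivative f (at u) v)" for v
    using assms(3)[of v] frechet_derivative_at[OF assms(2)]
    by (subst Ck_on_cong[OF assms(1), of _ "\<lambda>u. f' u v"]) simp_all
  then show ?thesis using assms(2) by (auto intro: differentiableI)
qed

lemma Ck_on_Suc_has_derivative:
  "Ck_on (Suc k) S f \<Longrightarrow> u \<in> S \<Longrightarrow> (f has_derivative frechet_derivative f (at u)) (at u)"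
  using frechet_derivative_works by auto

lemma Ck_on_SucD: "Ck_on (Suc k) S f \<Longrightarrow> Ck_on k S f"
proof (induction k arbitrary: f)
  case 0
  then show ?case
    by (auto intro!: continuous_at_imp_continuous_on differentiable_imp_continuous_within)
next
  case (Suc k)
  then show ?case by auto
qed

lemma Ck_on_subset: "Ck_on k S f \<Longrightarrow> T \<subseteq> S \<Longrightarrow> Ck_on k T f"
  by (induction k arbitrary: f) (auto intro: continuous_on_subset)

lemma Ck_on_const: "Ck_on k S (\<lambda>u. c)"
  by (induction k arbitrary: c) auto

lemma Ck_on_linear:
  assumes "bounded_linear L" "open S" "Ck_on k S f"
  shows "Ck_on k S (\<lambda>u. L (f u))"
  using assms(3)
proof (induction k arbitrary: f)
  case 0
  then show ?case using bounded_linear.continuous_on[OF assms(1)] by auto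
next
  case (Suc k)
  show ?case
    by (rule Ck_on_SucI[OF assms(2) bounded_linear.has_derivative[OF assms(1)
          Ck_on_Suc_has_derivative[OF Suc.prems]] Suc.IH]) (use Suc.prems in auto)
qed

lemma Ck_on_add:
  assumes "open S" "Ck_on k S f" "Ck_on k S g"
  shows "Ck_on k S (\<lambda>u. f u + g u)"
  using assms(2,3)
proof (induction k arbitrary: f g)
  case 0
  then show ?case by (auto intro: continuous_on_add)
next
  case (Suc k)
  show ?case
    by (rule Ck_on_SucI[OF assms(1) has_derivative_add[OF
          Ck_on_Suc_has_derivative[OF Suc.prems(1)] Ck_on_Suc_has_derivative[OF Suc.prems(2)]] Suc.IH])
      (use Suc.prems in auto)
qed

lemma Ck_on_bilinear:
  assumes "bounded_bilinear B" "open S" "Ck_on k S f" "Ck_on k S g"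
  shows "Ck_on k S (\<lambda>u. B (f u) (g u))"
  using assms(3,4)
proof (induction k arbitrary: f g)
  case 0
  then show ?case using bounded_bilinear.continuous_on[OF assms(1)] by auto
next
  case (Suc k)
  show ?case
    by (rule Ck_on_SucI[OF assms(2) bounded_bilinear.FDERIV[OF assms(1)
          Ck_on_Suc_has_derivative[OF Suc.prems(1)] Ck_on_Suc_has_derivative[OF Suc.prems(2)]]
          Ck_on_add[OF assms(2) Suc.IH Suc.IH]])
      (use Suc.prems Ck_on_SucD in auto)
qed

text \<open>The derivative of 1/f contains 1/f again, so the induction bootstraps: class k of 1/f,
  known from the previous stage, gives class k of the derivative. The square root works in the same
  way.\<close>

lemma Ck_on_inverse:
  fixes f :: "'a::real_normed_vector \<Rightarrow> real"
  assumes "open S" "Ck_on k S f" "\<And>u. u \<in> S \<Longrightarrow> f u \<noteq> 0"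
  shows "Ck_on k S (\<lambda>u. inverse (f u))"
  using assms(2)
proof (induction k)
  case 0
  then show ?case using assms by (auto intro: continuous_on_inverse)
next
  case (Suc k)
  have i: "Ck_on k S (\<lambda>u. inverse (f u))" using Suc Ck_on_SucD by blast
  show ?case
    by (rule Ck_on_SucI[OF assms(1) Deriv.has_derivative_inverse[OF assms(3)
          Ck_on_Suc_has_derivative[OF Suc.prems]]
          Ck_on_linear[OF bounded_linear_minus[OF bounded_linear_ident] assms(1)
          Ck_on_bilinear[OF bounded_bilinear_mult assms(1)
          Ck_on_bilinear[OF bounded_bilinear_mult assms(1) i] i]]])
      (use Suc.prems in auto)
qed

lemma Ck_on_sqrt:
  fixes f :: "'a::real_normed_vector \<Rightarrow> real"
  assumes "open S" "Ck_on k S f" "\<And>u. u \<in> S \<Longrightarrow> f u > 0"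
  shows "Ck_on k S (\<lambda>u. sqrt (f u))"
  using assms(2)
proof (induction k)
  case 0
  then show ?case using assms by (auto intro: continuous_intros)
next
  case (Suc k)
  have "Ck_on k S (\<lambda>u. sqrt (f u))" using Suc Ck_on_SucD by blast
  then have i: "Ck_on k S (\<lambda>u. inverse (sqrt (f u)))"
    by (rule Ck_on_inverse[OF assms(1)]) (use assms(3) in fastforce)
  have d: "((\<lambda>u. sqrt (f u)) has_derivative
      (\<lambda>v. inverse (sqrt (f u)) * frechet_derivative f (at u) v / 2)) (at u)"
    if "u \<in> S" for u
    using has_derivative_real_sqrt[OF assms(3)[OF that] Ck_on_Suc_has_derivative[OF Suc.prems that]]
    by (simp add: field_simps)
  show ?case
    by (rule Ck_on_SucI[OF assms(1) d Ck_on_linear[OF bounded_linear_divide assms(1)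
          Ck_on_bilinear[OF bounded_bilinear_mult assms(1) i]]])
      (use Suc.prems in auto)
qed

lemma smooth_on_cong:
  "open S \<Longrightarrow> (\<And>u. u \<in> S \<Longrightarrow> f u = g u) \<Longrightarrow> smooth_on S f \<longleftrightarrow> smooth_on S g"
  unfolding smooth_on_def using Ck_on_cong by metis

lemma smooth_on_subset: "smooth_on S f \<Longrightarrow> T \<subseteq> S \<Longrightarrow> smooth_on T f"
  unfolding smooth_on_def using Ck_on_subset by metis

lemma smooth_on_const: "smooth_on S (\<lambda>u. c)"
  by (simp add: smooth_on_def Ck_on_const)

lemma smooth_on_linear: "bounded_linear L \<Longrightarrow> open S \<Longrightarrow> smooth_on S f \<Longrightarrow> smooth_on S (\<lambda>u. L (f u))"
  by (simp add: smooth_on_def Ck_on_linear)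

lemma smooth_on_add: "open S \<Longrightarrow> smooth_on S f \<Longrightarrow> smooth_on S g \<Longrightarrow> smooth_on S (\<lambda>u. f u + g u)"
  by (simp add: smooth_on_def Ck_on_add)

lemma smooth_on_bilinear:
  "bounded_bilinear B \<Longrightarrow> open S \<Longrightarrow> smooth_on S f \<Longrightarrow> smooth_on S g \<Longrightarrow> smooth_on S (\<lambda>u. B (f u) (g u))"
  by (simp add: smooth_on_def Ck_on_bilinear)

lemmas smooth_on_scaleR = smooth_on_bilinear[OF bounded_bilinear_scaleR]
lemmas smooth_on_mult = smooth_on_bilinear[OF bounded_bilinear_mult]

lemma smooth_on_uminus: "open S \<Longrightarrow> smooth_on S f \<Longrightarrow> smooth_on S (\<lambda>u. - f u)"
  using smooth_on_linear[OF bounded_linear_minus[OF bounded_linear_ident]] .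

lemma smooth_on_diff: "open S \<Longrightarrow> smooth_on S f \<Longrightarrow> smooth_on S g \<Longrightarrow> smooth_on S (\<lambda>u. f u - g u)"
  using smooth_on_add[OF _ _ smooth_on_uminus] by fastforce

lemma smooth_on_vec_nth: "open S \<Longrightarrow> smooth_on S f \<Longrightarrow> smooth_on S (\<lambda>u. f u $ i)"
  using smooth_on_linear[OF bounded_linear_vec_nth] .

lemma smooth_on_inverse:
  fixes f :: "'a::real_normed_vector \<Rightarrow> real"
  shows "open S \<Longrightarrow> smooth_on S f \<Longrightarrow> (\<And>u. u \<in> S \<Longrightarrow> f u \<noteq> 0) \<Longrightarrow> smooth_on S (\<lambda>u. inverse (f u))"
  unfolding smooth_on_def by (auto intro!: Ck_on_inverse)

lemma smooth_on_sqrt: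
  fixes f :: "'a::real_normed_vector \<Rightarrow> real"
  shows "open S \<Longrightarrow> smooth_on S f \<Longrightarrow> (\<And>u. u \<in> S \<Longrightarrow> f u > 0) \<Longrightarrow> smooth_on S (\<lambda>u. sqrt (f u))"
  unfolding smooth_on_def by (auto intro!: Ck_on_sqrt)

lemma smooth_on_imp_continuous_on: "smooth_on S f \<Longrightarrow> continuous_on S f"
  unfolding smooth_on_def using Ck_on.simps(1) by blast

lemma smooth_on_imp_differentiable: "smooth_on S f \<Longrightarrow> u \<in> S \<Longrightarrow> f differentiable (at u)"
  unfolding smooth_on_def using Ck_on.simps(2) by blast

lemma smooth_on_frechet_derivative: "smooth_on S f \<Longrightarrow> smooth_on S (\<lambda>u. frechet_derivative f (at u) v)"
  unfolding smooth_on_def using Ck_on.simps(2) by blast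

lemma smooth_on_has_derivative:
  "smooth_on S f \<Longrightarrow> u \<in> S \<Longrightarrow> (f has_derivative frechet_derivative f (at u)) (at u)"
  using smooth_on_imp_differentiable frechet_derivative_works by blast

section \<open>Symmetry of mixed second derivatives\<close>

lemma eq_if_nearby_values_eq:
  fixes F G :: "'a::metric_space \<Rightarrow> real"
  assumes "continuous_on S F" "continuous_on S G" "u \<in> S"
    and near: "\<And>e. e > 0 \<Longrightarrow> \<exists>q\<in>S. \<exists>p\<in>S. dist q u < e \<and> dist p u < e \<and> F q = G p"
  shows "F u = G u"
proof (rule ccontr)
  assume "F u \<noteq> G u"
  define e where "e = \<bar>F u - G u\<bar> / 2"
  have e: "e > 0" using \<open>F u \<noteq> G u\<close> by (simp add: e_def)
  obtain d1 where d1: "d1 > 0" "\<forall>p\<in>S. dist p u < d1 \<longrightarrow> dist (F p) (F u) < e"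
    using assms(1,3) e unfolding continuous_on_iff by blast
  obtain d2 where d2: "d2 > 0" "\<forall>p\<in>S. dist p u < d2 \<longrightarrow> dist (G p) (G u) < e"
    using assms(2,3) e unfolding continuous_on_iff by blast
  obtain q p where "q \<in> S" "p \<in> S" "dist q u < min d1 d2" "dist p u < min d1 d2" "F q = G p"
    using near[of "min d1 d2"] d1(1) d2(1) by auto
  then have "dist (F q) (F u) < e" "dist (F q) (G u) < e" using d1 d2 by auto
  then have "\<bar>F u - G u\<bar> < 2 * e" by (simp add: dist_real_def)
  then show False by (simp add: e_def)
qed

text \<open>The second difference f(u + ta + tb) - f(u + ta) - f(u + tb) + f(u) is symmetric in
  \<open>a\<close> and \<open>b\<close>. Two mean value steps turn it into t^2 times either mixed
  derivative, each at its own point near u; continuity then lets both points tend to u.\<close>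

lemma Schwarz_real:
  fixes f :: "'a::real_normed_vector \<Rightarrow> real"
  assumes "open S" "smooth_on S f" "u \<in> S"
  shows "frechet_derivative (\<lambda>w. frechet_derivative f (at w) b) (at u) a =
         frechet_derivative (\<lambda>w. frechet_derivative f (at w) a) (at u) b"
proof -
  let ?D = "\<lambda>a w. frechet_derivative f (at w) a"
  let ?DD = "\<lambda>a b w. frechet_derivative (?D b) (at w) a"
  have key: "\<exists>p. dist p u < d \<and> p \<in> S \<and> f (u + t *\<^sub>R a + t *\<^sub>R b) - f (u + t *\<^sub>R a) - f (u + t *\<^sub>R b) + f u = t * t * ?DD b a p"
    if d: "ball u d \<subseteq> S" "d > 0" and t: "t > 0" "t * (norm a + norm b) < d" for d t a b
  proof -
    have inb: "u + s *\<^sub>R a + r *\<^sub>R b \<in> ball u d" if "0 \<le> s" "s \<le> t" "0 \<le> r" "r \<le> t" for s r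
    proof -
      have "norm (s *\<^sub>R a + r *\<^sub>R b) \<le> s * norm a + r * norm b"
        using that norm_triangle_ineq[of "s *\<^sub>R a" "r *\<^sub>R b"] by simp
      also have "\<dots> \<le> t * norm a + t * norm b"
        using that by (intro add_mono mult_right_mono) auto
      also have "\<dots> < d" using t by (simp add: distrib_left)
      finally have "dist (u + s *\<^sub>R a + r *\<^sub>R b) u < d" by (simp add: dist_norm add.assoc)
      then show ?thesis by (simp add: dist_commute)
    qed
    have inS: "u + s *\<^sub>R a + r *\<^sub>R b \<in> S" if "0 \<le> s" "s \<le> t" "0 \<le> r" "r \<le> t" for s r
      using inb[OF that] d(1) by auto
    have linD: "linear (frechet_derivative f (at w))" if "w \<in> S" for w
      using linear_frechet_derivative smooth_on_imp_differentiable[OF assms(2) that] by blast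
    have der1: "((\<lambda>s. f (u + s *\<^sub>R a + r *\<^sub>R b)) has_real_derivative ?D a (u + s *\<^sub>R a + r *\<^sub>R b)) (at s)"
      if "0 \<le> s" "s \<le> t" "0 \<le> r" "r \<le> t" for s r
    proof -
      have "((\<lambda>s. u + s *\<^sub>R a + r *\<^sub>R b) has_derivative (\<lambda>h. h *\<^sub>R a)) (at s)"
        by (auto intro!: derivative_eq_intros)
      from has_derivative_compose[OF this smooth_on_has_derivative[OF assms(2) inS[OF that]]]
      show ?thesis using linear_cmul[OF linD[OF inS[OF that]]]
        by (simp add: has_field_derivative_def mult.commute[of _ "?D a _"])
    qed
    \<comment> \<open>Mean value theorem in direction \<open>a\<close>, applied to the increment in
      direction \<open>b\<close> as a function of s; a second application, in direction
      \<open>b\<close>, follows.\<close>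
    have "\<exists>s>0. s < t \<and> (f (u + t *\<^sub>R a + t *\<^sub>R b) - f (u + t *\<^sub>R a + 0 *\<^sub>R b)) - (f (u + 0 *\<^sub>R a + t *\<^sub>R b) - f (u + 0 *\<^sub>R a + 0 *\<^sub>R b))
        = (t - 0) * (?D a (u + s *\<^sub>R a + t *\<^sub>R b) - ?D a (u + s *\<^sub>R a + 0 *\<^sub>R b))"
      using t by (intro MVT2 DERIV_diff der1) auto
    then obtain s where s: "0 < s" "s < t" and eq1: "f (u + t *\<^sub>R a + t *\<^sub>R b) - f (u + t *\<^sub>R a) - f (u + t *\<^sub>R b) + f u
        = t * (?D a (u + s *\<^sub>R a + t *\<^sub>R b) - ?D a (u + s *\<^sub>R a))" by auto
    have der2: "((\<lambda>r. ?D a (u + s *\<^sub>R a + r *\<^sub>R b)) has_real_derivative ?DD b a (u + s *\<^sub>R a + r *\<^sub>R b)) (at r)"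
      if "0 \<le> r" "r \<le> t" for r
    proof -
      have i: "u + s *\<^sub>R a + r *\<^sub>R b \<in> S" using inS s that by auto
      have sm: "smooth_on S (?D a)" using smooth_on_frechet_derivative[OF assms(2)] .
      have "((\<lambda>r. u + s *\<^sub>R a + r *\<^sub>R b) has_derivative (\<lambda>h. h *\<^sub>R b)) (at r)"
        by (auto intro!: derivative_eq_intros)
      from has_derivative_compose[OF this smooth_on_has_derivative[OF sm i]]
      show ?thesis
        using linear_cmul[OF linear_frechet_derivative[OF smooth_on_imp_differentiable[OF sm i]]]
        by (simp add: has_field_derivative_def mult.commute[of _ "?DD b a _"])
    qed
    have "\<exists>r>0. r < t \<and> ?D a (u + s *\<^sub>R a + t *\<^sub>R b) - ?D a (u + s *\<^sub>R a + 0 *\<^sub>R b)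
        = (t - 0) * ?DD b a (u + s *\<^sub>R a + r *\<^sub>R b)"
      using t by (intro MVT2 der2) auto
    then obtain r where r: "0 < r" "r < t" and eq2: "?D a (u + s *\<^sub>R a + t *\<^sub>R b) - ?D a (u + s *\<^sub>R a)
        = t * ?DD b a (u + s *\<^sub>R a + r *\<^sub>R b)" by auto
    show ?thesis using eq1 eq2 inb[of s r] inS[of s r] r s
      by (intro exI[of _ "u + s *\<^sub>R a + r *\<^sub>R b"]) (auto simp: dist_commute)
  qed
  have cont: "continuous_on S (?DD a b)" for a b
    by (intro smooth_on_imp_continuous_on smooth_on_frechet_derivative assms)
  obtain d0 where d0: "d0 > 0" "ball u d0 \<subseteq> S"
    using assms(1,3) unfolding open_contains_ball by metis
  show ?thesis
  proof (rule eq_if_nearby_values_eq[OF cont cont assms(3)])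
    fix e :: real assume "e > 0"
    define d where "d = min d0 e"
    have d: "d > 0" "ball u d \<subseteq> S" "d \<le> e" using d0 \<open>e > 0\<close> by (auto simp: d_def)
    \<comment> \<open>The summand 1 keeps the quotient defined for a = b = 0 and makes t (|a| + |b|)
      strictly less than d.\<close>
    define t where "t = d / (norm a + norm b + 1)"
    have n: "norm a + norm b + 1 > 0" using norm_ge_zero[of a] norm_ge_zero[of b] by linarith
    then have t: "t > 0" using d by (simp add: t_def)
    have "t * (norm a + norm b) < t * (norm a + norm b + 1)"
      using t by simp
    also have "\<dots> = d" using n by (simp add: t_def)
    finally have t2: "t * (norm a + norm b) < d" "t * (norm b + norm a) < d" by (simp_all add: add.commute)
    obtain p where p: "dist p u < d" "p \<in> S" "f (u + t *\<^sub>R a + t *\<^sub>R b) - f (u + t *\<^sub>R a) - f (u + t *\<^sub>R b) + f u = t * t * ?DD b a p"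
      using key[OF d(2,1) t t2(1)] by (elim exE conjE)
    obtain q where q: "dist q u < d" "q \<in> S" "f (u + t *\<^sub>R b + t *\<^sub>R a) - f (u + t *\<^sub>R b) - f (u + t *\<^sub>R a) + f u = t * t * ?DD a b q"
      using key[OF d(2,1) t t2(2)] by (elim exE conjE)
    have "u + t *\<^sub>R b + t *\<^sub>R a = u + t *\<^sub>R a + t *\<^sub>R b" by simp
    from q(3)[unfolded this] p(3) have "t * t * ?DD b a p = t * t * ?DD a b q" by linarith
    then have "?DD a b q = ?DD b a p" using t by simp
    then show "\<exists>q\<in>S. \<exists>p\<in>S. dist q u < e \<and> dist p u < e \<and> ?DD a b q = ?DD b a p"
      using p(1,2) q(1,2) d(3) by (intro bexI[of _ q] bexI[of _ p] conjI) auto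
  qed
qed

text \<open>Pairing with a fixed vector \<open>y\<close> commutes with both derivatives and reduces
  the claim to real functions; the inner product on the codomain provides enough such
  functionals.\<close>

lemma Schwarz:
  fixes f :: "'a::real_normed_vector \<Rightarrow> 'b::real_inner"
  assumes "open S" "smooth_on S f" "u \<in> S"
  shows "frechet_derivative (\<lambda>w. frechet_derivative f (at w) b) (at u) a =
         frechet_derivative (\<lambda>w. frechet_derivative f (at w) a) (at u) b"
proof -
  have dd: "frechet_derivative (\<lambda>w. frechet_derivative (\<lambda>w. f w \<bullet> y) (at w) b) (at u) a
      = frechet_derivative (\<lambda>w. frechet_derivative f (at w) b) (at u) a \<bullet> y" for y a b
  proof -
    have inner: "frechet_derivative (\<lambda>w. g w \<bullet> y) (at w) = (\<lambda>v. frechet_derivative g (at w) v \<bullet> y)"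
      if "smooth_on S g" "w \<in> S" for g :: "'a \<Rightarrow> 'b" and w
      using smooth_on_has_derivative[OF that]
      by (intro frechet_derivative_at[symmetric] has_derivative_inner_left)
    have g: "smooth_on S (\<lambda>w. frechet_derivative f (at w) b)"
      using smooth_on_frechet_derivative[OF assms(2)] .
    have "((\<lambda>w. frechet_derivative f (at w) b \<bullet> y) has_derivative
        (\<lambda>v. frechet_derivative (\<lambda>w. frechet_derivative f (at w) b) (at u) v \<bullet> y)) (at u)"
      using smooth_on_has_derivative[OF g assms(3)] by (intro has_derivative_inner_left)
    then have "((\<lambda>w. frechet_derivative (\<lambda>w. f w \<bullet> y) (at w) b) has_derivative
        (\<lambda>v. frechet_derivative (\<lambda>w. frechet_derivative f (at w) b) (at u) v \<bullet> y)) (at u)"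
      by (rule has_derivative_transform_within_open[OF _ assms(1,3)]) (simp add: inner[OF assms(2)])
    then show ?thesis using frechet_derivative_at by metis
  qed
  have "smooth_on S (\<lambda>w. f w \<bullet> y)" for y
    using smooth_on_linear[OF bounded_linear_inner_left assms(1,2)] .
  then have "frechet_derivative (\<lambda>w. frechet_derivative f (at w) b) (at u) a \<bullet> y =
         frechet_derivative (\<lambda>w. frechet_derivative f (at w) a) (at u) b \<bullet> y" for y
    using Schwarz_real[OF assms(1) _ assms(3), of "\<lambda>w. f w \<bullet> y" a b] dd by metis
  then show ?thesis using vector_eq_rdot by blast
qed

section \<open>Minkowski space\<close>

lemma bounded_bilinear_lorentz: "bounded_bilinear lorentz"
  unfolding bilinear_conv_bounded_bilinear[symmetric] bilinear_def lorentz_def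
  by (auto intro!: linearI simp: algebra_simps)

interpretation lorentz: bounded_bilinear lorentz
  by (rule bounded_bilinear_lorentz)

lemma lorentz_commute: "lorentz v w = lorentz w v"
  by (simp add: lorentz_def mult.commute)

lemmas lorentz_simps =
  lorentz.add_left lorentz.add_right lorentz.diff_left lorentz.diff_right
  lorentz.minus_left lorentz.minus_right lorentz.scaleR_left lorentz.scaleR_right
  lorentz.zero_left lorentz.zero_right

section \<open>Volume form, Hodge star and triple product\<close>

definition flip :: "real^4 \<Rightarrow> real^4" where
  "flip v = (\<chi> i. if i = 1 then - v$1 else v$i)"

lemma flip_nth [simp]: "flip v $ 1 = - v$1" "flip v $ 2 = v$2" "flip v $ 3 = v$3" "flip v $ 4 = v$4"
  by (simp_all add: flip_def)

lemma flip_eq_0_iff [simp]: "flip v = 0 \<longleftrightarrow> v = 0"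
  by (simp add: vec_eq_iff forall_4)

text \<open>The determinant with rows a, b, c, d, by Laplace expansion along the first two rows:
  Pluecker coordinates of a \<and> b times the complementary ones of c \<and> d.\<close>

definition vol4 :: "real^4 \<Rightarrow> real^4 \<Rightarrow> real^4 \<Rightarrow> real^4 \<Rightarrow> real" where
  "vol4 a b c d =
     (a$1 * b$2 - a$2 * b$1) * (c$3 * d$4 - c$4 * d$3)
   - (a$1 * b$3 - a$3 * b$1) * (c$2 * d$4 - c$4 * d$2)
   + (a$1 * b$4 - a$4 * b$1) * (c$2 * d$3 - c$3 * d$2)
   + (a$2 * b$3 - a$3 * b$2) * (c$1 * d$4 - c$4 * d$1)
   - (a$2 * b$4 - a$4 * b$2) * (c$1 * d$3 - c$3 * d$1)
   + (a$3 * b$4 - a$4 * b$3) * (c$1 * d$2 - c$2 * d$1)"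

lemma vector_4 [simp]:
  "(vector [w, x, y, z] :: 'a::zero^4) $ 1 = w" "(vector [w, x, y, z] :: 'a^4) $ 2 = x"
  "(vector [w, x, y, z] :: 'a^4) $ 3 = y" "(vector [w, x, y, z] :: 'a^4) $ 4 = z"
  unfolding vector_def by simp_all

lemma det_4:
  "det (A :: 'a::comm_ring_1^4^4) =
     A$1$1 * det (vector [vector [A$2$2, A$2$3, A$2$4], vector [A$3$2, A$3$3, A$3$4], vector [A$4$2, A$4$3, A$4$4]] :: 'a^3^3)
   - A$1$2 * det (vector [vector [A$2$1, A$2$3, A$2$4], vector [A$3$1, A$3$3, A$3$4], vector [A$4$1, A$4$3, A$4$4]] :: 'a^3^3)
   + A$1$3 * det (vector [vector [A$2$1, A$2$2, A$2$4], vector [A$3$1, A$3$2, A$3$4], vector [A$4$1, A$4$2, A$4$4]] :: 'a^3^3)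
   - A$1$4 * det (vector [vector [A$2$1, A$2$2, A$2$3], vector [A$3$1, A$3$2, A$3$3], vector [A$4$1, A$4$2, A$4$3]] :: 'a^3^3)"
proof -
  have f1: "finite {2::4, 3, 4}" "1 \<notin> {2::4, 3, 4}" by auto
  have f2: "finite {3::4, 4}" "2 \<notin> {3::4, 4}" by auto
  have f3: "finite {4::4}" "3 \<notin> {4::4}" by auto
  show ?thesis
    unfolding det_def[of A] UNIV_4
    unfolding sum_over_permutations_insert[OF f1]
    unfolding sum_over_permutations_insert[OF f2]
    unfolding sum_over_permutations_insert[OF f3]
    unfolding permutes_sing
    by (simp add: det_3 sign_swap_id permutation_swap_id permutation_compose sign_compose sign_id swap_id_eq
        transpose_def algebra_simps)
qed

lemma det_vector4: "det (vector [a, b, c, d] :: real^4^4) = vol4 a b c d"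
  by (simp add: det_4 det_3 vol4_def algebra_simps)

lemma vol4_alt [simp]:
  "vol4 a a c d = 0" "vol4 a b c c = 0" "vol4 a b a d = 0" "vol4 a b c a = 0" "vol4 a b b d = 0" "vol4 a b c b = 0"
  by (simp_all add: vol4_def algebra_simps)

lemma vol4_swap: "vol4 b a c d = - vol4 a b c d" "vol4 a b d c = - vol4 a b c d"
  by (simp_all add: vol4_def algebra_simps)

lemma vol4_linear:
  "vol4 (x + y) b c d = vol4 x b c d + vol4 y b c d" "vol4 (r *\<^sub>R x) b c d = r * vol4 x b c d"
  "vol4 a (x + y) c d = vol4 a x c d + vol4 a y c d" "vol4 a (r *\<^sub>R x) c d = r * vol4 a x c d"
  "vol4 a b (x + y) d = vol4 a b x d + vol4 a b y d" "vol4 a b (r *\<^sub>R x) d = r * vol4 a b x d"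
  "vol4 a b c (x + y) = vol4 a b c x + vol4 a b c y" "vol4 a b c (r *\<^sub>R x) = r * vol4 a b c x"
  "vol4 (x - y) b c d = vol4 x b c d - vol4 y b c d" "vol4 a (x - y) c d = vol4 a x c d - vol4 a y c d"
  "vol4 a b (x - y) d = vol4 a b x d - vol4 a b y d" "vol4 a b c (x - y) = vol4 a b c x - vol4 a b c y"
  by (simp_all add: vol4_def algebra_simps)

text \<open>The Hodge star of v \<and> w: the two-form \<open>vol4 v w\<close> with both indices
  raised by \<open>flip\<close>. The minus sign offsets the signature of the normal plane, so that a
  positive orthonormal frame satisfies \<open>wedge e3 e4 = hodge e1 e2\<close>.\<close>

definition hodge :: "real^4 \<Rightarrow> real^4 \<Rightarrow> real^4^4" where
  "hodge v w = (\<chi> i j. - vol4 v w (flip (axis i 1)) (flip (axis j 1)))"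

lemma bounded_bilinear_hodge: "bounded_bilinear hodge"
  unfolding bilinear_conv_bounded_bilinear[symmetric] bilinear_def
  by (auto intro!: linearI simp: hodge_def vec_eq_iff vol4_linear)

interpretation hodge: bounded_bilinear hodge
  by (rule bounded_bilinear_hodge)

lemma hodge_alt [simp]: "hodge v v = 0"
  by (simp add: hodge_def vec_eq_iff)

lemma hodge_swap: "hodge w v = - hodge v w"
  by (simp add: hodge_def vec_eq_iff vol4_swap(1)[of w v])

text \<open>Lowers the indices again, so that \<open>pairing c d\<close> recovers
  \<open>vol4 v w c d\<close> from \<open>hodge v w\<close>. Equations between bivectors are tested
  in this way by evaluating determinants.\<close>

definition pairing :: "real^4 \<Rightarrow> real^4 \<Rightarrow> real^4^4 \<Rightarrow> real" where
  "pairing c d m = - (\<Sum>i\<in>UNIV. \<Sum>j\<in>UNIV. m$i$j * flip c$i * flip d$j)"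

lemma linear_pairing: "linear (pairing c d)"
  by (rule linearI) (simp_all add: pairing_def sum.distrib sum_negf sum_distrib_left algebra_simps)

lemma pairing_hodge: "pairing c d (hodge v w) = vol4 v w c d"
  unfolding pairing_def sum_4 hodge_def vol4_def
  by (simp add: axis_def algebra_simps)

text \<open>The metric dual of the linear form \<open>vol4 a b c\<close>, hence orthogonal to all
  three arguments. It supplies the last vector of a positive frame.\<close>

definition cross4 :: "real^4 \<Rightarrow> real^4 \<Rightarrow> real^4 \<Rightarrow> real^4" where
  "cross4 a b c = flip (\<chi> j. vol4 a b c (axis j 1))"

lemma lorentz_cross4: "lorentz (cross4 a b c) w = vol4 a b c w"
  by (simp add: lorentz_def cross4_def vol4_def axis_def algebra_simps)

text \<open>The bracket on the right is the Gram determinant of a, b, c; the sign in front comes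
  from the determinant -1 of the Lorentz metric.\<close>

lemma lorentz_cross4_self:
  "lorentz (cross4 a b c) (cross4 a b c) = - (
     lorentz a a * (lorentz b b * lorentz c c - lorentz b c * lorentz b c)
   - lorentz a b * (lorentz a b * lorentz c c - lorentz b c * lorentz a c)
   + lorentz a c * (lorentz a b * lorentz b c - lorentz b b * lorentz a c))"
  by (simp add: lorentz_def cross4_def vol4_def axis_def) algebra

text \<open>Which of \<open>e3\<close>, \<open>e4\<close> is time-like is left open. The Gram
  determinant of the frame is at once the product of their two signs and minus the squared volume,
  so the signs are opposite and the volume is 1. Only the product of the signs enters the Hodge
  identity.\<close>

lemma lorentz_frame_pos:
  assumes o: "lorentz e1 e1 = 1" "lorentz e2 e2 = 1" "lorentz e1 e2 = 0"
    "lorentz e1 e3 = 0" "lorentz e2 e3 = 0" "lorentz e1 e4 = 0" "lorentz e2 e4 = 0"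
    "lorentz e3 e4 = 0"
    and s: "\<bar>lorentz e3 e3\<bar> = 1" "\<bar>lorentz e4 e4\<bar> = 1"
    and pos: "vol4 e1 e2 e3 e4 > 0"
  shows lorentz_frame_signature: "lorentz e3 e3 * lorentz e4 e4 = -1"
    and lorentz_frame_vol: "vol4 e1 e2 e3 e4 = 1"
    and lorentz_frame_expand: "v = lorentz v e1 *\<^sub>R e1 + lorentz v e2 *\<^sub>R e2
      + (lorentz e3 e3 * lorentz v e3) *\<^sub>R e3 + (lorentz e4 e4 * lorentz v e4) *\<^sub>R e4"
    and lorentz_frame_hodge: "wedge e3 e4 = hodge e1 e2"
proof -
  let ?B = "vector [e1, e2, e3, e4] :: real^4^4"
  let ?C = "vector [flip e1, flip e2, flip e3, flip e4] :: real^4^4"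
  note o' = o o(3-8)[THEN trans[OF lorentz_commute]]
  \<comment> \<open>\<open>flip\<close> lowers an index, so this product is the Gram matrix of the
    frame.\<close>
  have "\<forall>i j. (?C ** transpose ?B) $ i $ j = lorentz (?B $ i) (?B $ j)"
    by (simp add: forall_4 matrix_matrix_mult_def transpose_def lorentz_def sum_4)
  then have "det (?C ** transpose ?B) = lorentz e3 e3 * lorentz e4 e4"
    using o' by (simp add: det_4 det_3)
  moreover have "det ?C = - det ?B" by (simp add: det_vector4 vol4_def algebra_simps)
  ultimately have d: "lorentz e3 e3 * lorentz e4 e4 = - (vol4 e1 e2 e3 e4)\<^sup>2"
    by (simp add: det_mul det_transpose det_vector4 power2_eq_square)
  have "\<bar>lorentz e3 e3 * lorentz e4 e4\<bar> = 1" using s by (simp add: abs_mult)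
  then have v2: "(vol4 e1 e2 e3 e4)\<^sup>2 = 1" using d by simp
  then show v1: "vol4 e1 e2 e3 e4 = 1" using pos by (simp add: power2_eq_1_iff)
  show st: "lorentz e3 e3 * lorentz e4 e4 = -1" using v1 d by simp
  have sq: "lorentz e3 e3 * lorentz e3 e3 = 1" "lorentz e4 e4 * lorentz e4 e4 = 1"
    using s by (simp_all add: abs_if split: if_splits)
  show expand: "v = lorentz v e1 *\<^sub>R e1 + lorentz v e2 *\<^sub>R e2
      + (lorentz e3 e3 * lorentz v e3) *\<^sub>R e3 + (lorentz e4 e4 * lorentz v e4) *\<^sub>R e4" for v
  proof -
    \<comment> \<open>The remainder is orthogonal to the four frame vectors. They form a basis
      because their volume is 1, so it vanishes by nondegeneracy.\<close>
    let ?w = "v - (lorentz v e1 *\<^sub>R e1 + lorentz v e2 *\<^sub>R e2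
      + (lorentz e3 e3 * lorentz v e3) *\<^sub>R e3 + (lorentz e4 e4 * lorentz v e4) *\<^sub>R e4)"
    have "lorentz ?w e1 = 0" "lorentz ?w e2 = 0" "lorentz ?w e3 = 0" "lorentz ?w e4 = 0"
      using o' sq by (auto simp: lorentz_simps algebra_simps)
    then have "?B *v flip ?w = 0"
      by (simp add: vec_eq_iff forall_4 matrix_vector_mult_def sum_4 lorentz_def algebra_simps)
    moreover have "invertible ?B" using v1 by (simp add: invertible_det_nz det_vector4)
    ultimately have "flip ?w = 0"
      by (metis invertible_def matrix_left_invertible_ker)
    then have "?w = 0" by simp
    then show ?thesis by (simp only: right_minus_eq)
  qed
  \<comment> \<open>Components along \<open>e1\<close> and \<open>e2\<close> drop out of the
    alternating form; the sign is the product of the two normal signs.\<close>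
  have vol: "vol4 e1 e2 a b = - (lorentz a e3 * lorentz b e4 - lorentz a e4 * lorentz b e3)" for a b
  proof -
    have "vol4 e1 e2 a b = (lorentz e3 e3 * lorentz e4 e4) * (lorentz a e3 * lorentz b e4 - lorentz a e4 * lorentz b e3)"
      apply (subst expand[of a], subst expand[of b])
      using v1 by (simp add: vol4_linear vol4_swap(2)[of e1 e2 e4 e3] algebra_simps)
    then show ?thesis using st by simp
  qed
  have "lorentz (flip (axis i 1)) e = e $ i" for i e
    using exhaust_4[of i] by (auto simp: lorentz_def axis_def)
  then show "wedge e3 e4 = hodge e1 e2"
    by (simp add: vec_eq_iff wedge_def hodge_def vol algebra_simps)
qed

text \<open>\<open>t\<close> is the normal component of the time axis. Its square is -1 minus two
  squares, so it can be normalised by a formula free of choices, which makes the resulting normal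
  field smooth along a surface; the triple product completes the frame.\<close>

lemma normal_frame_exists:
  assumes o: "lorentz e1 e1 = 1" "lorentz e2 e2 = 1" "lorentz e1 e2 = 0"
  defines "t \<equiv> axis 1 1 - lorentz (axis 1 1) e1 *\<^sub>R e1 - lorentz (axis 1 1) e2 *\<^sub>R e2"
  shows normal_frame_timelike: "lorentz t t < 0"
    and normal_frame_props: "\<And>e3. e3 = inverse (sqrt (- lorentz t t)) *\<^sub>R t \<Longrightarrow>
      lorentz e3 e3 = -1 \<and> lorentz e1 e3 = 0 \<and> lorentz e2 e3 = 0 \<and>
      lorentz e1 (cross4 e1 e2 e3) = 0 \<and> lorentz e2 (cross4 e1 e2 e3) = 0 \<and>
      lorentz e3 (cross4 e1 e2 e3) = 0 \<and> lorentz (cross4 e1 e2 e3) (cross4 e1 e2 e3) = 1 \<and>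
      vol4 e1 e2 e3 (cross4 e1 e2 e3) = 1"
proof -
  have a: "lorentz (axis 1 1) (axis 1 1) = -1" by (simp add: lorentz_def axis_def)
  have o': "lorentz e2 e1 = 0" using o lorentz_commute by metis
  have tt: "lorentz t t = - 1 - (lorentz (axis 1 1) e1)\<^sup>2 - (lorentz (axis 1 1) e2)\<^sup>2"
    unfolding t_def using o o' a
    by (simp add: lorentz_simps lorentz_commute[of e1 "axis 1 1"] lorentz_commute[of e2 "axis 1 1"] algebra_simps power2_eq_square)
  then show neg: "lorentz t t < 0" by (smt (verit) zero_le_power2)
  fix e3 assume e3: "e3 = inverse (sqrt (- lorentz t t)) *\<^sub>R t"
  have t: "lorentz e1 t = 0" "lorentz e2 t = 0"
    unfolding t_def using o o' by (simp_all add: lorentz_simps lorentz_commute[of e1 "axis 1 1"] lorentz_commute[of e2 "axis 1 1"])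
  have n: "lorentz e3 e3 = -1" "lorentz e1 e3 = 0" "lorentz e2 e3 = 0"
    using neg t by (simp_all add: e3 lorentz_simps field_simps flip: power2_eq_square)
  have c: "lorentz (cross4 e1 e2 e3) (cross4 e1 e2 e3) = 1"
    using n o by (simp add: lorentz_cross4_self)
  have p: "lorentz w (cross4 e1 e2 e3) = vol4 e1 e2 e3 w" for w
    using lorentz_commute lorentz_cross4 by metis
  show "lorentz e3 e3 = -1 \<and> lorentz e1 e3 = 0 \<and> lorentz e2 e3 = 0 \<and>
      lorentz e1 (cross4 e1 e2 e3) = 0 \<and> lorentz e2 (cross4 e1 e2 e3) = 0 \<and>
      lorentz e3 (cross4 e1 e2 e3) = 0 \<and> lorentz (cross4 e1 e2 e3) (cross4 e1 e2 e3) = 1 \<and>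
      vol4 e1 e2 e3 (cross4 e1 e2 e3) = 1"
    using n c p[of e1] p[of e2] p[of e3] p[of "cross4 e1 e2 e3"] by simp
qed

section \<open>Derivatives along vector fields\<close>

lemma axis_expansion_2: "(v::real^2) = v$1 *\<^sub>R axis 1 1 + v$2 *\<^sub>R axis 2 1"
  by (simp add: vec_eq_iff forall_2 axis_def)

lemma push_eq: "push f X = dir_deriv X f"
  by (simp add: fun_eq_iff push_def dir_deriv_def)

lemma ambient_deriv_eq: "ambient_deriv X F = dir_deriv X F"
  by (simp add: fun_eq_iff ambient_deriv_def dir_deriv_def)

lemma partial_deriv_eq: "partial_deriv i F = dir_deriv (coord_field i) F"
  by (simp add: fun_eq_iff partial_deriv_def dir_deriv_def coord_field_def)

lemma dir_deriv_eqI: "(F has_derivative F') (at u) \<Longrightarrow> dir_deriv X F u = F' (X u)"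
  unfolding dir_deriv_def using frechet_derivative_at by metis

lemma dir_deriv_bilinear:
  assumes "bounded_bilinear B" "F differentiable (at u)" "G differentiable (at u)"
  shows "dir_deriv X (\<lambda>w. B (F w) (G w)) u = B (F u) (dir_deriv X G u) + B (dir_deriv X F u) (G u)"
  using dir_deriv_eqI[OF bounded_bilinear.FDERIV[OF assms(1) assms(2,3)[unfolded frechet_derivative_works]]]
  by (simp add: dir_deriv_def)

lemmas dir_deriv_scaleR = dir_deriv_bilinear[OF bounded_bilinear_scaleR]
lemmas dir_deriv_lorentz = dir_deriv_bilinear[OF bounded_bilinear_lorentz]
lemmas dir_deriv_hodge = dir_deriv_bilinear[OF bounded_bilinear_hodge]

lemma dir_deriv_linear:
  assumes "bounded_linear L" "F differentiable (at u)"
  shows "dir_deriv X (\<lambda>w. L (F w)) u = L (dir_deriv X F u)"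
  using dir_deriv_eqI[OF bounded_linear.has_derivative[OF assms(1) assms(2)[unfolded frechet_derivative_works]]]
  by (simp add: dir_deriv_def)

lemma dir_deriv_add:
  "F differentiable (at u) \<Longrightarrow> G differentiable (at u) \<Longrightarrow>
   dir_deriv X (\<lambda>w. F w + G w) u = dir_deriv X F u + dir_deriv X G u"
  unfolding frechet_derivative_works
  by (subst dir_deriv_eqI[OF has_derivative_add]) (auto simp: dir_deriv_def)

lemma dir_deriv_diff:
  "F differentiable (at u) \<Longrightarrow> G differentiable (at u) \<Longrightarrow>
   dir_deriv X (\<lambda>w. F w - G w) u = dir_deriv X F u - dir_deriv X G u"
  unfolding frechet_derivative_works
  by (subst dir_deriv_eqI[OF has_derivative_diff]) (auto simp: dir_deriv_def)

lemma dir_deriv_uminus: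
  "F differentiable (at u) \<Longrightarrow> dir_deriv X (\<lambda>w. - F w) u = - dir_deriv X F u"
  by (rule dir_deriv_linear[OF bounded_linear_minus[OF bounded_linear_ident]])

lemma dir_deriv_const [simp]: "dir_deriv X (\<lambda>w. c) u = 0"
  by (simp add: dir_deriv_def)

lemma dir_deriv_cong:
  assumes "open W" "u \<in> W" "\<And>w. w \<in> W \<Longrightarrow> F w = G w"
  shows "dir_deriv X F u = dir_deriv X G u"
proof -
  have "(F has_derivative F') (at u) \<longleftrightarrow> (G has_derivative F') (at u)" for F'
    using has_derivative_transform_within_open[OF _ assms(1,2)] assms(3) by metis
  then show ?thesis unfolding dir_deriv_def frechet_derivative_def by simp
qed

lemma dir_deriv_comb:
  assumes "F differentiable (at u)" "X u = a *\<^sub>R Y u + b *\<^sub>R Z u"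
  shows "dir_deriv X F u = a *\<^sub>R dir_deriv Y F u + b *\<^sub>R dir_deriv Z F u"
  using linear_frechet_derivative[OF assms(1)]
  by (simp add: dir_deriv_def assms(2) linear_add linear_cmul)

lemma dir_deriv_coord:
  fixes F :: "real^2 \<Rightarrow> 'b::real_normed_vector"
  assumes "F differentiable (at u)"
  shows "dir_deriv X F u = X u $ 1 *\<^sub>R partial_deriv 1 F u + X u $ 2 *\<^sub>R partial_deriv 2 F u"
  unfolding partial_deriv_eq
  by (rule dir_deriv_comb[OF assms]) (simp add: coord_field_def flip: axis_expansion_2)

lemma smooth_on_partial_deriv: "smooth_on W F \<Longrightarrow> smooth_on W (partial_deriv i F)"
  using smooth_on_frechet_derivative[of W F "axis i 1"] by (simp add: partial_deriv_def[abs_def])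

lemma smooth_on_coord_field: "smooth_on W (coord_field i)"
  by (simp add: coord_field_def smooth_on_const)

lemma smooth_on_dir_deriv:
  fixes F :: "real^2 \<Rightarrow> 'b::real_normed_vector"
  assumes "open W" "smooth_on W F" "smooth_on W X"
  shows "smooth_on W (dir_deriv X F)"
proof -
  have "smooth_on W (\<lambda>u. X u $ 1 *\<^sub>R partial_deriv 1 F u + X u $ 2 *\<^sub>R partial_deriv 2 F u)"
    by (intro smooth_on_add smooth_on_scaleR smooth_on_vec_nth smooth_on_partial_deriv assms)
  then show ?thesis
    by (subst smooth_on_cong[OF assms(1)])
      (auto intro!: dir_deriv_coord smooth_on_imp_differentiable[OF assms(2)])
qed

text \<open>The Hessian term depends only on the values of X and Y at \<open>u\<close> and is
  symmetric by Schwarz, so in a commutator just the first-order term survives.\<close>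

lemma dir_deriv_dir_deriv:
  fixes F :: "real^2 \<Rightarrow> 'b::real_normed_vector"
  assumes W: "open W" "u \<in> W" and F: "smooth_on W F" and Y: "Y differentiable (at u)"
  shows "dir_deriv X (dir_deriv Y F) u = frechet_derivative F (at u) (dir_deriv X Y u)
    + (\<Sum>i\<in>UNIV. \<Sum>j\<in>UNIV. (X u $ i * Y u $ j) *\<^sub>R partial_deriv i (partial_deriv j F) u)"
proof -
  have dF: "F differentiable (at w)" if "w \<in> W" for w
    using smooth_on_imp_differentiable[OF F that] .
  have dP: "partial_deriv i F differentiable (at u)" for i
    using smooth_on_imp_differentiable[OF smooth_on_partial_deriv[OF F] W(2)] .
  have n: "(\<lambda>w. Y w $ i) differentiable (at u)" for i
    using bounded_linear.has_derivative[OF bounded_linear_vec_nth] Y unfolding differentiable_def by blast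
  have s: "(\<lambda>w. Y w $ i *\<^sub>R partial_deriv i F w) differentiable (at u)" for i
    using n dP by (rule differentiable_scaleR)
  have "dir_deriv X (dir_deriv Y F) u
      = dir_deriv X (\<lambda>w. Y w $ 1 *\<^sub>R partial_deriv 1 F w + Y w $ 2 *\<^sub>R partial_deriv 2 F w) u"
    by (rule dir_deriv_cong[OF W]) (simp add: dir_deriv_coord[OF dF])
  also have "\<dots> = (\<Sum>j\<in>UNIV. Y u $ j *\<^sub>R dir_deriv X (partial_deriv j F) u + dir_deriv X Y u $ j *\<^sub>R partial_deriv j F u)"
    by (simp add: sum_2 dir_deriv_add s dir_deriv_scaleR n dP dir_deriv_linear[OF bounded_linear_vec_nth Y])
  also have "frechet_derivative F (at u) (dir_deriv X Y u) = (\<Sum>j\<in>UNIV. dir_deriv X Y u $ j *\<^sub>R partial_deriv j F u)"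
    using dir_deriv_coord[OF dF[OF W(2)], of "dir_deriv X Y"] by (simp add: dir_deriv_def sum_2)
  then have "(\<Sum>j\<in>UNIV. Y u $ j *\<^sub>R dir_deriv X (partial_deriv j F) u + dir_deriv X Y u $ j *\<^sub>R partial_deriv j F u)
      = frechet_derivative F (at u) (dir_deriv X Y u)
    + (\<Sum>i\<in>UNIV. \<Sum>j\<in>UNIV. (X u $ i * Y u $ j) *\<^sub>R partial_deriv i (partial_deriv j F) u)"
    by (simp add: sum_2 dir_deriv_coord[OF dP] algebra_simps)
  finally show ?thesis .
qed

lemma partial_deriv_commute:
  fixes F :: "real^2 \<Rightarrow> 'b::real_inner"
  assumes "open W" "u \<in> W" "smooth_on W F"
  shows "partial_deriv i (partial_deriv j F) u = partial_deriv j (partial_deriv i F) u"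
  using Schwarz[OF assms(1,3,2), of "axis j 1" "axis i 1"] by (simp add: partial_deriv_def[abs_def])

lemma dir_deriv_commutator:
  fixes F :: "real^2 \<Rightarrow> 'b::real_inner"
  assumes "open W" "u \<in> W" "smooth_on W F" "X differentiable (at u)" "Y differentiable (at u)"
  shows "dir_deriv X (dir_deriv Y F) u - dir_deriv Y (dir_deriv X F) u =
    frechet_derivative F (at u) (dir_deriv X Y u - dir_deriv Y X u)"
  using linear_frechet_derivative[OF smooth_on_imp_differentiable[OF assms(3,2)]]
  by (simp add: dir_deriv_dir_deriv[OF assms(1-3)] assms(4,5) linear_diff sum_2
      partial_deriv_commute[OF assms(1-3), of 2 1] mult.commute)

section \<open>The Levi-Civita connection as a tangential projection\<close>

lemma matrix_inv_works:
  "invertible A \<Longrightarrow> A ** matrix_inv A = mat 1 \<and> matrix_inv A ** A = mat 1"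
  unfolding invertible_def matrix_inv_def by (rule someI_ex)

text \<open>Each metric derivative splits into two products. By symmetry of second derivatives, four
  of the six terms cancel and the other two coincide.\<close>

lemma christoffel_eq:
  assumes W: "open W" "u \<in> W" and f: "smooth_on W f"
  shows "christoffel f k i j u = (\<Sum>l\<in>UNIV. matrix_inv (metric_matrix f u) $ k $ l *
    lorentz (partial_deriv i (partial_deriv j f) u) (partial_deriv l f u))"
proof -
  have d: "partial_deriv i f differentiable (at u)" for i
    using smooth_on_imp_differentiable[OF smooth_on_partial_deriv[OF f] W(2)] .
  have g: "metric_matrix f w $ j $ l = lorentz (partial_deriv j f w) (partial_deriv l f w)" for w j l
    by (simp add: metric_matrix_def induced_metric_def push_eq partial_deriv_eq)
  have dg: "partial_deriv i (\<lambda>w. metric_matrix f w $ j $ l) u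
     = lorentz (partial_deriv j f u) (partial_deriv i (partial_deriv l f) u)
     + lorentz (partial_deriv i (partial_deriv j f) u) (partial_deriv l f u)" for i j l
    unfolding g partial_deriv_eq[of i] by (rule dir_deriv_lorentz[OF d d])
  have "(1/2) * (partial_deriv i (\<lambda>w. metric_matrix f w $ j $ l) u
      + partial_deriv j (\<lambda>w. metric_matrix f w $ i $ l) u
      - partial_deriv l (\<lambda>w. metric_matrix f w $ i $ j) u)
    = lorentz (partial_deriv i (partial_deriv j f) u) (partial_deriv l f u)" for l
    unfolding dg
    by (simp add: partial_deriv_commute[OF W f, of l] partial_deriv_commute[OF W f, of j i]
        lorentz_commute)
  then show ?thesis unfolding christoffel_def sum_distrib_left
    by (simp only: mult.left_commute[of "1/2"])
qed

text \<open>Contraction with the metric cancels the inverse matrix in the Christoffel symbols and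
  leaves the Hessian of f paired with a tangent vector. So the Levi-Civita connection is the
  tangential part of the ambient derivative.\<close>

lemma lorentz_push_cov_deriv:
  assumes W: "open W" "u \<in> W" and f: "smooth_on W f" and Y: "Y differentiable (at u)"
    and inv: "det (metric_matrix f u) \<noteq> 0"
  shows "lorentz (push f (cov_deriv f X Y) u) (partial_deriv m f u) =
    lorentz (dir_deriv X (push f Y) u) (partial_deriv m f u)"
proof -
  let ?F = "\<lambda>i j. partial_deriv i (partial_deriv j f) u"
  have df: "f differentiable (at u)" using smooth_on_imp_differentiable[OF f W(2)] .
  note lin = linear_frechet_derivative[OF df]
  have g: "metric_matrix f w $ j $ l = lorentz (partial_deriv j f w) (partial_deriv l f w)" for w j l
    by (simp add: metric_matrix_def induced_metric_def push_eq partial_deriv_eq)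
  define G where "G = (\<chi> k. \<Sum>i\<in>UNIV. \<Sum>j\<in>UNIV. christoffel f k i j u * X u $ i * Y u $ j)"
  define s where "s = (\<lambda>l. \<Sum>i\<in>UNIV. \<Sum>j\<in>UNIV. X u $ i * Y u $ j * lorentz (?F i j) (partial_deriv l f u))"
  have Gk: "G $ k = (\<Sum>l\<in>UNIV. matrix_inv (metric_matrix f u) $ k $ l * s l)" for k
    unfolding G_def s_def by (simp add: christoffel_eq[OF W f] sum_2 algebra_simps)
  have "metric_matrix f u ** matrix_inv (metric_matrix f u) = mat 1"
    using matrix_inv_works[of "metric_matrix f u"] inv by (simp add: invertible_det_nz)
  then have id: "(\<Sum>k\<in>UNIV. metric_matrix f u $ m $ k * matrix_inv (metric_matrix f u) $ k $ l) = (if m = l then 1 else 0)" for l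
    by (simp add: matrix_matrix_mult_def mat_def vec_eq_iff)
  have "(\<Sum>k\<in>UNIV. metric_matrix f u $ m $ k * G $ k)
      = (\<Sum>l\<in>UNIV. (\<Sum>k\<in>UNIV. metric_matrix f u $ m $ k * matrix_inv (metric_matrix f u) $ k $ l) * s l)"
    unfolding Gk by (simp add: sum_2 algebra_simps)
  also have "\<dots> = s m" unfolding id using exhaust_2[of m] by (auto simp: sum_2)
  finally have Gm: "(\<Sum>k\<in>UNIV. metric_matrix f u $ m $ k * G $ k) = s m" .
  have "frechet_derivative f (at u) G = G$1 *\<^sub>R partial_deriv 1 f u + G$2 *\<^sub>R partial_deriv 2 f u"
    using dir_deriv_coord[OF df, of "\<lambda>_. G"] by (simp add: dir_deriv_def)
  then have "lorentz (frechet_derivative f (at u) G) (partial_deriv m f u) = s m"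
    using Gm by (simp add: sum_2 g lorentz_simps lorentz_commute mult.commute)
  moreover have "push f (cov_deriv f X Y) u = frechet_derivative f (at u) (dir_deriv X Y u) + frechet_derivative f (at u) G"
    by (simp add: push_def cov_deriv_def G_def dir_deriv_def linear_add[OF lin])
  moreover have "s m = lorentz (\<Sum>i\<in>UNIV. \<Sum>j\<in>UNIV. (X u $ i * Y u $ j) *\<^sub>R ?F i j) (partial_deriv m f u)"
    by (simp add: s_def sum_2 lorentz_simps)
  ultimately show ?thesis
    by (simp only: push_eq[of f Y] dir_deriv_dir_deriv[OF W f Y] lorentz_simps)
qed

section \<open>Moving frames\<close>

text \<open>Injectivity and space-likeness follow from the existence of the frame.\<close>

locale framed_surface =
  fixes f :: "real^2 \<Rightarrow> real^4" and W :: "(real^2) set" and e1 e2 :: "real^2 \<Rightarrow> real^2"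
  assumes frame: "tangent_frame f W e1 e2" and smooth: "smooth_on W f"
begin

lemma open_W: "open W" and smooth_e: "smooth_on W e1" "smooth_on W e2"
  using frame by (auto simp: tangent_frame_def)

definition "E1 = push f e1"
definition "E2 = push f e2"

abbreviation "D1 \<equiv> dir_deriv e1"
abbreviation "D2 \<equiv> dir_deriv e2"

lemma smooth_E: "smooth_on W E1" "smooth_on W E2"
  unfolding E1_def E2_def push_eq by (intro smooth_on_dir_deriv open_W smooth smooth_e)+

lemma orthonormal:
  assumes "u \<in> W"
  shows "lorentz (E1 u) (E1 u) = 1" "lorentz (E2 u) (E2 u) = 1"
    "lorentz (E1 u) (E2 u) = 0" "lorentz (E2 u) (E1 u) = 0"
  using frame assms lorentz_commute by (auto simp: tangent_frame_def induced_metric_def E1_def E2_def)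

lemma diff: "smooth_on W F \<Longrightarrow> u \<in> W \<Longrightarrow> F differentiable (at u)"
  by (rule smooth_on_imp_differentiable)

lemma linear_df: "u \<in> W \<Longrightarrow> linear (frechet_derivative f (at u))"
  using linear_frechet_derivative diff[OF smooth] by blast

lemma push_comb: "u \<in> W \<Longrightarrow> frechet_derivative f (at u) (a *\<^sub>R e1 u + b *\<^sub>R e2 u) = a *\<^sub>R E1 u + b *\<^sub>R E2 u"
  using linear_df by (simp add: E1_def E2_def push_def linear_add linear_cmul)

lemma frame_det_nonzero:
  assumes "u \<in> W" shows "e1 u $ 1 * e2 u $ 2 - e1 u $ 2 * e2 u $ 1 \<noteq> 0"
proof
  assume z: "e1 u $ 1 * e2 u $ 2 - e1 u $ 2 * e2 u $ 1 = 0"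
  have comb: "a = 0 \<and> b = 0" if "a *\<^sub>R e1 u + b *\<^sub>R e2 u = 0" for a b
  proof -
    have v: "a *\<^sub>R E1 u + b *\<^sub>R E2 u = 0"
      using push_comb[OF assms, of a b] that linear_0[OF linear_df[OF assms]] by simp
    have "lorentz (a *\<^sub>R E1 u + b *\<^sub>R E2 u) (E1 u) = a" "lorentz (a *\<^sub>R E1 u + b *\<^sub>R E2 u) (E2 u) = b"
      using orthonormal[OF assms] by (simp_all add: lorentz_simps)
    then show ?thesis unfolding v by (simp add: lorentz_simps)
  qed
  \<comment> \<open>As in Cramer's rule: with zero determinant, two combinations of
    \<open>e1 u\<close> and \<open>e2 u\<close> with these coefficients vanish, so every entry of
    the frame is 0.\<close>
  have "e2 u $ 2 = 0 \<and> - e1 u $ 2 = 0" "e2 u $ 1 = 0 \<and> - e1 u $ 1 = 0"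
    using z by (intro comb; simp add: vec_eq_iff forall_2 algebra_simps)+
  then show False using comb[of 1 0] by (simp add: vec_eq_iff forall_2)
qed

lemma frame_expand:
  assumes "u \<in> W"
  obtains a b where "v = a *\<^sub>R e1 u + b *\<^sub>R e2 u"
proof
  let ?d = "e1 u $ 1 * e2 u $ 2 - e1 u $ 2 * e2 u $ 1"
  show "v = ((v$1 * e2 u $ 2 - v$2 * e2 u $ 1) / ?d) *\<^sub>R e1 u
      + ((e1 u $ 1 * v$2 - e1 u $ 2 * v$1) / ?d) *\<^sub>R e2 u"
    (is "v = (?a / _) *\<^sub>R _ + (?b / _) *\<^sub>R _")
  proof -
    have "?a / ?d * x + ?b / ?d * y = (?a * x + ?b * y) / ?d" for x y by (simp add: add_divide_distrib)
    moreover have "?a * e1 u $ 1 + ?b * e2 u $ 1 = v $ 1 * ?d" "?a * e1 u $ 2 + ?b * e2 u $ 2 = v $ 2 * ?d"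
      by (simp_all add: algebra_simps)
    ultimately show ?thesis using frame_det_nonzero[OF assms] by (simp add: vec_eq_iff forall_2)
  qed
qed

lemma tangent_coords:
  assumes "u \<in> W"
  shows "v = lorentz (frechet_derivative f (at u) v) (E1 u) *\<^sub>R e1 u
    + lorentz (frechet_derivative f (at u) v) (E2 u) *\<^sub>R e2 u"
proof -
  obtain a b where v: "v = a *\<^sub>R e1 u + b *\<^sub>R e2 u" using frame_expand[OF assms] .
  show ?thesis unfolding v using orthonormal[OF assms] by (simp add: push_comb assms lorentz_simps)
qed

lemma tangent_expand:
  assumes "u \<in> W"
  shows "frechet_derivative f (at u) v = lorentz (frechet_derivative f (at u) v) (E1 u) *\<^sub>R E1 u
    + lorentz (frechet_derivative f (at u) v) (E2 u) *\<^sub>R E2 u"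
  using tangent_coords[OF assms, of v] push_comb[OF assms] by metis

lemma push_inject:
  "u \<in> W \<Longrightarrow> frechet_derivative f (at u) v = frechet_derivative f (at u) w \<Longrightarrow> v = w"
  using tangent_coords[of u v] tangent_coords[of u w] by simp

lemma tangent_space_eq: "u \<in> W \<Longrightarrow> tangent_space f u = {a *\<^sub>R E1 u + b *\<^sub>R E2 u | a b. True}"
  unfolding tangent_space_def using tangent_expand push_comb[symmetric] by auto

lemma normal_space_eq:
  "u \<in> W \<Longrightarrow> normal_space f u = {\<xi>. lorentz \<xi> (E1 u) = 0 \<and> lorentz \<xi> (E2 u) = 0}"
proof -
  assume u: "u \<in> W"
  have "1 *\<^sub>R E1 u + 0 *\<^sub>R E2 u \<in> tangent_space f u" "0 *\<^sub>R E1 u + 1 *\<^sub>R E2 u \<in> tangent_space f u"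
    unfolding tangent_space_eq[OF u] by blast+
  then have E: "E1 u \<in> tangent_space f u" "E2 u \<in> tangent_space f u" by simp_all
  show ?thesis
  proof (intro set_eqI iffI)
    fix \<xi> assume "\<xi> \<in> normal_space f u"
    then show "\<xi> \<in> {\<xi>. lorentz \<xi> (E1 u) = 0 \<and> lorentz \<xi> (E2 u) = 0}"
      using E by (simp add: normal_space_def)
  next
    fix \<xi> assume "\<xi> \<in> {\<xi>. lorentz \<xi> (E1 u) = 0 \<and> lorentz \<xi> (E2 u) = 0}"
    then show "\<xi> \<in> normal_space f u"
      unfolding normal_space_def tangent_space_eq[OF u] by (auto simp: lorentz_simps)
  qed
qed

definition nor :: "real^2 \<Rightarrow> real^4 \<Rightarrow> real^4" where
  "nor u v = v - lorentz v (E1 u) *\<^sub>R E1 u - lorentz v (E2 u) *\<^sub>R E2 u"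

lemma nor_orthogonal: "u \<in> W \<Longrightarrow> lorentz (nor u v) (E1 u) = 0" "u \<in> W \<Longrightarrow> lorentz (nor u v) (E2 u) = 0"
  using orthonormal[of u] by (simp_all add: nor_def lorentz_simps)

lemma nor_tangent: "u \<in> W \<Longrightarrow> nor u (E1 u) = 0" "u \<in> W \<Longrightarrow> nor u (E2 u) = 0"
  using orthonormal[of u] by (simp_all add: nor_def)

lemma linear_nor: "linear (nor u)"
  by (rule linearI) (simp_all add: nor_def lorentz_simps algebra_simps)

lemmas nor_simps = linear_add[OF linear_nor] linear_cmul[OF linear_nor] linear_diff[OF linear_nor]
  linear_neg[OF linear_nor] linear_0[OF linear_nor]

lemma normal_deriv_eq:
  assumes "u \<in> W" shows "normal_deriv f X \<xi> u = nor u (dir_deriv X \<xi> u)"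
  unfolding normal_deriv_def ambient_deriv_eq
proof (rule the_equality)
  let ?v = "dir_deriv X \<xi> u"
  have "?v - nor u ?v = lorentz ?v (E1 u) *\<^sub>R E1 u + lorentz ?v (E2 u) *\<^sub>R E2 u"
    by (simp add: nor_def)
  then show "nor u ?v \<in> normal_space f u \<and> ?v - nor u ?v \<in> tangent_space f u"
    using nor_orthogonal[OF assms] unfolding normal_space_eq[OF assms] tangent_space_eq[OF assms] by blast
  fix n assume n: "n \<in> normal_space f u \<and> ?v - n \<in> tangent_space f u"
  then obtain a b where ab: "?v - n = a *\<^sub>R E1 u + b *\<^sub>R E2 u"
    unfolding tangent_space_eq[OF assms] by auto
  have "nor u n = n" using n unfolding normal_space_eq[OF assms] by (simp add: nor_def)
  moreover have "nor u (?v - n) = 0" unfolding ab by (simp add: nor_simps nor_tangent[OF assms])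
  ultimately show "n = nor u ?v" by (simp add: nor_simps)
qed

lemma det_metric_matrix: "det (metric_matrix f u) =
    lorentz (partial_deriv 1 f u) (partial_deriv 1 f u) * lorentz (partial_deriv 2 f u) (partial_deriv 2 f u)
    - lorentz (partial_deriv 1 f u) (partial_deriv 2 f u) * lorentz (partial_deriv 1 f u) (partial_deriv 2 f u)"
  by (simp add: det_2 metric_matrix_def induced_metric_def push_eq partial_deriv_eq
      lorentz_commute[of "dir_deriv (coord_field 2) f u" "dir_deriv (coord_field 1) f u"])

lemma E_coords:
  assumes "u \<in> W"
  shows "E1 u = e1 u $ 1 *\<^sub>R partial_deriv 1 f u + e1 u $ 2 *\<^sub>R partial_deriv 2 f u"
    "E2 u = e2 u $ 1 *\<^sub>R partial_deriv 1 f u + e2 u $ 2 *\<^sub>R partial_deriv 2 f u"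
  unfolding E1_def E2_def push_eq by (rule dir_deriv_coord[OF diff[OF smooth assms]])+

lemma frame_det_metric:
  assumes "u \<in> W"
  shows "(e1 u $ 1 * e2 u $ 2 - e1 u $ 2 * e2 u $ 1)\<^sup>2 * det (metric_matrix f u) = 1"
proof -
  let ?g = "\<lambda>i j. lorentz (partial_deriv i f u) (partial_deriv j f u)"
  have "lorentz (E1 u) (E1 u) * lorentz (E2 u) (E2 u) - (lorentz (E1 u) (E2 u))\<^sup>2
    = (e1 u $ 1 * e2 u $ 2 - e1 u $ 2 * e2 u $ 1)\<^sup>2 * det (metric_matrix f u)"
    unfolding det_metric_matrix E_coords[OF assms] lorentz_simps
    by (simp add: lorentz_commute[of "partial_deriv 2 f u" "partial_deriv 1 f u"] power2_eq_square algebra_simps)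
  then show ?thesis using orthonormal[OF assms] by simp
qed

lemma det_metric_nonzero: "u \<in> W \<Longrightarrow> det (metric_matrix f u) \<noteq> 0"
  using frame_det_metric[of u] by auto

lemma push_cov_deriv:
  assumes "u \<in> W" "Y differentiable (at u)"
  shows "push f (cov_deriv f X Y) u = lorentz (dir_deriv X (push f Y) u) (E1 u) *\<^sub>R E1 u
    + lorentz (dir_deriv X (push f Y) u) (E2 u) *\<^sub>R E2 u"
proof -
  let ?a = "push f (cov_deriv f X Y) u" and ?b = "dir_deriv X (push f Y) u"
  have "lorentz ?a (partial_deriv m f u) = lorentz ?b (partial_deriv m f u)" for m
    using lorentz_push_cov_deriv[OF open_W assms(1) smooth assms(2) det_metric_nonzero[OF assms(1)]] .
  then have "lorentz ?a (E1 u) = lorentz ?b (E1 u)" "lorentz ?a (E2 u) = lorentz ?b (E2 u)"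
    by (simp_all add: E_coords[OF assms(1)] lorentz_simps)
  then show ?thesis using tangent_expand[OF assms(1), of "cov_deriv f X Y u"] by (simp add: push_def)
qed

lemma second_form_eq:
  "u \<in> W \<Longrightarrow> Y differentiable (at u) \<Longrightarrow> second_form f X Y u = nor u (dir_deriv X (push f Y) u)"
  by (simp add: second_form_def push_cov_deriv ambient_deriv_eq nor_def)

section \<open>Connection form and structure equations of the frame\<close>

lemma smooth_D: "smooth_on W F \<Longrightarrow> smooth_on W (D1 F)" "smooth_on W F \<Longrightarrow> smooth_on W (D2 F)"
  for F :: "real^2 \<Rightarrow> 'b::real_normed_vector"
  by (intro smooth_on_dir_deriv open_W smooth_e; assumption)+

text \<open>\<open>w1\<close> and \<open>w2\<close> are the values of the connection form of the
  tangent frame on \<open>e1\<close> and \<open>e2\<close>. Removing the tangential rotation leaves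
  the coefficients of the second fundamental form. \<open>h12\<close> is read off from
  \<open>D1 E2\<close>; its symmetry is established only by \<open>D2_E1\<close>.\<close>

definition "w1 u = lorentz (D1 E1 u) (E2 u)"
definition "w2 u = lorentz (D2 E1 u) (E2 u)"
definition "h11 u = D1 E1 u - w1 u *\<^sub>R E2 u"
definition "h12 u = D1 E2 u + w1 u *\<^sub>R E1 u"
definition "h22 u = D2 E2 u + w2 u *\<^sub>R E1 u"

lemma smooth_w: "smooth_on W w1" "smooth_on W w2"
  unfolding w1_def[abs_def] w2_def[abs_def]
  by (intro smooth_on_bilinear[OF bounded_bilinear_lorentz open_W] smooth_D smooth_E)+

lemma smooth_h: "smooth_on W h11" "smooth_on W h12" "smooth_on W h22"
  unfolding h11_def[abs_def] h12_def[abs_def] h22_def[abs_def]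
  by (intro smooth_on_add smooth_on_diff smooth_on_scaleR open_W smooth_D smooth_E smooth_w)+

lemma lorentz_dir_deriv_const:
  assumes "u \<in> W" "smooth_on W F" "smooth_on W G" "\<And>w. w \<in> W \<Longrightarrow> lorentz (F w) (G w) = c"
  shows "lorentz (dir_deriv X F u) (G u) = - lorentz (F u) (dir_deriv X G u)"
proof -
  have "dir_deriv X (\<lambda>w. lorentz (F w) (G w)) u = dir_deriv X (\<lambda>w. c) u"
    by (rule dir_deriv_cong[OF open_W assms(1,4)])
  then show ?thesis
    using dir_deriv_lorentz[OF diff[OF assms(2,1)] diff[OF assms(3,1)]] by simp
qed

lemma D_self_zero:
  assumes "u \<in> W" "smooth_on W F" "\<And>w. w \<in> W \<Longrightarrow> lorentz (F w) (F w) = c"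
  shows "lorentz (dir_deriv X F u) (F u) = 0"
  using lorentz_dir_deriv_const[OF assms(1,2,2,3), of X] lorentz_commute[of "F u"] by simp

lemma frame_derivs:
  assumes "u \<in> W"
  shows "D1 E1 u = w1 u *\<^sub>R E2 u + h11 u" "D1 E2 u = - w1 u *\<^sub>R E1 u + h12 u"
    "D2 E2 u = - w2 u *\<^sub>R E1 u + h22 u"
  by (simp_all add: h11_def h12_def h22_def)

lemma DE_inner:
  assumes "u \<in> W"
  shows "lorentz (D1 E2 u) (E1 u) = - w1 u" "lorentz (D2 E2 u) (E1 u) = - w2 u"
    "lorentz (D1 E1 u) (E1 u) = 0" "lorentz (D2 E1 u) (E1 u) = 0"
    "lorentz (D1 E2 u) (E2 u) = 0" "lorentz (D2 E2 u) (E2 u) = 0"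
  using lorentz_dir_deriv_const[OF assms smooth_E(2,1) orthonormal(4)]
    D_self_zero[OF assms smooth_E(1) orthonormal(1)] D_self_zero[OF assms smooth_E(2) orthonormal(2)]
  by (simp_all add: w1_def w2_def lorentz_commute)

lemma h_normal:
  assumes "u \<in> W"
  shows "lorentz (h11 u) (E1 u) = 0" "lorentz (h11 u) (E2 u) = 0"
    "lorentz (h12 u) (E1 u) = 0" "lorentz (h12 u) (E2 u) = 0"
    "lorentz (h22 u) (E1 u) = 0" "lorentz (h22 u) (E2 u) = 0"
  using orthonormal[OF assms] DE_inner[OF assms]
  by (simp_all add: h11_def h12_def h22_def w1_def w2_def lorentz_simps)

text \<open>Torsion-freeness, from the commutator applied to the parametrisation itself:
  \<open>D1 E2 - D2 E1\<close> is the image of the bracket, hence tangent. Its components give the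
  bracket, and its missing normal part gives the symmetry of the second fundamental form.\<close>

lemma bracket_e: assumes "u \<in> W" shows "D1 e2 u - D2 e1 u = - w1 u *\<^sub>R e1 u - w2 u *\<^sub>R e2 u"
  and D2_E1: "D2 E1 u = w2 u *\<^sub>R E2 u + h12 u"
proof -
  let ?b = "D1 e2 u - D2 e1 u"
  have c: "D1 E2 u - D2 E1 u = frechet_derivative f (at u) ?b"
    unfolding E1_def E2_def push_eq
    by (rule dir_deriv_commutator[OF open_W assms smooth diff[OF smooth_e(1) assms] diff[OF smooth_e(2) assms]])
  have i: "lorentz (D1 E2 u - D2 E1 u) (E1 u) = - w1 u" "lorentz (D1 E2 u - D2 E1 u) (E2 u) = - w2 u"
    using DE_inner[OF assms] by (simp_all add: lorentz_simps w2_def)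
  show "?b = - w1 u *\<^sub>R e1 u - w2 u *\<^sub>R e2 u"
    using tangent_coords[OF assms, of ?b] i unfolding c[symmetric] by simp
  have "D1 E2 u - D2 E1 u = - w1 u *\<^sub>R E1 u - w2 u *\<^sub>R E2 u"
    using tangent_expand[OF assms, of ?b] i unfolding c[symmetric] by simp
  then show "D2 E1 u = w2 u *\<^sub>R E2 u + h12 u"
    by (simp add: h12_def algebra_simps)
qed

lemma commutator:
  fixes F :: "real^2 \<Rightarrow> 'b::real_inner"
  assumes "u \<in> W" "smooth_on W F"
  shows "D1 (D2 F) u - D2 (D1 F) u = - w1 u *\<^sub>R D1 F u - w2 u *\<^sub>R D2 F u"
proof -
  have "linear (frechet_derivative F (at u))" using linear_frechet_derivative[OF diff[OF assms(2,1)]] .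
  then have "frechet_derivative F (at u) (D1 e2 u - D2 e1 u) = - w1 u *\<^sub>R D1 F u - w2 u *\<^sub>R D2 F u"
    unfolding bracket_e[OF assms(1)]
    by (simp only: linear_diff linear_cmul dir_deriv_def)
  then show ?thesis
    using dir_deriv_commutator[OF open_W assms(1,2) diff[OF smooth_e(1) assms(1)] diff[OF smooth_e(2) assms(1)]]
    by simp
qed

text \<open>The exterior derivative of the connection form on (e1, e2); the squares come from the
  bracket term. It equals minus the Gaussian curvature.\<close>

definition "kap u = D1 w2 u - D2 w1 u + w1 u * w1 u + w2 u * w2 u"

lemma dir_deriv_eq_comb:
  fixes N :: "real^2 \<Rightarrow> 'b::real_inner"
  assumes "u \<in> W" "\<And>w. w \<in> W \<Longrightarrow> F w = a w *\<^sub>R E w + N w"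
    "smooth_on W a" "smooth_on W E" "smooth_on W N"
  shows "dir_deriv X F u = a u *\<^sub>R dir_deriv X E u + dir_deriv X a u *\<^sub>R E u + dir_deriv X N u"
proof -
  have "dir_deriv X F u = dir_deriv X (\<lambda>w. a w *\<^sub>R E w + N w) u"
    by (rule dir_deriv_cong[OF open_W assms(1,2)])
  also have "\<dots> = dir_deriv X (\<lambda>w. a w *\<^sub>R E w) u + dir_deriv X N u"
    by (intro dir_deriv_add diff[OF _ assms(1)] smooth_on_scaleR open_W assms)
  also have "dir_deriv X (\<lambda>w. a w *\<^sub>R E w) u = a u *\<^sub>R dir_deriv X E u + dir_deriv X a u *\<^sub>R E u"
    by (intro dir_deriv_scaleR diff[OF _ assms(1)] assms)
  finally show ?thesis .
qed

text \<open>The commutator applied to \<open>E2\<close> and \<open>E1\<close>. These are full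
  ambient derivatives, so tangential parts are kept: the \<open>kap\<close> terms belong to them and
  carry the Gauss equation, while the normal parts are the Codazzi equation proper.\<close>

lemma Codazzi:
  assumes "u \<in> W"
  shows "D1 h22 u = D2 h12 u + kap u *\<^sub>R E1 u + w2 u *\<^sub>R (h11 u - h22 u) - (2 * w1 u) *\<^sub>R h12 u"
    "D1 h12 u = D2 h11 u - kap u *\<^sub>R E2 u + w1 u *\<^sub>R (h22 u - h11 u) - (2 * w2 u) *\<^sub>R h12 u"
proof -
  have two: "(2 * r) *\<^sub>R v = r *\<^sub>R v + r *\<^sub>R v" for r and v :: "real^4"
    by (simp only: scaleR_scaleR[symmetric] scaleR_2)
  have m: "smooth_on W (\<lambda>u. - w1 u)" "smooth_on W (\<lambda>u. - w2 u)"
    "dir_deriv X (\<lambda>u. - w1 u) u = - dir_deriv X w1 u" "dir_deriv X (\<lambda>u. - w2 u) u = - dir_deriv X w2 u" for X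
    by (intro smooth_on_uminus dir_deriv_uminus open_W smooth_w diff[OF _ assms])+
  have "D1 (D2 E2) u = (- w2 u) *\<^sub>R D1 E1 u + (- D1 w2 u) *\<^sub>R E1 u + D1 h22 u"
    using dir_deriv_eq_comb[OF assms frame_derivs(3) m(2) smooth_E(1) smooth_h(3), of e1] m by simp
  moreover have "D2 (D1 E2) u = (- w1 u) *\<^sub>R D2 E1 u + (- D2 w1 u) *\<^sub>R E1 u + D2 h12 u"
    using dir_deriv_eq_comb[OF assms frame_derivs(2) m(1) smooth_E(1) smooth_h(2), of e2] m by simp
  ultimately have "D1 h22 u = (D1 (D2 E2) u - D2 (D1 E2) u) + D2 h12 u
      + (w2 u *\<^sub>R D1 E1 u + D1 w2 u *\<^sub>R E1 u) - (w1 u *\<^sub>R D2 E1 u + D2 w1 u *\<^sub>R E1 u)"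
    by simp
  then show "D1 h22 u = D2 h12 u + kap u *\<^sub>R E1 u + w2 u *\<^sub>R (h11 u - h22 u) - (2 * w1 u) *\<^sub>R h12 u"
    unfolding commutator[OF assms smooth_E(2)] frame_derivs[OF assms] D2_E1[OF assms] kap_def
    by (simp add: algebra_simps two)
  have "D1 (D2 E1) u = w2 u *\<^sub>R D1 E2 u + D1 w2 u *\<^sub>R E2 u + D1 h12 u"
    by (rule dir_deriv_eq_comb[OF assms D2_E1 smooth_w(2) smooth_E(2) smooth_h(2), of e1])
  moreover have "D2 (D1 E1) u = w1 u *\<^sub>R D2 E2 u + D2 w1 u *\<^sub>R E2 u + D2 h11 u"
    by (rule dir_deriv_eq_comb[OF assms frame_derivs(1) smooth_w(1) smooth_E(2) smooth_h(1), of e2])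
  ultimately have "D1 h12 u = (D1 (D2 E1) u - D2 (D1 E1) u) + D2 h11 u
      - (w2 u *\<^sub>R D1 E2 u + D1 w2 u *\<^sub>R E2 u) + (w1 u *\<^sub>R D2 E2 u + D2 w1 u *\<^sub>R E2 u)"
    by simp
  then show "D1 h12 u = D2 h11 u - kap u *\<^sub>R E2 u + w1 u *\<^sub>R (h22 u - h11 u) - (2 * w2 u) *\<^sub>R h12 u"
    unfolding commutator[OF assms smooth_E(1)] frame_derivs[OF assms] D2_E1[OF assms] kap_def
    by (simp add: algebra_simps two)
qed

end

context framed_surface begin

subsection \<open>The normal frame\<close>

definition "E3pre u = axis 1 1 - lorentz (axis 1 1) (E1 u) *\<^sub>R E1 u - lorentz (axis 1 1) (E2 u) *\<^sub>R E2 u"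
definition "E3 u = inverse (sqrt (- lorentz (E3pre u) (E3pre u))) *\<^sub>R E3pre u"
definition "E4 u = cross4 (E1 u) (E2 u) (E3 u)"

lemma E3pre_timelike: "u \<in> W \<Longrightarrow> lorentz (E3pre u) (E3pre u) < 0"
  unfolding E3pre_def by (rule normal_frame_timelike[OF orthonormal(1-3)])

lemma normal_frame:
  assumes "u \<in> W"
  shows "lorentz (E3 u) (E3 u) = -1" "lorentz (E4 u) (E4 u) = 1" "lorentz (E3 u) (E4 u) = 0"
    "lorentz (E1 u) (E3 u) = 0" "lorentz (E2 u) (E3 u) = 0"
    "lorentz (E1 u) (E4 u) = 0" "lorentz (E2 u) (E4 u) = 0"
    "vol4 (E1 u) (E2 u) (E3 u) (E4 u) = 1"
  using normal_frame_props[OF orthonormal(1-3)[OF assms], of "E3 u"]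
  by (simp_all add: E3_def E3pre_def E4_def)

lemma smooth_E34: "smooth_on W E3" "smooth_on W E4"
proof -
  note bl = smooth_on_bilinear[OF bounded_bilinear_lorentz open_W]
  have p: "smooth_on W E3pre" unfolding E3pre_def[abs_def]
    by (intro smooth_on_diff smooth_on_scaleR bl smooth_on_const open_W smooth_E)
  then show 3: "smooth_on W E3" unfolding E3_def[abs_def]
    by (intro smooth_on_scaleR smooth_on_inverse smooth_on_sqrt smooth_on_uminus bl open_W)
      (use E3pre_timelike in fastforce)+
  have v: "smooth_on W (\<lambda>u. vol4 (E1 u) (E2 u) (E3 u) v)" for v unfolding vol4_def
    by (intro smooth_on_add smooth_on_diff smooth_on_mult smooth_on_vec_nth smooth_on_const open_W smooth_E 3)
  have "E4 u = - vol4 (E1 u) (E2 u) (E3 u) (axis 1 1) *\<^sub>R axis 1 1 + vol4 (E1 u) (E2 u) (E3 u) (axis 2 1) *\<^sub>R axis 2 1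
     + vol4 (E1 u) (E2 u) (E3 u) (axis 3 1) *\<^sub>R axis 3 1 + vol4 (E1 u) (E2 u) (E3 u) (axis 4 1) *\<^sub>R axis 4 1" for u
    by (simp add: E4_def cross4_def vec_eq_iff forall_4 axis_def)
  then have "E4 = (\<lambda>u. - vol4 (E1 u) (E2 u) (E3 u) (axis 1 1) *\<^sub>R axis 1 1 + vol4 (E1 u) (E2 u) (E3 u) (axis 2 1) *\<^sub>R axis 2 1
     + vol4 (E1 u) (E2 u) (E3 u) (axis 3 1) *\<^sub>R axis 3 1 + vol4 (E1 u) (E2 u) (E3 u) (axis 4 1) *\<^sub>R axis 4 1)"
    by blast
  then show "smooth_on W E4"
    by (simp only:) (intro smooth_on_add smooth_on_scaleR smooth_on_uminus v smooth_on_const open_W)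
qed

definition normal :: "real^2 \<Rightarrow> real^4 \<Rightarrow> bool" where
  "normal u n \<longleftrightarrow> lorentz n (E1 u) = 0 \<and> lorentz n (E2 u) = 0"

lemma normal_h: "u \<in> W \<Longrightarrow> normal u (h11 u)" "u \<in> W \<Longrightarrow> normal u (h12 u)" "u \<in> W \<Longrightarrow> normal u (h22 u)"
  by (simp_all add: normal_def h_normal)

lemma normal_nor: "u \<in> W \<Longrightarrow> normal u (nor u v)"
  by (simp add: normal_def nor_orthogonal)

lemma nor_normal: "normal u n \<Longrightarrow> nor u n = n"
  by (simp add: normal_def nor_def)

lemma normal_closed:
  "normal u n \<Longrightarrow> normal u m \<Longrightarrow> normal u (n + m)" "normal u n \<Longrightarrow> normal u m \<Longrightarrow> normal u (n - m)"
  "normal u n \<Longrightarrow> normal u (r *\<^sub>R n)" "normal u n \<Longrightarrow> normal u (- n)"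
  by (simp_all add: normal_def lorentz_simps)

lemma normal_E34: "u \<in> W \<Longrightarrow> normal u (E3 u)" "u \<in> W \<Longrightarrow> normal u (E4 u)"
  using normal_frame lorentz_commute unfolding normal_def by metis+

text \<open>Coordinates of a normal vector with respect to \<open>E3\<close> and \<open>E4\<close>;
  \<open>E3\<close> is time-like, whence the sign.\<close>

definition "nc3 u n = - lorentz n (E3 u)"
definition "nc4 u n = lorentz n (E4 u)"

lemma nc_linear:
  "nc3 u (n + m) = nc3 u n + nc3 u m" "nc3 u (n - m) = nc3 u n - nc3 u m" "nc3 u (r *\<^sub>R n) = r * nc3 u n" "nc3 u (- n) = - nc3 u n"
  "nc4 u (n + m) = nc4 u n + nc4 u m" "nc4 u (n - m) = nc4 u n - nc4 u m" "nc4 u (r *\<^sub>R n) = r * nc4 u n" "nc4 u (- n) = - nc4 u n"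
  by (simp_all add: nc3_def nc4_def lorentz_simps)

lemma normal_expand:
  assumes "u \<in> W" "normal u n" shows "n = nc3 u n *\<^sub>R E3 u + nc4 u n *\<^sub>R E4 u"
  using lorentz_frame_expand[OF orthonormal(1-3)[OF assms(1)] normal_frame(4-7,3)[OF assms(1)], of n]
    assms(2) normal_frame[OF assms(1)] by (simp add: nc3_def nc4_def normal_def)

lemma normal_eqI:
  assumes "u \<in> W" "normal u n" "normal u m" "nc3 u n = nc3 u m" "nc4 u n = nc4 u m"
  shows "n = m"
  using normal_expand[OF assms(1,2)] normal_expand[OF assms(1,3)] assms(4,5) by metis

lemma lorentz_normal:
  assumes "u \<in> W" "normal u n" "normal u m"
  shows "lorentz n m = - (nc3 u n * nc3 u m) + nc4 u n * nc4 u m"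
proof -
  have "lorentz n m = lorentz n (nc3 u m *\<^sub>R E3 u + nc4 u m *\<^sub>R E4 u)"
    using normal_expand[OF assms(1,3)] by simp
  then show ?thesis by (simp add: lorentz_simps nc3_def nc4_def)
qed

text \<open>The exterior square of the normal plane is a line, so linear dependence of two normal
  vectors is one scalar equation, the vanishing of a 2 by 2 determinant.\<close>

lemma bilinear_normal:
  assumes "u \<in> W" "normal u n" "normal u m"
  shows "vol4 (E1 u) (E2 u) n m = nc3 u n * nc4 u m - nc4 u n * nc3 u m"
    and "hodge n m = (nc3 u n * nc4 u m - nc4 u n * nc3 u m) *\<^sub>R hodge (E3 u) (E4 u)"
proof -
  show "vol4 (E1 u) (E2 u) n m = nc3 u n * nc4 u m - nc4 u n * nc3 u m"
    using normal_frame(8)[OF assms(1)] vol4_swap(2)[of "E1 u" "E2 u" "E4 u" "E3 u"]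
    by (subst normal_expand[OF assms(1,2)], subst normal_expand[OF assms(1,3)])
      (simp add: vol4_linear algebra_simps)
  show "hodge n m = (nc3 u n * nc4 u m - nc4 u n * nc3 u m) *\<^sub>R hodge (E3 u) (E4 u)"
    by (subst normal_expand[OF assms(1,2)], subst normal_expand[OF assms(1,3)])
      (simp add: hodge.add_left hodge.add_right hodge.scaleR_left hodge.scaleR_right
        hodge_swap[of "E4 u" "E3 u"] algebra_simps)
qed

text \<open>Three vectors of the normal plane are linearly dependent.\<close>

lemma vol4_three_normal:
  assumes "u \<in> W" "normal u a" "normal u b" "normal u c"
  shows "vol4 a b v c = 0"
  by (subst normal_expand[OF assms(1,2)], subst normal_expand[OF assms(1,3)], subst normal_expand[OF assms(1,4)])
    (simp add: vol4_linear)

subsection \<open>Mean curvature and the Laplacian of the Gauss map\<close>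

text \<open>The Gauss equation is the \<open>E2\<close> component of the second Codazzi identity:
  since h is normal, the derivatives can be moved from h to \<open>E2\<close>.\<close>

lemma kap_eq:
  assumes "u \<in> W" shows "kap u = lorentz (h12 u) (h12 u) - lorentz (h11 u) (h22 u)"
proof -
  have "lorentz (D1 h12 u) (E2 u) = - lorentz (h12 u) (D1 E2 u)"
    "lorentz (D2 h11 u) (E2 u) = - lorentz (h11 u) (D2 E2 u)"
    using lorentz_dir_deriv_const[OF assms smooth_h(2) smooth_E(2) h_normal(4), of e1]
      lorentz_dir_deriv_const[OF assms smooth_h(1) smooth_E(2) h_normal(2), of e2] by simp_all
  then show ?thesis
    using arg_cong[OF Codazzi(2)[OF assms], of "\<lambda>v. lorentz v (E2 u)"] orthonormal[OF assms] h_normal[OF assms]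
    by (simp add: lorentz_simps frame_derivs[OF assms])
qed

lemma second_forms:
  assumes "u \<in> W"
  shows "second_form f e1 e1 u = h11 u" "second_form f e1 e2 u = h12 u"
    "second_form f e2 e1 u = h12 u" "second_form f e2 e2 u = h22 u"
  using second_form_eq[OF assms diff[OF smooth_e(1) assms]] second_form_eq[OF assms diff[OF smooth_e(2) assms]]
  by (simp_all add: frame_derivs[OF assms] D2_E1[OF assms] nor_simps nor_tangent[OF assms]
      nor_normal[OF normal_h(1)[OF assms]] nor_normal[OF normal_h(2)[OF assms]] nor_normal[OF normal_h(3)[OF assms]]
      flip: E1_def E2_def)

definition "Hm u = (1/2) *\<^sub>R (h11 u + h22 u)"

lemma mean_curvature_eq: "u \<in> W \<Longrightarrow> mean_curvature f e1 e2 u = Hm u"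
  by (simp add: mean_curvature_def Hm_def second_forms)

lemma smooth_Hm: "smooth_on W Hm"
  unfolding Hm_def[abs_def] by (intro smooth_on_scaleR smooth_on_add smooth_on_const smooth_h open_W)

lemma normal_Hm: "u \<in> W \<Longrightarrow> normal u (Hm u)"
  by (simp add: Hm_def normal_closed normal_h)

lemma D_Hm:
  assumes "u \<in> W" shows "dir_deriv X Hm u = (1/2) *\<^sub>R (dir_deriv X h11 u + dir_deriv X h22 u)"
proof -
  have "dir_deriv X Hm u = (1/2) *\<^sub>R dir_deriv X (\<lambda>u. h11 u + h22 u) u"
    unfolding Hm_def[abs_def]
    by (rule dir_deriv_linear[OF bounded_linear_scaleR_right])
      (intro diff[OF _ assms] smooth_on_add smooth_h open_W)
  then show ?thesis by (simp add: dir_deriv_add diff[OF _ assms] smooth_h)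
qed

lemma D_normal_inner:
  assumes "u \<in> W" "smooth_on W n" "\<And>w. w \<in> W \<Longrightarrow> normal w (n w)"
  shows "lorentz (D1 n u) (E1 u) = - lorentz (n u) (h11 u)" "lorentz (D1 n u) (E2 u) = - lorentz (n u) (h12 u)"
    "lorentz (D2 n u) (E1 u) = - lorentz (n u) (h12 u)" "lorentz (D2 n u) (E2 u) = - lorentz (n u) (h22 u)"
proof -
  have z: "lorentz (n w) (E1 w) = 0" "lorentz (n w) (E2 w) = 0" if "w \<in> W" for w
    using assms(3)[OF that] by (simp_all add: normal_def)
  show "lorentz (D1 n u) (E1 u) = - lorentz (n u) (h11 u)" "lorentz (D1 n u) (E2 u) = - lorentz (n u) (h12 u)"
    "lorentz (D2 n u) (E1 u) = - lorentz (n u) (h12 u)" "lorentz (D2 n u) (E2 u) = - lorentz (n u) (h22 u)"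
    using lorentz_dir_deriv_const[OF assms(1,2) smooth_E(1) z(1), of e1]
      lorentz_dir_deriv_const[OF assms(1,2) smooth_E(2) z(2), of e1]
      lorentz_dir_deriv_const[OF assms(1,2) smooth_E(1) z(1), of e2]
      lorentz_dir_deriv_const[OF assms(1,2) smooth_E(2) z(2), of e2] z[OF assms(1)]
    by (simp_all add: frame_derivs[OF assms(1)] D2_E1[OF assms(1)] lorentz_simps)
qed

lemma Weingarten:
  assumes "u \<in> W" "smooth_on W n" "\<And>w. w \<in> W \<Longrightarrow> normal w (n w)"
  shows "D1 n u = nor u (D1 n u) - lorentz (n u) (h11 u) *\<^sub>R E1 u - lorentz (n u) (h12 u) *\<^sub>R E2 u"
    "D2 n u = nor u (D2 n u) - lorentz (n u) (h12 u) *\<^sub>R E1 u - lorentz (n u) (h22 u) *\<^sub>R E2 u"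
  unfolding nor_def using D_normal_inner[OF assms] by simp_all

lemma cov_deriv_frame:
  assumes "u \<in> W"
  shows "cov_deriv f e1 e1 u = w1 u *\<^sub>R e2 u" "cov_deriv f e2 e2 u = - w2 u *\<^sub>R e1 u"
proof -
  have p: "frechet_derivative f (at u) (a *\<^sub>R e1 u) = a *\<^sub>R E1 u"
    "frechet_derivative f (at u) (a *\<^sub>R e2 u) = a *\<^sub>R E2 u" for a
    using push_comb[OF assms, of a 0] push_comb[OF assms, of 0 a] by simp_all
  note c = push_cov_deriv[OF assms diff[OF smooth_e(1) assms], folded E1_def]
    push_cov_deriv[OF assms diff[OF smooth_e(2) assms], folded E2_def]
  have "frechet_derivative f (at u) (cov_deriv f e1 e1 u) = frechet_derivative f (at u) (w1 u *\<^sub>R e2 u)"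
    "frechet_derivative f (at u) (cov_deriv f e2 e2 u) = frechet_derivative f (at u) (- w2 u *\<^sub>R e1 u)"
    using c(1)[of e1] c(2)[of e2] unfolding p by (simp_all add: push_def DE_inner[OF assms] w1_def)
  then show "cov_deriv f e1 e1 u = w1 u *\<^sub>R e2 u" "cov_deriv f e2 e2 u = - w2 u *\<^sub>R e1 u"
    using push_inject[OF assms] by blast+
qed

lemmas hodge_simps = hodge.add_left hodge.add_right hodge.diff_left hodge.diff_right
  hodge.minus_left hodge.minus_right hodge.scaleR_left hodge.scaleR_right

text \<open>Rotating the tangent frame does not change e1 \<and> e2, so the first derivatives
  contain no connection term. In the second derivatives, Codazzi trades those of \<open>h12\<close>
  for those of \<open>h11\<close> and \<open>h22\<close>, and only derivatives of the trace remain.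
  The connection terms, including those from Codazzi, cancel against the covariant corrections in
  the Laplacian.\<close>

lemma laplacian_hodge:
  assumes "u \<in> W" and F: "\<And>w. w \<in> W \<Longrightarrow> F w = hodge (E1 w) (E2 w)"
  shows "laplacian f e1 e2 F u = - (hodge (D1 h11 u + D1 h22 u) (E2 u) + hodge (E1 u) (D2 h11 u + D2 h22 u)
    - (2 * kap u) *\<^sub>R hodge (E1 u) (E2 u) + 2 *\<^sub>R hodge (h11 u - h22 u) (h12 u))"
proof -
  have sF: "smooth_on W F"
    using smooth_on_bilinear[OF bounded_bilinear_hodge open_W smooth_E] F
    by (subst smooth_on_cong[OF open_W]) auto
  note bh = smooth_on_bilinear[OF bounded_bilinear_hodge open_W]
  have DF: "D1 F w = hodge (h11 w) (E2 w) + hodge (E1 w) (h12 w)"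
    "D2 F w = hodge (h12 w) (E2 w) + hodge (E1 w) (h22 w)" if w: "w \<in> W" for w
    using dir_deriv_cong[OF open_W w F] dir_deriv_hodge[OF diff[OF smooth_E(1) w] diff[OF smooth_E(2) w]]
    by (simp_all add: frame_derivs[OF w] D2_E1[OF w] hodge_simps)
  have "D1 (D1 F) u = hodge (h11 u) (D1 E2 u) + hodge (D1 h11 u) (E2 u)
      + (hodge (E1 u) (D1 h12 u) + hodge (D1 E1 u) (h12 u))"
    by (simp add: dir_deriv_cong[OF open_W assms(1) DF(1)] dir_deriv_add dir_deriv_hodge
        diff[OF bh assms(1)] diff[OF _ assms(1)] smooth_E smooth_h)
  moreover have "D2 (D2 F) u = hodge (h12 u) (D2 E2 u) + hodge (D2 h12 u) (E2 u)
      + (hodge (E1 u) (D2 h22 u) + hodge (D2 E1 u) (h22 u))"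
    by (simp add: dir_deriv_cong[OF open_W assms(1) DF(2)] dir_deriv_add dir_deriv_hodge
        diff[OF bh assms(1)] diff[OF _ assms(1)] smooth_E smooth_h)
  moreover have "dir_deriv (cov_deriv f e1 e1) F u = w1 u *\<^sub>R D2 F u"
    "dir_deriv (cov_deriv f e2 e2) F u = - w2 u *\<^sub>R D1 F u"
    using dir_deriv_comb[OF diff[OF sF assms(1)], of "cov_deriv f e1 e1" "w1 u" e2 0 e1]
      dir_deriv_comb[OF diff[OF sF assms(1)], of "cov_deriv f e2 e2" "- w2 u" e1 0 e2]
      cov_deriv_frame[OF assms(1)] by simp_all
  ultimately show ?thesis
    unfolding laplacian_def
    by (simp only: frame_derivs[OF assms(1)] D2_E1[OF assms(1)] DF[OF assms(1)] Codazzi[OF assms(1)]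
        hodge_simps hodge_alt hodge_swap[of "h12 u" "h11 u"] hodge_swap[of "h12 u" "h22 u"]
        hodge_swap[of "h11 u" "E1 u"] hodge_swap[of "h12 u" "E1 u"] hodge_swap[of "h22 u" "E1 u"]
        hodge_swap[of "h11 u" "E2 u"] hodge_swap[of "h12 u" "E2 u"] hodge_swap[of "h22 u" "E2 u"])
      (simp add: vec_eq_iff algebra_simps)
qed

text \<open>The summands of the Laplacian lie in independent parts of the space of bivectors:
  normal-tangent, tangent-tangent and normal-normal. Hence they vanish separately.\<close>

lemma laplacian_hodge_zero_iff:
  assumes "u \<in> W" and F: "\<And>w. w \<in> W \<Longrightarrow> F w = hodge (E1 w) (E2 w)"
  shows "laplacian f e1 e2 F u = 0 \<longleftrightarrow>
    nor u (D1 Hm u) = 0 \<and> nor u (D2 Hm u) = 0 \<and> kap u = - 2 * lorentz (Hm u) (Hm u) \<and>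
    vol4 (E1 u) (E2 u) (h11 u - h22 u) (h12 u) = 0"
proof -
  define T1 T2 where "T1 = nor u (D1 Hm u)" and "T2 = nor u (D2 Hm u)"
  define a where "a = h11 u - h22 u"
  \<comment> \<open>The coefficient of \<open>hodge E1 E2\<close>: the tangential parts of the
    derivatives of H contribute -4 <H, H>, the curvature term contributes -2
    \<open>kap\<close>.\<close>
  define c where "c = - 4 * lorentz (Hm u) (Hm u) - 2 * kap u"
  define X where "X = 2 *\<^sub>R hodge T1 (E2 u) + 2 *\<^sub>R hodge (E1 u) T2 + c *\<^sub>R hodge (E1 u) (E2 u) + 2 *\<^sub>R hodge a (h12 u)"
  have n: "normal u T1" "normal u T2" "normal u a" "normal u (h12 u)"
    using assms(1) by (simp_all add: T1_def T2_def a_def normal_nor normal_closed normal_h)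
  have c: "c = - 2 * lorentz (Hm u) (h11 u) - 2 * lorentz (Hm u) (h22 u) - 2 * kap u"
  proof -
    have "h11 u + h22 u = 2 *\<^sub>R Hm u" by (simp add: Hm_def)
    then have "lorentz (Hm u) (h11 u) + lorentz (Hm u) (h22 u) = 2 * lorentz (Hm u) (Hm u)"
      by (metis lorentz.add_right lorentz.scaleR_right real_scaleR_def)
    then show ?thesis by (simp add: c_def)
  qed
  have "D1 Hm u = T1 - lorentz (Hm u) (h11 u) *\<^sub>R E1 u - lorentz (Hm u) (h12 u) *\<^sub>R E2 u"
    "D2 Hm u = T2 - lorentz (Hm u) (h12 u) *\<^sub>R E1 u - lorentz (Hm u) (h22 u) *\<^sub>R E2 u"
    unfolding T1_def T2_def by (rule Weingarten[OF assms(1) smooth_Hm normal_Hm]; assumption)+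
  note D = this
  have DD: "D1 h11 u + D1 h22 u = 2 *\<^sub>R (T1 - lorentz (Hm u) (h11 u) *\<^sub>R E1 u - lorentz (Hm u) (h12 u) *\<^sub>R E2 u)"
    "D2 h11 u + D2 h22 u = 2 *\<^sub>R (T2 - lorentz (Hm u) (h12 u) *\<^sub>R E1 u - lorentz (Hm u) (h22 u) *\<^sub>R E2 u)"
    unfolding D[symmetric] by (simp_all add: D_Hm[OF assms(1)])
  have "laplacian f e1 e2 F u = - (hodge (D1 h11 u + D1 h22 u) (E2 u) + hodge (E1 u) (D2 h11 u + D2 h22 u)
    - (2 * kap u) *\<^sub>R hodge (E1 u) (E2 u) + 2 *\<^sub>R hodge (h11 u - h22 u) (h12 u))"
    by (rule laplacian_hodge[OF assms(1) F])
  then have "laplacian f e1 e2 F u = - X"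
    unfolding DD X_def c a_def by (simp add: hodge_simps vec_eq_iff algebra_simps)
  then have "laplacian f e1 e2 F u = 0 \<longleftrightarrow> X = 0" by simp
  also have "\<dots> \<longleftrightarrow> T1 = 0 \<and> T2 = 0 \<and> c = 0 \<and> vol4 (E1 u) (E2 u) a (h12 u) = 0"
  proof
    assume "X = 0"
    then have "pairing v w X = 0" for v w
      using linear_0[OF linear_pairing] by simp
    then have p: "2 * vol4 T1 (E2 u) v w + 2 * vol4 (E1 u) T2 v w + c * vol4 (E1 u) (E2 u) v w + 2 * vol4 a (h12 u) v w = 0" for v w
      unfolding X_def by (simp add: linear_add[OF linear_pairing] linear_cmul[OF linear_pairing] pairing_hodge)
    have e: "vol4 a (h12 u) (E1 u) (E2 u) = vol4 (E1 u) (E2 u) a (h12 u)"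
      by (simp add: vol4_def algebra_simps)
    \<comment> \<open>Each choice of test vectors isolates one summand: two tangent ones the last,
      \<open>E3\<close> and \<open>E4\<close> the coefficient \<open>c\<close>, a tangent and a
      normal one \<open>T1\<close> or \<open>T2\<close>.\<close>
    have 1: "vol4 (E1 u) (E2 u) a (h12 u) = 0" using p[of "E1 u" "E2 u"] e by simp
    have three: "vol4 n1 (E2 u) (E3 u) (E4 u) = 0" "vol4 (E1 u) n1 (E3 u) (E4 u) = 0"
      "vol4 n1 n2 (E3 u) (E4 u) = 0"  if "normal u n1" "normal u n2" for n1 n2
      using that by (subst normal_expand[OF assms(1) that(1)], simp add: vol4_linear)+
    have cz: "c = 0" using p[of "E3 u" "E4 u"] three[OF n(1,1)] three[OF n(2,2)] three[OF n(3,4)] normal_frame(8)[OF assms(1)]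
      by simp
    have z: "vol4 a (h12 u) v w = 0" if "normal u w" for v w
      using vol4_three_normal[OF assms(1) n(3,4) that] .
    have q1: "vol4 T1 (E2 u) (E1 u) w = - vol4 (E1 u) (E2 u) T1 w" for w by (simp add: vol4_def algebra_simps)
    have q2: "vol4 (E1 u) T2 (E2 u) w = - vol4 (E1 u) (E2 u) T2 w" for w by (simp add: vol4_def algebra_simps)
    have t1: "vol4 (E1 u) (E2 u) T1 w = 0" if "normal u w" for w
      using p[of "E1 u" w] z[OF that] q1 by simp
    have t2: "vol4 (E1 u) (E2 u) T2 w = 0" if "normal u w" for w
      using p[of "E2 u" w] z[OF that] q2 by simp
    have zero: "T = 0" if T: "normal u T" "\<And>w. normal u w \<Longrightarrow> vol4 (E1 u) (E2 u) T w = 0" for T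
    proof -
      have "nc3 u T = 0" "nc4 u T = 0"
        using T(2)[OF normal_E34(2)[OF assms(1)]] T(2)[OF normal_E34(1)[OF assms(1)]]
          bilinear_normal(1)[OF assms(1) T(1) normal_E34(2)[OF assms(1)]]
          bilinear_normal(1)[OF assms(1) T(1) normal_E34(1)[OF assms(1)]] normal_frame[OF assms(1)]
        by (simp_all add: nc3_def nc4_def lorentz_commute[of "E4 u" "E3 u"])
      then show ?thesis using normal_expand[OF assms(1) T(1)] by simp
    qed
    show "T1 = 0 \<and> T2 = 0 \<and> c = 0 \<and> vol4 (E1 u) (E2 u) a (h12 u) = 0"
      using 1 cz zero[OF n(1) t1] zero[OF n(2) t2] by simp
  next
    assume z: "T1 = 0 \<and> T2 = 0 \<and> c = 0 \<and> vol4 (E1 u) (E2 u) a (h12 u) = 0"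
    then have "hodge a (h12 u) = 0" using bilinear_normal[OF assms(1) n(3,4)] by simp
    then show "X = 0" using z by (simp add: X_def hodge.zero_left hodge.zero_right)
  qed
  finally show ?thesis by (auto simp: T1_def T2_def a_def c_def)
qed

section \<open>Gauss equation for the intrinsic curvature\<close>

lemma coord_smooth: "smooth_on W (push f (coord_field i))"
  unfolding push_eq by (intro smooth_on_dir_deriv open_W smooth smooth_on_coord_field)

text \<open>The curvature is defined through coordinate fields, \<open>kap\<close> through the
  frame. The Gauss equation is first proved for coordinate fields; its extrinsic side then scales
  with the squared determinant of the change of basis, and so does
  \<open>det (metric_matrix f u)\<close>, so the factor cancels.\<close>

lemma gaussian_curvature_eq:
  assumes "u \<in> W" shows "gaussian_curvature f u = - kap u"
proof -
  define X1 X2 where "X1 = coord_field 1" and "X2 = coord_field 2"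
  define f1 f2 where "f1 = push f X1" and "f2 = push f X2"
  have X: "smooth_on W X1" "smooth_on W X2" by (simp_all add: X1_def X2_def smooth_on_coord_field)
  have sf: "smooth_on W f1" "smooth_on W f2" unfolding f1_def f2_def X1_def X2_def by (rule coord_smooth)+
  note bl = smooth_on_bilinear[OF bounded_bilinear_lorentz open_W]
  have dX: "X differentiable (at w)" if "smooth_on W X" "w \<in> W" for X :: "real^2 \<Rightarrow> real^2" and w
    using diff[OF that] .
  have cov: "cov_deriv f X Y w = lorentz (dir_deriv X (push f Y) w) (E1 w) *\<^sub>R e1 w
      + lorentz (dir_deriv X (push f Y) w) (E2 w) *\<^sub>R e2 w"
    if "smooth_on W X" "smooth_on W Y" "w \<in> W" for X Y w
    using push_cov_deriv[OF that(3) dX[OF that(2,3)], of X] push_comb[OF that(3)] push_inject[OF that(3)]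
    by (metis push_def)
  have scov: "smooth_on W (cov_deriv f X Y)" if "smooth_on W X" "smooth_on W Y" for X Y
    by (subst smooth_on_cong[OF open_W cov[OF that]], assumption)
      (intro smooth_on_add smooth_on_scaleR bl smooth_on_dir_deriv open_W smooth_e smooth_E that,
        simp_all add: push_eq smooth_on_dir_deriv[OF open_W smooth that(2)])
  define g where "g X Y w = second_form f X Y w" for X Y w
  have gn: "normal w (g X Y w)" if "smooth_on W Y" "w \<in> W" for X Y w
    unfolding g_def second_form_eq[OF that(2) dX[OF that]] by (rule normal_nor[OF that(2)])
  have spc: "push f (cov_deriv f X Y) w = dir_deriv X (push f Y) w - g X Y w" for X Y w
    by (simp add: g_def second_form_def ambient_deriv_eq)
  have sg: "smooth_on W (g X Y)" if "smooth_on W X" "smooth_on W Y" for X Y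
  proof -
    have "g X Y = (\<lambda>w. dir_deriv X (dir_deriv Y f) w - dir_deriv (cov_deriv f X Y) f w)"
      using spc by (simp add: push_eq fun_eq_iff)
    then show ?thesis using scov[OF that] smooth_on_dir_deriv[OF open_W smooth] that
      by (simp add: smooth_on_diff smooth_on_dir_deriv open_W)
  qed
  have c0: "dir_deriv X X1 u = 0" "dir_deriv X X2 u = 0" for X
    by (simp_all add: X1_def X2_def coord_field_def)
  have comm: "dir_deriv X1 (dir_deriv X2 G) w = dir_deriv X2 (dir_deriv X1 G) w"
    if "smooth_on W G" "w \<in> W" for G :: "real^2 \<Rightarrow> real^4" and w
    using partial_deriv_commute[OF open_W that(2,1), of 1 2]
    by (simp add: X1_def X2_def partial_deriv_eq)
  have fo: "lorentz (frechet_derivative f (at w) v) n = 0" if "w \<in> W" "normal w n" for w v n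
    using that(2) by (subst tangent_expand[OF that(1)]) (simp add: lorentz_simps normal_def lorentz_commute)
  \<comment> \<open>A tangent vector sees only the tangential part, so the outer covariant
    derivative may be replaced by the ambient one.\<close>
  have tang: "lorentz (push f Z u) v = lorentz (push f Z u) v'"
    if "lorentz v (E1 u) = lorentz v' (E1 u)" "lorentz v (E2 u) = lorentz v' (E2 u)" for Z v v'
    using that unfolding push_def
    by (subst tangent_expand[OF assms], subst (3) tangent_expand[OF assms])
      (simp add: lorentz_simps lorentz_commute[of "E1 u"] lorentz_commute[of "E2 u"])
  have koszul: "lorentz (push f Z u) (push f (cov_deriv f X Y) u) = lorentz (push f Z u) (dir_deriv X (push f Y) u)"
    if "smooth_on W Y" for X Y Z
    by (rule tang) (use push_cov_deriv[OF assms dX[OF that assms], of X] orthonormal[OF assms] in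
      \<open>simp_all add: lorentz_simps\<close>)
  \<comment> \<open>Differentiating <V, h(Z, Y)> = 0 moves the derivative off the second fundamental
    form.\<close>
  have inner: "lorentz f1' (dir_deriv X (g Z Y) u) = - lorentz (dir_deriv X (push f V) u) (g Z Y u)"
    if "smooth_on W Z" "smooth_on W Y" "smooth_on W V" "f1' = push f V u" for X Y Z V f1'
  proof -
    have "lorentz (dir_deriv X (push f V) u) (g Z Y u) = - lorentz (push f V u) (dir_deriv X (g Z Y) u)"
      by (rule lorentz_dir_deriv_const[OF assms _ sg[OF that(1,2)]])
        (use fo gn that smooth_on_dir_deriv[OF open_W smooth that(3)] in \<open>auto simp: push_eq dir_deriv_def\<close>)
    then show ?thesis using that(4) by simp
  qed
  have gl: "lorentz (dir_deriv X (push f V) u) (g Z Y u) = lorentz (g X V u) (g Z Y u)"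
    if "smooth_on W Y" "smooth_on W V" for X Y Z V
  proof -
    have "dir_deriv X (push f V) u = g X V u + frechet_derivative f (at u) (cov_deriv f X V u)"
      using spc[of X V u] by (simp add: push_def)
    then show ?thesis
      using fo[OF assms gn[OF that(1) assms, of Z], of "cov_deriv f X V u"] by (simp add: lorentz_simps)
  qed
  have lf: "linear (frechet_derivative f (at u))" by (rule linear_df[OF assms])
  define R where "R = (\<lambda>w. cov_deriv f X1 (cov_deriv f X2 X2) w - cov_deriv f X2 (cov_deriv f X1 X2) w)"
  have "push f R u = push f (cov_deriv f X1 (cov_deriv f X2 X2)) u - push f (cov_deriv f X2 (cov_deriv f X1 X2)) u"
    by (simp add: push_def R_def linear_diff[OF lf])
  then have "induced_metric f R X1 u = lorentz (push f X1 u) (dir_deriv X1 (push f (cov_deriv f X2 X2)) u)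
      - lorentz (push f X1 u) (dir_deriv X2 (push f (cov_deriv f X1 X2)) u)"
    unfolding induced_metric_def
    by (simp add: lorentz_commute[of _ "push f X1 u"] lorentz_simps koszul[OF scov] X)
  moreover have "dir_deriv Z (push f (cov_deriv f X Y)) u = dir_deriv Z (dir_deriv X (push f Y)) u - dir_deriv Z (g X Y) u"
    if "smooth_on W X" "smooth_on W Y" for X Y Z
  proof -
    have "push f (cov_deriv f X Y) = (\<lambda>w. dir_deriv X (push f Y) w - g X Y w)" using spc by blast
    then show ?thesis
      using sg[OF that] smooth_on_dir_deriv[OF open_W smooth that(2)] that
      by (simp add: push_eq dir_deriv_diff diff[OF _ assms] smooth_on_dir_deriv[OF open_W])
  qed
  \<comment> \<open>The third-order derivatives of f cancel, as coordinate derivatives commute; only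
    the terms with \<open>g\<close> remain.\<close>
  ultimately have "induced_metric f R X1 u = - lorentz (push f X1 u) (dir_deriv X1 (g X2 X2) u) + lorentz (push f X1 u) (dir_deriv X2 (g X1 X2) u)"
    using comm[OF sf(2) assms] X by (simp add: f2_def lorentz_simps)
  also have "\<dots> = lorentz (g X1 X1 u) (g X2 X2 u) - lorentz (g X2 X1 u) (g X1 X2 u)"
    using inner[OF X(2,2,1) refl, of X1] inner[OF X(1,2,1) refl, of X2] gl[OF X(2,1)] by simp
  finally have K: "gaussian_curvature f u * det (metric_matrix f u) = lorentz (g X1 X1 u) (g X2 X2 u) - lorentz (g X2 X1 u) (g X1 X2 u)"
    using det_metric_nonzero[OF assms] unfolding gaussian_curvature_def Let_def R_def X1_def X2_def by simp

  define al where "al i w = lorentz (push f (coord_field i) w) (E1 w)" for i w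
  define be where "be i w = lorentz (push f (coord_field i) w) (E2 w)" for i w
  have sab: "smooth_on W (al i)" "smooth_on W (be i)" for i
    unfolding al_def[abs_def] be_def[abs_def] by (intro bl coord_smooth smooth_E)+
  have ce: "coord_field i w = al i w *\<^sub>R e1 w + be i w *\<^sub>R e2 w" if "w \<in> W" for i w
    using tangent_coords[OF that, of "coord_field i w"] by (simp add: al_def be_def push_def)
  have pe: "push f (coord_field i) w = al i w *\<^sub>R E1 w + be i w *\<^sub>R E2 w" if "w \<in> W" for i w
    using tangent_expand[OF that, of "coord_field i w"] by (simp add: al_def be_def push_def)
  have gform: "g (coord_field j) (coord_field i) u = (al j u * al i u) *\<^sub>R h11 u + (al j u * be i u + be j u * al i u) *\<^sub>R h12 u + (be j u * be i u) *\<^sub>R h22 u" for i j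
  proof -
    let ?X = "coord_field j"
    have "dir_deriv ?X (push f (coord_field i)) u = dir_deriv ?X (\<lambda>w. al i w *\<^sub>R E1 w + be i w *\<^sub>R E2 w) u"
      by (rule dir_deriv_cong[OF open_W assms pe])
    also have "\<dots> = (al i u *\<^sub>R dir_deriv ?X E1 u + dir_deriv ?X (al i) u *\<^sub>R E1 u)
        + (be i u *\<^sub>R dir_deriv ?X E2 u + dir_deriv ?X (be i) u *\<^sub>R E2 u)"
      by (simp add: dir_deriv_add dir_deriv_scaleR diff[OF _ assms] smooth_on_scaleR open_W sab smooth_E)
    finally have "g ?X (coord_field i) u = al i u *\<^sub>R nor u (dir_deriv ?X E1 u) + be i u *\<^sub>R nor u (dir_deriv ?X E2 u)"
      unfolding g_def
      by (simp add: second_form_eq[OF assms dX[OF smooth_on_coord_field assms]] nor_simps nor_tangent[OF assms])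
    moreover have "dir_deriv ?X E1 u = al j u *\<^sub>R D1 E1 u + be j u *\<^sub>R D2 E1 u"
      "dir_deriv ?X E2 u = al j u *\<^sub>R D1 E2 u + be j u *\<^sub>R D2 E2 u"
      by (intro dir_deriv_comb ce assms diff[OF _ assms] smooth_E)+
    ultimately show ?thesis
      by (simp add: nor_simps nor_tangent[OF assms] frame_derivs[OF assms] D2_E1[OF assms]
          nor_normal normal_h assms algebra_simps)
  qed
  \<comment> \<open>The determinant of the coordinate fields with respect to the orthonormal
    frame.\<close>
  define d where "d = al 1 u * be 2 u - be 1 u * al 2 u"
  have "lorentz (g X1 X1 u) (g X2 X2 u) - lorentz (g X2 X1 u) (g X1 X2 u)
    = d\<^sup>2 * (lorentz (h11 u) (h22 u) - lorentz (h12 u) (h12 u))"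
    unfolding X1_def X2_def gform d_def lorentz_simps
    by (simp add: lorentz_commute[of "h12 u" "h11 u"] lorentz_commute[of "h22 u" "h11 u"]
        lorentz_commute[of "h22 u" "h12 u"] algebra_simps power2_eq_square)
  moreover have "det (metric_matrix f u) = d\<^sup>2"
    unfolding det_metric_matrix d_def using pe[OF assms] orthonormal[OF assms]
    by (simp add: partial_deriv_eq push_eq lorentz_simps algebra_simps power2_eq_square)
  moreover have "lorentz (h11 u) (h22 u) - lorentz (h12 u) (h12 u) = - kap u" using kap_eq[OF assms] by simp
  ultimately have "gaussian_curvature f u * d\<^sup>2 = - kap u * d\<^sup>2" "d\<^sup>2 \<noteq> 0"
    using K det_metric_nonzero[OF assms] by (metis mult.commute)+
  then show ?thesis using mult_cancel_right by metis
qed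

end

subsection \<open>Consequences of the Ricci equation\<close>

text \<open>In a Lorentzian plane write (a, b) = \<alpha> v and (c, d) = \<beta> v; by
  \<open>nz\<close>, v is not null. With P = (p1, p2) and Q = (q1, q2), the vectors \<alpha> P +
  \<beta> Q and \<alpha> Q - \<beta> P are orthogonal to v by the premises \<open>i\<close> and
  proportional to it by the premises \<open>o\<close>. So both vanish, and \<alpha>^2 + \<beta>^2
  \<noteq> 0 gives P = Q = 0.\<close>

lemma plane_algebra:
  fixes a b p q c d :: real
  assumes dep: "a * d = b * c" and nz: "- (a * a) + b * b + (- (c * c) + d * d) \<noteq> 0"
    and i: "- (p1 * a) + p2 * b + (- (q1 * c) + q2 * d) = 0" "- (q1 * a) + q2 * b - (- (p1 * c) + p2 * d) = 0"
    and o: "(a * q2 - b * q1) + (p1 * d - p2 * c) = 0" "- (a * p2 - b * p1) + (q1 * d - q2 * c) = 0"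
  shows "p1 = 0 \<and> p2 = 0 \<and> q1 = 0 \<and> q2 = 0"
proof -
  let ?N = "- (a * a) + b * b + (- (c * c) + d * d)"
  have "?N * p1 = 0" "?N * p2 = 0" "?N * q1 = 0" "?N * q2 = 0"
    using dep i o by algebra+
  then show ?thesis using nz by simp
qed

text \<open>Here H = (p, q) is a null vector of a Lorentzian plane, A = (a, b) and B = (c, d). If
  <H, A> or <H, B> is nonzero, the relation <H, B> A = <H, A> B is a nontrivial dependence. If both
  vanish, A and B lie in the orthogonal complement of the line of H, which is that line
  itself.\<close>

lemma null_direction:
  fixes a b c d p q :: real
  assumes "p * p = q * q" "p \<noteq> 0 \<or> q \<noteq> 0"
    and "(- (p * c) + q * d) * a = (- (p * a) + q * b) * c" "(- (p * c) + q * d) * b = (- (p * a) + q * b) * d"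
  shows "a * d = b * c"
proof -
  have "(- (p * c) + q * d) * (a * d - b * c) = 0" "(- (p * a) + q * b) * (a * d - b * c) = 0"
    using assms(3,4) by algebra+
  moreover have "a * d = b * c" if "- (p * c) + q * d = 0" "- (p * a) + q * b = 0"
  proof -
    have "p * q * (a * d - b * c) = 0" using that by algebra
    moreover have "p * q \<noteq> 0" using assms(1,2) by auto
    ultimately show ?thesis by simp
  qed
  ultimately show ?thesis by auto
qed

context framed_surface begin

lemma lorentz_nor: "normal u n \<Longrightarrow> lorentz (nor u v) n = lorentz v n"
  by (simp add: nor_def normal_def lorentz_simps lorentz_commute[of _ n])

lemma normal_zero [simp]: "normal u 0"
  by (simp add: normal_def lorentz.zero_left)

text \<open>Derivatives of \<open>q\<close> and \<open>r\<close> appear only along tangent vectors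
  and are removed by the projection.\<close>

lemma nor_DD:
  assumes "u \<in> W" and sm: "smooth_on W G" "smooth_on W p" "smooth_on W q" "smooth_on W r"
    and eq: "\<And>w. w \<in> W \<Longrightarrow> F w = p w *\<^sub>R G w - q w *\<^sub>R E1 w - r w *\<^sub>R E2 w"
    and "normal u (G u)"
  shows "nor u (dir_deriv X F u) = p u *\<^sub>R nor u (dir_deriv X G u) + dir_deriv X p u *\<^sub>R G u
    - q u *\<^sub>R nor u (dir_deriv X E1 u) - r u *\<^sub>R nor u (dir_deriv X E2 u)"
proof -
  have "dir_deriv X F u = dir_deriv X (\<lambda>w. p w *\<^sub>R G w - q w *\<^sub>R E1 w - r w *\<^sub>R E2 w) u"
    by (rule dir_deriv_cong[OF open_W assms(1) eq])
  also have "\<dots> = p u *\<^sub>R dir_deriv X G u + dir_deriv X p u *\<^sub>R G u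
     - (q u *\<^sub>R dir_deriv X E1 u + dir_deriv X q u *\<^sub>R E1 u) - (r u *\<^sub>R dir_deriv X E2 u + dir_deriv X r u *\<^sub>R E2 u)"
    by (simp add: dir_deriv_diff dir_deriv_scaleR diff[OF _ assms(1)] smooth_on_scaleR smooth_on_diff
        open_W sm smooth_E)
  finally show ?thesis
    by (simp add: nor_simps nor_tangent[OF assms(1)] nor_normal[OF assms(7)])
qed

text \<open>The commutator applied to the normal field F. The rotation form of the hypotheses makes
  the products of \<open>p1\<close> and \<open>p2\<close> cancel. It covers a parallel field, with G
  = 0, and the coefficients of the traceless part of h, which turn at twice the rate of the tangent
  frame.\<close>

lemma Ricci:
  assumes "u \<in> W" and sm: "smooth_on W F" "smooth_on W G" "smooth_on W p1" "smooth_on W p2"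
    and n: "\<And>w. w \<in> W \<Longrightarrow> normal w (F w)" "\<And>w. w \<in> W \<Longrightarrow> normal w (G w)"
    and D: "\<And>w. w \<in> W \<Longrightarrow> nor w (D1 F w) = p1 w *\<^sub>R G w" "\<And>w. w \<in> W \<Longrightarrow> nor w (D2 F w) = p2 w *\<^sub>R G w"
    and DG: "nor u (D1 G u) = - p1 u *\<^sub>R F u" "nor u (D2 G u) = - p2 u *\<^sub>R F u"
  shows "(D1 p2 u - D2 p1 u + w1 u * p1 u + w2 u * p2 u) *\<^sub>R G u =
    lorentz (F u) (h12 u) *\<^sub>R (h11 u - h22 u) - lorentz (F u) (h11 u - h22 u) *\<^sub>R h12 u"
proof -
  note bl = smooth_on_bilinear[OF bounded_bilinear_lorentz open_W]
  have W1: "D1 F w = p1 w *\<^sub>R G w - lorentz (F w) (h11 w) *\<^sub>R E1 w - lorentz (F w) (h12 w) *\<^sub>R E2 w"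
    "D2 F w = p2 w *\<^sub>R G w - lorentz (F w) (h12 w) *\<^sub>R E1 w - lorentz (F w) (h22 w) *\<^sub>R E2 w"
    if "w \<in> W" for w
    using Weingarten[OF that sm(1) n(1)] unfolding D[OF that] by simp_all
  have norE: "nor u (D1 E1 u) = h11 u" "nor u (D1 E2 u) = h12 u" "nor u (D2 E1 u) = h12 u" "nor u (D2 E2 u) = h22 u"
    by (simp_all add: frame_derivs[OF assms(1)] D2_E1[OF assms(1)] nor_simps nor_tangent[OF assms(1)]
        nor_normal normal_h assms(1))
  have "nor u (D1 (D2 F) u) = p2 u *\<^sub>R (- p1 u *\<^sub>R F u) + D1 p2 u *\<^sub>R G u
      - lorentz (F u) (h12 u) *\<^sub>R h11 u - lorentz (F u) (h22 u) *\<^sub>R h12 u"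
    by (subst nor_DD[OF assms(1) sm(2,4) _ _ W1(2)]) (auto intro!: bl sm smooth_h n assms(1) simp: DG norE)
  moreover have "nor u (D2 (D1 F) u) = p1 u *\<^sub>R (- p2 u *\<^sub>R F u) + D2 p1 u *\<^sub>R G u
      - lorentz (F u) (h11 u) *\<^sub>R h12 u - lorentz (F u) (h12 u) *\<^sub>R h22 u"
    by (subst nor_DD[OF assms(1) sm(2,3) _ _ W1(1)]) (auto intro!: bl sm smooth_h n assms(1) simp: DG norE)
  moreover have "nor u (D1 (D2 F) u) - nor u (D2 (D1 F) u) = - w1 u *\<^sub>R nor u (D1 F u) - w2 u *\<^sub>R nor u (D2 F u)"
    using arg_cong[OF commutator[OF assms(1) sm(1)], of "nor u"] by (simp add: nor_simps)
  ultimately have *: "p2 u *\<^sub>R (- p1 u *\<^sub>R F u) + D1 p2 u *\<^sub>R G u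
      - lorentz (F u) (h12 u) *\<^sub>R h11 u - lorentz (F u) (h22 u) *\<^sub>R h12 u
      - (p1 u *\<^sub>R (- p2 u *\<^sub>R F u) + D2 p1 u *\<^sub>R G u
      - lorentz (F u) (h11 u) *\<^sub>R h12 u - lorentz (F u) (h12 u) *\<^sub>R h22 u)
    = - w1 u *\<^sub>R (p1 u *\<^sub>R G u) - w2 u *\<^sub>R (p2 u *\<^sub>R G u)"
    unfolding D[OF assms(1)] by simp
  show ?thesis
  proof (subst vec_eq_iff, intro allI)
    fix i
    show "((D1 p2 u - D2 p1 u + w1 u * p1 u + w2 u * p2 u) *\<^sub>R G u) $ i =
      (lorentz (F u) (h12 u) *\<^sub>R (h11 u - h22 u) - lorentz (F u) (h11 u - h22 u) *\<^sub>R h12 u) $ i"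
      using arg_cong[OF *, of "\<lambda>v. v $ i"] by (simp add: lorentz_simps algebra_simps)
  qed
qed

lemma parallel_non_null_absurd:
  assumes par: "\<And>w. w \<in> W \<Longrightarrow> nor w (D1 Hm w) = 0" "\<And>w. w \<in> W \<Longrightarrow> nor w (D2 Hm w) = 0"
    and kap: "\<And>w. w \<in> W \<Longrightarrow> kap w = - 2 * lorentz (Hm w) (Hm w)"
    and dep: "\<And>w. w \<in> W \<Longrightarrow> vol4 (E1 w) (E2 w) (h11 w - h22 w) (h12 w) = 0"
    and nz: "\<And>w. w \<in> W \<Longrightarrow> lorentz (Hm w) (Hm w) \<noteq> 0" and u: "u \<in> W"
  shows False
proof -
  define a where "a w = (1/2) *\<^sub>R (h11 w - h22 w)" for w
  define b where "b = h12"
  have sa: "smooth_on W a" unfolding a_def[abs_def]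
    by (intro smooth_on_scaleR smooth_on_diff smooth_on_const smooth_h open_W)
  have sb: "smooth_on W b" by (simp add: b_def smooth_h)
  have na: "normal w (a w)" and nb: "normal w (b w)" if "w \<in> W" for w
    using that by (simp_all add: a_def b_def normal_closed normal_h)
  have h: "h11 w = Hm w + a w" "h22 w = Hm w - a w" for w
    by (simp_all add: Hm_def a_def vec_eq_iff field_simps)
  have hd: "h11 w - h22 w = 2 *\<^sub>R a w" for w by (simp add: a_def)
  have dep': "nc3 w (a w) * nc4 w (b w) = nc4 w (a w) * nc3 w (b w)" if "w \<in> W" for w
    using dep[OF that] bilinear_normal(1)[OF that na[OF that] nb[OF that]] unfolding hd b_def
    by (simp add: vol4_linear)
  \<comment> \<open>The Gauss equation with \<open>h11 = Hm + a\<close>, \<open>h22 = Hm - a\<close>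
    and K = 2 <H, H>.\<close>
  have N: "lorentz (a w) (a w) + lorentz (b w) (b w) + lorentz (Hm w) (Hm w) = 0" if "w \<in> W" for w
    using kap[OF that] kap_eq[OF that] unfolding h b_def
    by (simp add: lorentz_simps lorentz_commute[of "Hm w" "a w"])
  have DN: "lorentz (nor w (dir_deriv X a w)) (a w) + lorentz (nor w (dir_deriv X b w)) (b w) = 0"
    if w: "w \<in> W" and X: "nor w (dir_deriv X Hm w) = 0" for w X
  proof -
    have sq: "dir_deriv X (\<lambda>w. lorentz (F w) (F w)) w = 2 * lorentz (nor w (dir_deriv X F w)) (F w)"
      if "smooth_on W F" "normal w (F w)" for F
      using dir_deriv_lorentz[OF diff[OF that(1) w] diff[OF that(1) w]] lorentz_nor[OF that(2)]
      by (simp add: lorentz_commute[of "F w"])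
    have "dir_deriv X (\<lambda>w. lorentz (a w) (a w) + lorentz (b w) (b w) + lorentz (Hm w) (Hm w)) w = dir_deriv X (\<lambda>w. 0) w"
      by (rule dir_deriv_cong[OF open_W w N])
    then have "dir_deriv X (\<lambda>w. lorentz (a w) (a w)) w + dir_deriv X (\<lambda>w. lorentz (b w) (b w)) w + dir_deriv X (\<lambda>w. lorentz (Hm w) (Hm w)) w = 0"
      by (simp add: dir_deriv_add diff[OF _ w] smooth_on_add open_W smooth_on_bilinear[OF bounded_bilinear_lorentz] sa sb smooth_Hm)
    then show ?thesis
      unfolding sq[OF sa na[OF w]] sq[OF sb nb[OF w]] sq[OF smooth_Hm normal_Hm[OF w]] X
      by (simp add: lorentz.zero_left)
  qed
  have Ddep: "vol4 (E1 w) (E2 w) (a w) (nor w (dir_deriv X b w)) + vol4 (E1 w) (E2 w) (nor w (dir_deriv X a w)) (b w) = 0"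
    if w: "w \<in> W" for w X
  proof -
    \<comment> \<open>The dependence is differentiated in the form \<open>hodge a b = 0\<close>,
      which does not involve the moving vectors \<open>E1\<close> and \<open>E2\<close>.\<close>
    have "hodge (a v) (b v) = 0" if "v \<in> W" for v
      using bilinear_normal(2)[OF that na[OF that] nb[OF that]] dep'[OF that] by simp
    then have "dir_deriv X (\<lambda>v. hodge (a v) (b v)) w = dir_deriv X (\<lambda>v. 0) w"
      by (intro dir_deriv_cong[OF open_W w]) auto
    then have "pairing (E1 w) (E2 w) (hodge (a w) (dir_deriv X b w) + hodge (dir_deriv X a w) (b w)) = 0"
      using dir_deriv_hodge[OF diff[OF sa w] diff[OF sb w], of X] linear_0[OF linear_pairing] by simp
    then have "vol4 (a w) (dir_deriv X b w) (E1 w) (E2 w) + vol4 (dir_deriv X a w) (b w) (E1 w) (E2 w) = 0"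
      by (simp add: linear_add[OF linear_pairing] pairing_hodge)
    moreover have "vol4 x y z t = vol4 z t x y" for x y z t by (simp add: vol4_def algebra_simps)
    ultimately have "vol4 (E1 w) (E2 w) (a w) (dir_deriv X b w) + vol4 (E1 w) (E2 w) (dir_deriv X a w) (b w) = 0"
      by metis
    then show ?thesis unfolding nor_def by (simp add: vol4_linear)
  qed
  \<comment> \<open>Since H is parallel, Codazzi expresses the derivatives of b by those of a, like
    Cauchy-Riemann equations for a quadratic differential.\<close>
  have cod: "nor w (D2 b w) = - nor w (D1 a w) + (2 * w1 w) *\<^sub>R b w - (2 * w2 w) *\<^sub>R a w"
    "nor w (D1 b w) = nor w (D2 a w) - (2 * w2 w) *\<^sub>R b w - (2 * w1 w) *\<^sub>R a w" if w: "w \<in> W" for w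
  proof -
    have "D1 h22 w = D1 Hm w - D1 a w" "D2 h11 w = D2 Hm w + D2 a w"
      unfolding h[abs_def] by (simp_all add: dir_deriv_diff dir_deriv_add diff[OF _ w] sa smooth_Hm)
    then have "- nor w (D1 a w) = nor w (D1 h22 w)" "nor w (D2 a w) = nor w (D2 h11 w)"
      using par[OF w] by (simp_all add: nor_simps)
    then show "nor w (D2 b w) = - nor w (D1 a w) + (2 * w1 w) *\<^sub>R b w - (2 * w2 w) *\<^sub>R a w"
    "nor w (D1 b w) = nor w (D2 a w) - (2 * w2 w) *\<^sub>R b w - (2 * w1 w) *\<^sub>R a w"
      unfolding b_def Codazzi[OF w] hd using arg_cong[OF Codazzi(2)[OF w], of "nor w"]
      by (simp_all add: nor_simps nor_tangent[OF w] hd nor_normal[OF na[OF w]] nor_normal[OF nb[OF w, unfolded b_def]]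
         minus_diff_eq[of "h11 w" "h22 w", symmetric] del: minus_diff_eq)
  qed
  have par_ab: "nor w (D1 a w) = (2 * w1 w) *\<^sub>R b w" "nor w (D2 a w) = (2 * w2 w) *\<^sub>R b w"
    "nor w (D1 b w) = (- 2 * w1 w) *\<^sub>R a w" "nor w (D2 b w) = (- 2 * w2 w) *\<^sub>R a w" if w: "w \<in> W" for w
  proof -
    \<comment> \<open>\<open>P\<close> and \<open>Q\<close> come from the covariant derivative of
      the traceless part; the factor 2 reflects that a quadratic form turns at twice the rate of the
      frame. After Codazzi only these two vectors are unknown, and \<open>DN\<close> and
      \<open>Ddep\<close> along \<open>e1\<close> and \<open>e2\<close> give four scalar equations
      for their four coordinates.\<close>
    define P Q where "P = nor w (D1 a w) - (2 * w1 w) *\<^sub>R b w" and "Q = nor w (D2 a w) - (2 * w2 w) *\<^sub>R b w"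
    have nPQ: "normal w P" "normal w Q" unfolding P_def Q_def
      by (intro normal_closed normal_nor nb w)+
    have A: "nor w (D1 a w) = P + (2 * w1 w) *\<^sub>R b w" "nor w (D2 a w) = Q + (2 * w2 w) *\<^sub>R b w"
      by (simp_all add: P_def Q_def)
    have B: "nor w (D1 b w) = Q - (2 * w1 w) *\<^sub>R a w" "nor w (D2 b w) = - P - (2 * w2 w) *\<^sub>R a w"
      unfolding cod[OF w] A by simp_all
    note n = nPQ na[OF w] nb[OF w]
    note ip = lorentz_normal[OF w] bilinear_normal(1)[OF w]
    have "nc3 w P = 0 \<and> nc4 w P = 0 \<and> nc3 w Q = 0 \<and> nc4 w Q = 0"
    proof (rule plane_algebra[OF dep'[OF w]])
      show "- (nc3 w (a w) * nc3 w (a w)) + nc4 w (a w) * nc4 w (a w) + (- (nc3 w (b w) * nc3 w (b w)) + nc4 w (b w) * nc4 w (b w)) \<noteq> 0"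
        using N[OF w] nz[OF w] ip(1)[OF n(3,3)] ip(1)[OF n(4,4)] by simp
      show "- (nc3 w P * nc3 w (a w)) + nc4 w P * nc4 w (a w) + (- (nc3 w Q * nc3 w (b w)) + nc4 w Q * nc4 w (b w)) = 0"
        using DN[OF w par(1)[OF w]] unfolding A B
        by (simp add: lorentz_simps ip n lorentz_commute algebra_simps)
      show "- (nc3 w Q * nc3 w (a w)) + nc4 w Q * nc4 w (a w) - (- (nc3 w P * nc3 w (b w)) + nc4 w P * nc4 w (b w)) = 0"
        using DN[OF w par(2)[OF w]] unfolding A B
        by (simp add: lorentz_simps ip n lorentz_commute algebra_simps)
      show "(nc3 w (a w) * nc4 w Q - nc4 w (a w) * nc3 w Q) + (nc3 w P * nc4 w (b w) - nc4 w P * nc3 w (b w)) = 0"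
        using Ddep[OF w, of e1] unfolding A B by (simp add: vol4_linear ip n)
      have "vol4 (E1 w) (E2 w) (a w) (- P) = - vol4 (E1 w) (E2 w) (a w) P" by (simp add: vol4_def algebra_simps)
      then show "- (nc3 w (a w) * nc4 w P - nc4 w (a w) * nc3 w P) + (nc3 w Q * nc4 w (b w) - nc4 w Q * nc3 w (b w)) = 0"
        using Ddep[OF w, of e2] unfolding A B by (simp add: vol4_linear ip n)
    qed
    then have "P = 0" "Q = 0" using normal_expand[OF w nPQ(1)] normal_expand[OF w nPQ(2)] by simp_all
    then show "nor w (D1 a w) = (2 * w1 w) *\<^sub>R b w" "nor w (D2 a w) = (2 * w2 w) *\<^sub>R b w"
      "nor w (D1 b w) = (- 2 * w1 w) *\<^sub>R a w" "nor w (D2 b w) = (- 2 * w2 w) *\<^sub>R a w"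
      using A B by simp_all
  qed
  have s2: "smooth_on W (\<lambda>w. c * w1 w)" "smooth_on W (\<lambda>w. c * w2 w)" for c
    by (intro smooth_on_mult smooth_on_const smooth_w open_W)+
  have D2w: "dir_deriv X (\<lambda>w. c * w1 w) u = c * dir_deriv X w1 u" "dir_deriv X (\<lambda>w. c * w2 w) u = c * dir_deriv X w2 u" for c X
    by (intro dir_deriv_linear[OF bounded_linear_mult_right] diff[OF _ u] smooth_w)+
  \<comment> \<open>Rotation rates 2 \<open>w1\<close> and 2 \<open>w2\<close> make the left
    coefficient in Ricci equal to 2 \<open>kap\<close>, and the right side vanishes for proportional
    a and b.\<close>
  have "(2 * kap u) *\<^sub>R b u = lorentz (a u) (b u) *\<^sub>R (2 *\<^sub>R a u) - lorentz (a u) (2 *\<^sub>R a u) *\<^sub>R b u"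
    using Ricci[OF u sa sb s2(1)[of 2] s2(2)[of 2] na nb par_ab(1,2)] par_ab(3,4)[OF u]
    unfolding D2w hd b_def[symmetric] kap_def by (simp add: algebra_simps)
  also have "\<dots> = 0"
    using dep'[OF u] by (intro normal_eqI[OF u])
      (simp_all add: normal_closed na[OF u] nb[OF u] nc_linear lorentz_simps lorentz_normal[OF u] nc3_def[of u 0] nc4_def[of u 0], algebra+)
  finally have 1: "kap u *\<^sub>R b u = 0" by simp
  have "(- 2 * kap u) *\<^sub>R a u = lorentz (b u) (b u) *\<^sub>R (2 *\<^sub>R a u) - lorentz (b u) (2 *\<^sub>R a u) *\<^sub>R b u"
    using Ricci[OF u sb sa s2(1)[of "-2"] s2(2)[of "-2"] nb na par_ab(3,4)] par_ab(1,2)[OF u]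
    unfolding D2w hd b_def[symmetric] kap_def by (simp add: algebra_simps)
  also have "\<dots> = 0"
    using dep'[OF u] by (intro normal_eqI[OF u])
      (simp_all add: normal_closed na[OF u] nb[OF u] nc_linear lorentz_simps lorentz_normal[OF u] nc3_def[of u 0] nc4_def[of u 0], algebra+)
  finally have 2: "kap u *\<^sub>R a u = 0" by simp
  have "kap u \<noteq> 0" using kap[OF u] nz[OF u] by simp
  then have "a u = 0" "b u = 0" using 1 2 by simp_all
  then show False using N[OF u] nz[OF u] by (simp add: lorentz.zero_left)
qed

lemma Hm_parallel_light_like_dep:
  assumes par: "\<And>w. w \<in> W \<Longrightarrow> nor w (D1 Hm w) = 0" "\<And>w. w \<in> W \<Longrightarrow> nor w (D2 Hm w) = 0"
    and u: "u \<in> W" and null: "light_like (Hm u)"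
  shows "vol4 (E1 u) (E2 u) (h11 u - h22 u) (h12 u) = 0"
proof -
  define d where "d = h11 u - h22 u"
  have n: "normal u (Hm u)" "normal u d" "normal u (h12 u)"
    using u by (simp_all add: d_def normal_Hm normal_closed normal_h)
  \<comment> \<open>Ricci for F = H with G = 0 and zero rates: a parallel H is annihilated by the
    normal curvature.\<close>
  have "(D1 (\<lambda>w. 0) u - D2 (\<lambda>w. 0) u + w1 u * 0 + w2 u * 0) *\<^sub>R (0 :: real^4) =
    lorentz (Hm u) (h12 u) *\<^sub>R (h11 u - h22 u) - lorentz (Hm u) (h11 u - h22 u) *\<^sub>R h12 u"
  proof (rule Ricci[OF u smooth_Hm])
    show "nor u (D1 (\<lambda>w. 0) u) = - 0 *\<^sub>R Hm u" "nor u (D2 (\<lambda>w. 0) u) = - 0 *\<^sub>R Hm u"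
      by (simp_all add: nor_simps)
  qed (simp_all add: smooth_on_const normal_Hm par)
  then have R: "lorentz (Hm u) (h12 u) *\<^sub>R d = lorentz (Hm u) d *\<^sub>R h12 u" by (simp add: d_def)
  have "nc3 u d * nc4 u (h12 u) = nc4 u d * nc3 u (h12 u)"
  proof (rule null_direction)
    show "nc3 u (Hm u) * nc3 u (Hm u) = nc4 u (Hm u) * nc4 u (Hm u)"
      using null lorentz_normal[OF u n(1,1)] by (simp add: light_like_def)
    show "nc3 u (Hm u) \<noteq> 0 \<or> nc4 u (Hm u) \<noteq> 0"
      using null normal_expand[OF u n(1)] by (auto simp: light_like_def)
    show "(- (nc3 u (Hm u) * nc3 u (h12 u)) + nc4 u (Hm u) * nc4 u (h12 u)) * nc3 u d =
        (- (nc3 u (Hm u) * nc3 u d) + nc4 u (Hm u) * nc4 u d) * nc3 u (h12 u)"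
      "(- (nc3 u (Hm u) * nc3 u (h12 u)) + nc4 u (Hm u) * nc4 u (h12 u)) * nc4 u d =
        (- (nc3 u (Hm u) * nc3 u d) + nc4 u (Hm u) * nc4 u d) * nc4 u (h12 u)"
      using arg_cong[OF R, of "nc3 u"] arg_cong[OF R, of "nc4 u"]
      by (simp_all add: nc_linear lorentz_normal[OF u] n)
  qed
  then show ?thesis using bilinear_normal(1)[OF u n(2,3)] by (simp add: d_def)
qed

end

text \<open>A Gronwall argument: with |F'| \<le> C |F| on a ball of radius r and C r \<le> 1/2, the
  maximum of |F| over the ball is at most half of itself.\<close>

lemma vanishing_neighbourhood:
  fixes F :: "'a::euclidean_space \<Rightarrow> 'b::real_normed_vector"
  assumes "open W" "u \<in> W" "F u = 0" "continuous_on W K" "\<And>w. w \<in> W \<Longrightarrow> K w \<ge> 0"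
    and der: "\<And>w. w \<in> W \<Longrightarrow> (F has_derivative F' w) (at w)"
    and bound: "\<And>w v. w \<in> W \<Longrightarrow> norm (F' w v) \<le> K w * norm (F w) * norm v"
  shows "\<exists>U. open U \<and> u \<in> U \<and> U \<subseteq> W \<and> (\<forall>w\<in>U. F w = 0)"
proof -
  obtain r0 where r0: "r0 > 0" "cball u r0 \<subseteq> W"
    using assms(1,2) by (meson open_contains_cball)
  have cont: "continuous_on W F"
    using der by (meson continuous_at_imp_continuous_on has_derivative_continuous)
  have "compact (K ` cball u r0)"
    using continuous_on_subset[OF assms(4) r0(2)] by (intro compact_continuous_image) auto
  then obtain C where C: "\<And>w. w \<in> cball u r0 \<Longrightarrow> K w \<le> C"
    by (metis bounded_real compact_imp_bounded abs_le_D1 imageI)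
  have "C \<ge> 0" using C[of u] assms(2,5) r0 by force
  \<comment> \<open>Chosen to give C r \<le> 1/2; adding 1 allows C = 0.\<close>
  define r where "r = min r0 (1 / (2 * (C + 1)))"
  have r: "r > 0" "cball u r \<subseteq> W" "cball u r \<subseteq> cball u r0" using r0 \<open>C \<ge> 0\<close> by (auto simp: r_def)
  have "C * r \<le> C * (1 / (2 * (C + 1)))" using \<open>C \<ge> 0\<close> by (intro mult_left_mono) (auto simp: r_def)
  also have "\<dots> \<le> 1/2" using \<open>C \<ge> 0\<close> by (simp add: field_simps)
  finally have Cr: "C * r \<le> 1/2" .
  have "continuous_on (cball u r) (\<lambda>w. norm (F w))"
    using continuous_on_subset[OF cont r(2)] by (intro continuous_on_norm)
  then obtain z where z: "z \<in> cball u r" "\<And>w. w \<in> cball u r \<Longrightarrow> norm (F w) \<le> norm (F z)"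
    using continuous_attains_sup[of "cball u r" "\<lambda>w. norm (F w)"] r(1) by auto
  have "norm (F z - F u) \<le> (C * norm (F z)) * norm (z - u)"
  proof (rule differentiable_bound[of "cball u r" F F'])
    fix w assume w: "w \<in> cball u r"
    then have wW: "w \<in> W" "w \<in> cball u r0" using r by auto
    show "(F has_derivative F' w) (at w within cball u r)"
      using der[OF wW(1)] has_derivative_at_withinI by blast
    have "K w * norm (F w) \<le> C * norm (F z)"
      using C[OF wW(2)] z(2)[OF w] assms(5)[OF wW(1)] \<open>C \<ge> 0\<close> by (intro mult_mono) auto
    then show "onorm (F' w) \<le> C * norm (F z)"
      using bound[OF wW(1)] by (intro onorm_le order_trans[OF bound[OF wW(1)]] mult_right_mono) auto
  qed (use z r in auto)
  also have "\<dots> \<le> (C * norm (F z)) * r"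
    using z(1) \<open>C \<ge> 0\<close> by (intro mult_left_mono) (auto simp: dist_norm norm_minus_commute)
  also have "\<dots> \<le> 1/2 * norm (F z)"
    using mult_right_mono[OF Cr, of "norm (F z)"] by (simp add: mult_ac)
  finally have "norm (F z) = 0" using assms(3) norm_ge_zero[of "F z"] by simp
  then have "F w = 0" if "w \<in> ball u r" for w using z(2)[of w] that by simp
  moreover have "ball u r \<subseteq> W" using r(2) ball_subset_cball by blast
  ultimately show ?thesis using r(1) by (intro exI[of _ "ball u r"]) auto
qed

section \<open>Gauss map in coordinates; local criteria for frames of either orientation\<close>

lemma open_vimage_Collect:
  fixes g :: "'a::topological_space \<Rightarrow> real"
  assumes "open W" "continuous_on W g" "open T"
  shows "open {w \<in> W. g w \<in> T}"
proof -
  have "{w \<in> W. g w \<in> T} = W \<inter> g -` T" by auto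
  then show ?thesis using continuous_open_preimage[OF assms(2,1,3)] by simp
qed

text \<open>The star of the unit tangent bivector with the orientation of the coordinates, expressed
  without a frame.\<close>

definition gauss_bivector :: "(real^2 \<Rightarrow> real^4) \<Rightarrow> real^2 \<Rightarrow> real^4^4" where
  "gauss_bivector f u = inverse (sqrt (det (metric_matrix f u))) *\<^sub>R hodge (partial_deriv 1 f u) (partial_deriv 2 f u)"

lemma laplacian_uminus:
  fixes F :: "real^2 \<Rightarrow> 'b::real_normed_vector"
  assumes "open W" "u \<in> W" "smooth_on W F" "smooth_on W e1" "smooth_on W e2"
  shows "laplacian f e1 e2 (\<lambda>w. - F w) u = - laplacian f e1 e2 F u"
proof -
  have d: "dir_deriv X (\<lambda>w. - F w) w = - dir_deriv X F w" if "w \<in> W" for X w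
    using dir_deriv_uminus[OF smooth_on_imp_differentiable[OF assms(3) that]] .
  have "dir_deriv X (dir_deriv X (\<lambda>w. - F w)) u = - dir_deriv X (dir_deriv X F) u" if "smooth_on W X" for X
  proof -
    have "dir_deriv X (dir_deriv X (\<lambda>w. - F w)) u = dir_deriv X (\<lambda>w. - dir_deriv X F w) u"
      by (rule dir_deriv_cong[OF assms(1,2)]) (rule d)
    also have "\<dots> = - dir_deriv X (dir_deriv X F) u"
      by (rule dir_deriv_uminus[OF smooth_on_imp_differentiable[OF smooth_on_dir_deriv[OF assms(1,3) that] assms(2)]])
    finally show ?thesis .
  qed
  then show ?thesis using assms d[OF assms(2)] by (simp add: laplacian_def)
qed

lemma framed_surface_restrict:
  assumes "framed_surface f W e1 e2" "open U" "U \<subseteq> W"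
  shows "framed_surface f U e1 e2"
  using assms unfolding framed_surface_def tangent_frame_def by (meson smooth_on_subset subsetD)

context framed_surface begin

definition "fdet u = e1 u $ 1 * e2 u $ 2 - e1 u $ 2 * e2 u $ 1"

lemma smooth_fdet: "smooth_on W fdet"
  unfolding fdet_def[abs_def]
  by (intro smooth_on_diff smooth_on_mult smooth_on_vec_nth open_W smooth_e)

text \<open>The Gram determinant of an orthonormal frame is 1, so |\<open>fdet\<close>| is the
  inverse root of the metric determinant; the sign of \<open>fdet\<close> tells whether the frame
  agrees with the orientation of the coordinates.\<close>

lemma hodge_E:
  assumes "u \<in> W"
  shows "hodge (E1 u) (E2 u) = sgn (fdet u) *\<^sub>R gauss_bivector f u"
proof -
  have "hodge (E1 u) (E2 u) = fdet u *\<^sub>R hodge (partial_deriv 1 f u) (partial_deriv 2 f u)"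
    unfolding E_coords[OF assms] fdet_def
    by (simp add: hodge_simps hodge_swap[of "partial_deriv 2 f u" "partial_deriv 1 f u"] algebra_simps)
  moreover have d: "(fdet u)\<^sup>2 * det (metric_matrix f u) = 1"
    using frame_det_metric[OF assms] by (simp add: fdet_def)
  then have "(fdet u)\<^sup>2 \<noteq> 0" by auto
  with d have "det (metric_matrix f u) = inverse ((fdet u)\<^sup>2)"
    by (simp add: field_simps)
  then have "inverse (sqrt (det (metric_matrix f u))) = \<bar>fdet u\<bar>"
    by (simp add: real_sqrt_inverse)
  ultimately show ?thesis by (simp add: gauss_bivector_def sgn_mult_abs)
qed

lemma fdet_nonzero: "u \<in> W \<Longrightarrow> fdet u \<noteq> 0"
  using frame_det_nonzero by (simp add: fdet_def)

text \<open>The sign of \<open>fdet\<close> is locally constant. On the open subset where it is the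
  same as at \<open>u\<close>, F is plus or minus \<open>hodge E1 E2\<close>, and such a sign does
  not affect the vanishing of the Laplacian.\<close>

lemma laplacian_gauss_bivector_zero_iff:
  assumes "u \<in> W" and F: "\<And>w. w \<in> W \<Longrightarrow> F w = gauss_bivector f w"
  shows "laplacian f e1 e2 F u = 0 \<longleftrightarrow>
    nor u (D1 Hm u) = 0 \<and> nor u (D2 Hm u) = 0 \<and> kap u = - 2 * lorentz (Hm u) (Hm u) \<and>
    vol4 (E1 u) (E2 u) (h11 u - h22 u) (h12 u) = 0"
proof -
  have fs: "framed_surface f W e1 e2" by (rule framed_surface_axioms)
  note c = smooth_on_imp_continuous_on[OF smooth_fdet]
  consider "fdet u > 0" | "fdet u < 0" using fdet_nonzero[OF assms(1)] by linarith
  then show ?thesis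
  proof cases
    case 1
    define U where "U = {w \<in> W. fdet w \<in> {0<..}}"
    have U: "open U" "U \<subseteq> W" "u \<in> U"
      using open_vimage_Collect[OF open_W c, of "{0<..}"] 1 assms(1) by (auto simp: U_def)
    interpret S: framed_surface f U e1 e2 by (rule framed_surface_restrict[OF fs U(1,2)])
    show ?thesis
      by (rule S.laplacian_hodge_zero_iff[OF U(3)]) (use hodge_E F in \<open>auto simp: U_def\<close>)
  next
    case 2
    define U where "U = {w \<in> W. fdet w \<in> {..<0}}"
    have U: "open U" "U \<subseteq> W" "u \<in> U"
      using open_vimage_Collect[OF open_W c, of "{..<0}"] 2 assms(1) by (auto simp: U_def)
    interpret S: framed_surface f U e1 e2 by (rule framed_surface_restrict[OF fs U(1,2)])
    have Fm: "- F w = hodge (E1 w) (E2 w)" if "w \<in> U" for w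
      using hodge_E F that by (auto simp: U_def)
    then have "smooth_on U (\<lambda>w. - F w)"
      using smooth_on_bilinear[OF bounded_bilinear_hodge U(1) S.smooth_E]
      by (subst smooth_on_cong[OF U(1) Fm]) auto
    from laplacian_uminus[OF U(1,3) this S.smooth_e, of f]
    have "laplacian f e1 e2 F u = 0 \<longleftrightarrow> laplacian f e1 e2 (\<lambda>w. - F w) u = 0" by simp
    also note S.laplacian_hodge_zero_iff[OF U(3), of "\<lambda>w. - F w", OF Fm]
    finally show ?thesis .
  qed
qed

lemma parallel_iff:
  assumes "u \<in> W"
  shows "(\<forall>X. normal_deriv f X (mean_curvature f e1 e2) u = 0) \<longleftrightarrow> nor u (D1 Hm u) = 0 \<and> nor u (D2 Hm u) = 0"
proof -
  have *: "normal_deriv f X (mean_curvature f e1 e2) u = nor u (dir_deriv X Hm u)" for X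
    using dir_deriv_cong[OF open_W assms mean_curvature_eq] normal_deriv_eq[OF assms] by simp
  have "nor u (dir_deriv X Hm u) = 0" if "nor u (D1 Hm u) = 0" "nor u (D2 Hm u) = 0" for X
  proof -
    obtain a b where "X u = a *\<^sub>R e1 u + b *\<^sub>R e2 u" using frame_expand[OF assms] .
    then have "dir_deriv X Hm u = a *\<^sub>R D1 Hm u + b *\<^sub>R D2 Hm u"
      by (rule dir_deriv_comb[OF diff[OF smooth_Hm assms]])
    then show ?thesis using that by (simp add: nor_simps)
  qed
  then show ?thesis unfolding * by blast
qed

text \<open>The contradiction arises by differentiating relations, so <H, H> must be nonzero on an
  open set; continuity provides one around a supposed bad point.\<close>

lemma harmonic_imp_null:
  assumes "\<And>w. w \<in> W \<Longrightarrow> nor w (D1 Hm w) = 0 \<and> nor w (D2 Hm w) = 0 \<and> kap w = - 2 * lorentz (Hm w) (Hm w) \<and>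
    vol4 (E1 w) (E2 w) (h11 w - h22 w) (h12 w) = 0" and "u \<in> W"
  shows "lorentz (Hm u) (Hm u) = 0"
proof (rule ccontr)
  assume nz: "lorentz (Hm u) (Hm u) \<noteq> 0"
  define U where "U = {w \<in> W. lorentz (Hm w) (Hm w) \<in> - {0}}"
  have "continuous_on W (\<lambda>w. lorentz (Hm w) (Hm w))"
    by (intro smooth_on_imp_continuous_on smooth_on_bilinear[OF bounded_bilinear_lorentz] open_W smooth_Hm)
  then have U: "open U" "U \<subseteq> W" "u \<in> U"
    unfolding U_def using open_vimage_Collect[OF open_W, of _ "- {0}"] nz assms(2) by (blast intro: open_Compl closed_singleton)+
  interpret S: framed_surface f U e1 e2 by (rule framed_surface_restrict[OF framed_surface_axioms U(1,2)])
  show False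
    by (rule S.parallel_non_null_absurd[OF _ _ _ _ _ U(3)]) (use assms(1) in \<open>auto simp: U_def\<close>)
qed

text \<open>For parallel H, Weingarten leaves only tangential derivatives, which are linear in H. So
  the Euclidean norm of the derivative is bounded by a continuous multiple of the norm of H.\<close>

lemma parallel_zero_nbhd:
  assumes par: "\<And>w. w \<in> W \<Longrightarrow> nor w (D1 Hm w) = 0 \<and> nor w (D2 Hm w) = 0"
    and u: "u \<in> W" "Hm u = 0"
  shows "\<exists>U. open U \<and> u \<in> U \<and> U \<subseteq> W \<and> (\<forall>w\<in>U. Hm w = 0)"
proof -
  obtain C where C: "C \<ge> 0" "\<And>v w. norm (lorentz v w) \<le> norm v * norm w * C"
    using lorentz.nonneg_bounded by blast
  define L1 where "L1 w = C * (norm (h11 w) * norm (E1 w) + norm (h12 w) * norm (E2 w))" for w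
  define L2 where "L2 w = C * (norm (h12 w) * norm (E1 w) + norm (h22 w) * norm (E2 w))" for w
  define al where "al i w = lorentz (push f (coord_field i) w) (E1 w)" for i w
  define be where "be i w = lorentz (push f (coord_field i) w) (E2 w)" for i w
  \<comment> \<open>Bounds for the two partial derivatives, added up; \<open>al i\<close> and
    \<open>be i\<close> are the components of the coordinate fields in the frame.\<close>
  define K where "K w = (\<bar>al 1 w\<bar> * L1 w + \<bar>be 1 w\<bar> * L2 w) + (\<bar>al 2 w\<bar> * L1 w + \<bar>be 2 w\<bar> * L2 w)" for w
  have L: "L1 w \<ge> 0" "L2 w \<ge> 0" for w using C(1) by (simp_all add: L1_def L2_def)
  have comb: "norm (- (lorentz H h *\<^sub>R E) - lorentz H h' *\<^sub>R E') \<le> C * (norm h * norm E + norm h' * norm E') * norm H" for H h h' E E'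
  proof -
    have "norm (- (lorentz H h *\<^sub>R E) - lorentz H h' *\<^sub>R E') \<le> \<bar>lorentz H h\<bar> * norm E + \<bar>lorentz H h'\<bar> * norm E'"
      using norm_triangle_ineq4[of "- (lorentz H h *\<^sub>R E)" "lorentz H h' *\<^sub>R E'"] by simp
    also have "\<dots> \<le> (norm H * norm h * C) * norm E + (norm H * norm h' * C) * norm E'"
      using C(2)[of H h] C(2)[of H h'] by (intro add_mono mult_right_mono) auto
    finally show ?thesis by (simp add: algebra_simps)
  qed
  have D: "norm (D1 Hm w) \<le> L1 w * norm (Hm w)" "norm (D2 Hm w) \<le> L2 w * norm (Hm w)" if "w \<in> W" for w
    using Weingarten[OF that smooth_Hm normal_Hm] par[OF that] comb by (simp_all add: L1_def L2_def)
  note bl = smooth_on_bilinear[OF bounded_bilinear_lorentz open_W]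
  have sab: "smooth_on W (al i)" "smooth_on W (be i)" for i
    unfolding al_def[abs_def] be_def[abs_def] by (intro bl coord_smooth smooth_E)+
  show ?thesis
  proof (rule vanishing_neighbourhood[where K = K and F' = "\<lambda>w. frechet_derivative Hm (at w)"])
    show "continuous_on W K" unfolding K_def L1_def L2_def
      by (intro continuous_intros smooth_on_imp_continuous_on sab smooth_h smooth_E)
    show "K w \<ge> 0" for w using L[of w] by (simp add: K_def)
    show "(Hm has_derivative frechet_derivative Hm (at w)) (at w)" if "w \<in> W" for w
      using smooth_on_has_derivative[OF smooth_Hm that] .
    fix w v assume w: "w \<in> W"
    have dH: "Hm differentiable (at w)" by (rule diff[OF smooth_Hm w])
    have p: "norm (partial_deriv i Hm w) \<le> (\<bar>al i w\<bar> * L1 w + \<bar>be i w\<bar> * L2 w) * norm (Hm w)" for i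
    proof -
      have "coord_field i w = al i w *\<^sub>R e1 w + be i w *\<^sub>R e2 w"
        using tangent_coords[OF w, of "coord_field i w"] by (simp add: al_def be_def push_def)
      then have "partial_deriv i Hm w = al i w *\<^sub>R D1 Hm w + be i w *\<^sub>R D2 Hm w"
        unfolding partial_deriv_eq by (rule dir_deriv_comb[OF dH])
      then have "norm (partial_deriv i Hm w) \<le> \<bar>al i w\<bar> * norm (D1 Hm w) + \<bar>be i w\<bar> * norm (D2 Hm w)"
        using norm_triangle_ineq[of "al i w *\<^sub>R D1 Hm w" "be i w *\<^sub>R D2 Hm w"] by simp
      also have "\<dots> \<le> \<bar>al i w\<bar> * (L1 w * norm (Hm w)) + \<bar>be i w\<bar> * (L2 w * norm (Hm w))"
        using D[OF w] by (intro add_mono mult_left_mono) auto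
      finally show ?thesis by (simp add: algebra_simps)
    qed
    have "frechet_derivative Hm (at w) v = v $ 1 *\<^sub>R partial_deriv 1 Hm w + v $ 2 *\<^sub>R partial_deriv 2 Hm w"
      using dir_deriv_coord[OF dH, of "\<lambda>_. v"] by (simp add: dir_deriv_def)
    then have "norm (frechet_derivative Hm (at w) v) \<le> \<bar>v $ 1\<bar> * norm (partial_deriv 1 Hm w) + \<bar>v $ 2\<bar> * norm (partial_deriv 2 Hm w)"
      using norm_triangle_ineq[of "v $ 1 *\<^sub>R partial_deriv 1 Hm w" "v $ 2 *\<^sub>R partial_deriv 2 Hm w"] by simp
    also have "\<dots> \<le> norm v * ((\<bar>al 1 w\<bar> * L1 w + \<bar>be 1 w\<bar> * L2 w) * norm (Hm w))
        + norm v * ((\<bar>al 2 w\<bar> * L1 w + \<bar>be 2 w\<bar> * L2 w) * norm (Hm w))"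
      using p component_le_norm_cart[of v] by (intro add_mono mult_mono) auto
    finally show "norm (frechet_derivative Hm (at w) v) \<le> K w * norm (Hm w) * norm v"
      by (simp add: K_def algebra_simps)
  qed (use open_W u in auto)
qed

end

subsection \<open>Existence of frames\<close>

text \<open>Gram-Schmidt on the coordinate fields works over the whole chart, because space-likeness
  makes both squares positive, and it preserves their orientation. \<open>m\<close> is the second
  field minus its projection to the first.\<close>

lemma spacelike_frame_exists:
  assumes V: "open V" and f: "smooth_on V f"
    and inj: "\<And>u. u \<in> V \<Longrightarrow> inj (frechet_derivative f (at u))"
    and sl: "\<And>u v. u \<in> V \<Longrightarrow> v \<in> tangent_space f u \<Longrightarrow> v \<noteq> 0 \<Longrightarrow> lorentz v v > 0"
  obtains e1 e2 where "framed_surface f V e1 e2" "\<And>u. u \<in> V \<Longrightarrow> e1 u $ 1 * e2 u $ 2 - e1 u $ 2 * e2 u $ 1 > 0"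
proof -
  define g where "g i j u = lorentz (partial_deriv i f u) (partial_deriv j f u)" for i j u
  define m :: "real^2 \<Rightarrow> real^2" where "m u = axis 2 1 - (g 1 2 u * inverse (g 1 1 u)) *\<^sub>R axis 1 1" for u
  define e1 :: "real^2 \<Rightarrow> real^2" where "e1 u = inverse (sqrt (g 1 1 u)) *\<^sub>R axis 1 1" for u
  define e2 where "e2 u = inverse (sqrt (lorentz (push f m u) (push f m u))) *\<^sub>R m u" for u
  note bl = smooth_on_bilinear[OF bounded_bilinear_lorentz V]
  have lin: "linear (frechet_derivative f (at u))" if "u \<in> V" for u
    using linear_frechet_derivative[OF smooth_on_imp_differentiable[OF f that]] .
  have pos: "lorentz (frechet_derivative f (at u) v) (frechet_derivative f (at u) v) > 0" if "u \<in> V" "v \<noteq> 0" for u v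
  proof (rule sl[OF that(1)])
    show "frechet_derivative f (at u) v \<noteq> 0"
      using inj[OF that(1)] linear_0[OF lin[OF that(1)]] that(2) by (metis injD)
  qed (simp add: tangent_space_def)
  have sg: "smooth_on V (g i j)" for i j
    unfolding g_def[abs_def] by (intro bl smooth_on_partial_deriv f)
  have ax: "(axis 1 1 :: real^2) \<noteq> 0" by (simp add: axis_eq_0_iff)
  have g11: "g 1 1 u > 0" if "u \<in> V" for u
    using pos[OF that ax] by (simp add: g_def partial_deriv_def)
  have sm: "smooth_on V m" unfolding m_def[abs_def]
    by (intro smooth_on_diff smooth_on_scaleR smooth_on_mult smooth_on_inverse smooth_on_const sg V)
      (use g11 in fastforce)
  have m0: "m u \<noteq> 0" for u by (auto simp: m_def vec_eq_iff forall_2 axis_def)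
  have mm: "lorentz (push f m u) (push f m u) > 0" if "u \<in> V" for u
    unfolding push_def by (rule pos[OF that m0])
  have sp: "smooth_on V (push f m)" unfolding push_eq by (rule smooth_on_dir_deriv[OF V f sm])
  have se: "smooth_on V e1" "smooth_on V e2"
    unfolding e1_def[abs_def] e2_def[abs_def]
    by (intro smooth_on_scaleR smooth_on_inverse smooth_on_sqrt smooth_on_const sg sm bl sp V;
      use g11 mm in fastforce)+
  have p1: "push f e1 u = inverse (sqrt (g 1 1 u)) *\<^sub>R partial_deriv 1 f u"
    and p2: "push f e2 u = inverse (sqrt (lorentz (push f m u) (push f m u))) *\<^sub>R push f m u"
    and pm: "push f m u = partial_deriv 2 f u - (g 1 2 u * inverse (g 1 1 u)) *\<^sub>R partial_deriv 1 f u"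
    if "u \<in> V" for u
    by (simp_all add: push_def e1_def e2_def m_def partial_deriv_def linear_cmul[OF lin[OF that]] linear_diff[OF lin[OF that]])
  have unit: "inverse (sqrt c) * (inverse (sqrt c) * c) = 1" if "c > 0" for c
    using that by (simp add: field_simps)
  have orth: "lorentz (partial_deriv 1 f u) (push f m u) = 0" if "u \<in> V" for u
    using g11[OF that] by (simp add: pm[OF that] lorentz_simps g_def)
  have "tangent_frame f V e1 e2" unfolding tangent_frame_def induced_metric_def
    using V se unit g11 mm orth
    by (auto simp: p1 p2 lorentz_simps) (simp add: g_def)
  then have fs: "framed_surface f V e1 e2" using f by (rule framed_surface.intro)
  have "e1 u $ 1 * e2 u $ 2 - e1 u $ 2 * e2 u $ 1 > 0" if "u \<in> V" for u
    using g11[OF that] mm[OF that] by (simp add: e1_def e2_def m_def axis_def)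
  then show ?thesis using that fs by blast
qed

lemma oriented_frame_exists:
  assumes "framed_surface f W e1 e2" "\<And>u. u \<in> W \<Longrightarrow> e1 u $ 1 * e2 u $ 2 - e1 u $ 2 * e2 u $ 1 > 0"
  obtains e3 e4 where "oriented_frame f W e1 e2 e3 e4"
proof -
  interpret framed_surface f W e1 e2 by (rule assms(1))
  have n: "E3 u \<in> normal_space f u \<and> E4 u \<in> normal_space f u" if "u \<in> W" for u
    using normal_E34[OF that] by (simp add: normal_space_eq[OF that] normal_def)
  have "oriented_frame f W e1 e2 E3 E4" unfolding oriented_frame_def
    using frame smooth_E34 n normal_frame(1,2,3,8) assms(2)
    by (simp add: det_vector4 det_2 algebra_simps flip: E1_def E2_def)
  then show ?thesis using that by blast
qed

text \<open>The right side mentions no frame, which is what makes the value described by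
  \<open>THE\<close> in \<open>gauss_map\<close> unique within a chart.\<close>

lemma oriented_frame_wedge:
  assumes "oriented_frame f W e1 e2 e3 e4" "smooth_on W f" "u \<in> W"
  shows "wedge (e3 u) (e4 u) = gauss_bivector f u"
proof -
  interpret framed_surface f W e1 e2
    using assms(1,2) by (simp add: framed_surface_def oriented_frame_def)
  have o: "e3 u \<in> normal_space f u" "e4 u \<in> normal_space f u" "\<bar>lorentz (e3 u) (e3 u)\<bar> = 1" "\<bar>lorentz (e4 u) (e4 u)\<bar> = 1"
    "lorentz (e3 u) (e4 u) = 0" "fdet u > 0" "vol4 (E1 u) (E2 u) (e3 u) (e4 u) > 0"
    using assms(1,3) by (auto simp: oriented_frame_def det_vector4 det_2 fdet_def algebra_simps E1_def E2_def)
  have "wedge (e3 u) (e4 u) = hodge (E1 u) (E2 u)"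
    by (rule lorentz_frame_hodge[OF orthonormal(1-3)[OF assms(3)] _ _ _ _ o(5,3,4,7)])
      (use o(1,2) in \<open>auto simp: normal_space_eq[OF assms(3)] lorentz_commute\<close>)
  then show ?thesis using hodge_E[OF assms(3)] o(6) by simp
qed

section \<open>Independence of the chart\<close>

lemma frechet_derivative_chain_on:
  assumes "open S" "w \<in> S" "\<And>w. w \<in> S \<Longrightarrow> f w = g (t w)"
    "t differentiable (at w)" "g differentiable (at (t w))"
  shows "frechet_derivative f (at w) v = frechet_derivative g (at (t w)) (frechet_derivative t (at w) v)"
proof -
  have "((\<lambda>w. g (t w)) has_derivative (\<lambda>v. frechet_derivative g (at (t w)) (frechet_derivative t (at w) v))) (at w)"
    using assms(4,5) unfolding frechet_derivative_works by (rule has_derivative_compose)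
  then have "(f has_derivative (\<lambda>v. frechet_derivative g (at (t w)) (frechet_derivative t (at w) v))) (at w)"
    by (rule has_derivative_transform_within_open[OF _ assms(1,2)]) (simp add: assms(3))
  then show ?thesis using frechet_derivative_at by metis
qed

text \<open>The reason why the trace of the second fundamental form does not depend on the
  orthonormal frame.\<close>

lemma orthogonal_columns:
  fixes a b c d :: real
  assumes "a * a + b * b = 1" "c * c + d * d = 1" "a * c + b * d = 0"
  shows "a * a + c * c = 1" "b * b + d * d = 1" "a * b + c * d = 0"
proof -
  \<comment> \<open>The squared determinant, by Lagrange's identity.\<close>
  have e: "(a * d - b * c) * (a * d - b * c) = 1" using assms by algebra
  show "a * a + c * c = 1" "b * b + d * d = 1" "a * b + c * d = 0"
    using assms e by algebra+
qed

text \<open>The bivector of the coordinate fields and the root of the metric determinant are both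
  multiplied by the Jacobian D. For the root this uses D > 0, so here the orientation of the atlas
  enters.\<close>

lemma gauss_bivector_chart_change:
  assumes S: "open S" "u \<in> S" "\<And>w. w \<in> S \<Longrightarrow> f w = g (t w)"
    and d: "t differentiable (at u)" "g differentiable (at (t u))"
    and pos: "det (matrix (frechet_derivative t (at u))) > 0"
  shows "gauss_bivector f u = gauss_bivector g (t u)"
proof -
  define m where "m = matrix (frechet_derivative t (at u))"
  have lg: "linear (frechet_derivative g (at (t u)))" by (rule linear_frechet_derivative[OF d(2)])
  have p: "partial_deriv j f u = m $ 1 $ j *\<^sub>R partial_deriv 1 g (t u) + m $ 2 $ j *\<^sub>R partial_deriv 2 g (t u)" for j
  proof -
    have "partial_deriv j f u = frechet_derivative g (at (t u)) (frechet_derivative t (at u) (axis j 1))"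
      unfolding partial_deriv_def by (rule frechet_derivative_chain_on[OF S d])
    also have "frechet_derivative t (at u) (axis j 1) = m $ 1 $ j *\<^sub>R axis 1 1 + m $ 2 $ j *\<^sub>R axis 2 1"
      by (subst axis_expansion_2) (simp add: m_def matrix_def)
    finally show ?thesis by (simp add: partial_deriv_def linear_add[OF lg] linear_cmul[OF lg])
  qed
  define D where "D = m $ 1 $ 1 * m $ 2 $ 2 - m $ 1 $ 2 * m $ 2 $ 1"
  have "D > 0" using pos by (simp add: D_def m_def det_2)
  have g: "det (metric_matrix f u) = lorentz (partial_deriv 1 f u) (partial_deriv 1 f u) * lorentz (partial_deriv 2 f u) (partial_deriv 2 f u)
    - lorentz (partial_deriv 1 f u) (partial_deriv 2 f u) * lorentz (partial_deriv 1 f u) (partial_deriv 2 f u)" for f u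
    by (simp add: det_2 metric_matrix_def induced_metric_def push_eq partial_deriv_eq
      lorentz_commute[of "dir_deriv (coord_field 2) f u" "dir_deriv (coord_field 1) f u"])
  have "det (metric_matrix f u) = D\<^sup>2 * det (metric_matrix g (t u))"
    unfolding g p lorentz_simps D_def
    by (simp add: lorentz_commute[of "partial_deriv 2 g (t u)" "partial_deriv 1 g (t u)"] power2_eq_square algebra_simps)
  then have "sqrt (det (metric_matrix f u)) = D * sqrt (det (metric_matrix g (t u)))"
    using \<open>D > 0\<close> by (simp add: real_sqrt_mult)
  moreover have "hodge (partial_deriv 1 f u) (partial_deriv 2 f u) = D *\<^sub>R hodge (partial_deriv 1 g (t u)) (partial_deriv 2 g (t u))"
    unfolding p D_def
    by (simp add: hodge.add_left hodge.add_right hodge.scaleR_left hodge.scaleR_right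
        hodge_swap[of "partial_deriv 2 g (t u)" "partial_deriv 1 g (t u)"] algebra_simps)
  ultimately show ?thesis using \<open>D > 0\<close> by (simp add: gauss_bivector_def)
qed

lemma (in framed_surface) lorentz_normal_tangent:
  "u \<in> W \<Longrightarrow> normal u n \<Longrightarrow> lorentz n (frechet_derivative f (at u) v) = 0"
  by (subst tangent_expand) (auto simp: normal_def lorentz_simps)

text \<open>H is tested against normal fields n, through 2 <n, H> = - <D1 n, E1> - <D2 n, E2>. This
  trace involves only first derivatives of the transition map, and it is invariant because the two
  tangent frames differ by an orthogonal matrix.\<close>

lemma Hm_chart_change:
  assumes P: "framed_surface f W e1 e2" and Q: "framed_surface g W' k1 k2"
    and uS: "u \<in> W" "u \<in> S" "t u \<in> W'" and S: "open S" "smooth_on S t" "\<And>w. w \<in> S \<Longrightarrow> f w = g (t w)"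
  shows "framed_surface.Hm f e1 e2 u = framed_surface.Hm g k1 k2 (t u)"
proof -
  interpret P: framed_surface f W e1 e2 by (rule P)
  interpret Q: framed_surface g W' k1 k2 by (rule Q)
  define U where "U = (S \<inter> W) \<inter> t -` W'"
  have "open U" unfolding U_def
    using S(1) P.open_W Q.open_W smooth_on_imp_continuous_on[OF S(2)]
    by (intro continuous_open_preimage) (auto intro: continuous_on_subset)
  have uU: "u \<in> U" using uS by (simp add: U_def)
  have chain: "frechet_derivative f (at w) v = frechet_derivative g (at (t w)) (frechet_derivative t (at w) v)"
    if "w \<in> U" for w v
    using that by (intro frechet_derivative_chain_on[OF S(1)] S(3) smooth_on_imp_differentiable[OF S(2)]
        Q.diff[OF Q.smooth]) (auto simp: U_def)
  define v1 v2 where "v1 = frechet_derivative t (at u) (e1 u)" and "v2 = frechet_derivative t (at u) (e2 u)"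
  obtain a b where v1: "v1 = a *\<^sub>R k1 (t u) + b *\<^sub>R k2 (t u)" using Q.frame_expand[OF uS(3)] .
  obtain c d where v2: "v2 = c *\<^sub>R k1 (t u) + d *\<^sub>R k2 (t u)" using Q.frame_expand[OF uS(3)] .
  have E: "P.E1 u = a *\<^sub>R Q.E1 (t u) + b *\<^sub>R Q.E2 (t u)" "P.E2 u = c *\<^sub>R Q.E1 (t u) + d *\<^sub>R Q.E2 (t u)"
    unfolding P.E1_def P.E2_def push_def chain[OF uU] v1_def[symmetric] v2_def[symmetric]
    unfolding v1 v2 by (rule Q.push_comb[OF uS(3)])+
  have o: "a * a + b * b = 1" "c * c + d * d = 1" "a * c + b * d = 0"
    using P.orthonormal[OF uS(1)] unfolding E
    by (simp_all add: lorentz_simps Q.orthonormal[OF uS(3)])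
  note oc = orthogonal_columns[OF o]
  have tr: "lorentz (n (t u)) (P.Hm u) = lorentz (n (t u)) (Q.Hm (t u))"
    if sn: "smooth_on W' n" and nn: "\<And>w. w \<in> W' \<Longrightarrow> Q.normal w (n w)" for n
  proof -
    let ?n = "\<lambda>w. n (t w)"
    have dn: "((\<lambda>w. n (t w)) has_derivative (\<lambda>v. frechet_derivative n (at (t u)) (frechet_derivative t (at u) v))) (at u)"
      using smooth_on_has_derivative[OF S(2) uS(2)] smooth_on_has_derivative[OF sn uS(3)]
      by (rule has_derivative_compose)
    then have dnu: "?n differentiable (at u)" by (rule differentiableI)
    have lin: "linear (frechet_derivative n (at (t u)))"
      using linear_frechet_derivative[OF Q.diff[OF sn uS(3)]] .
    have Dn: "dir_deriv e1 ?n u = a *\<^sub>R dir_deriv k1 n (t u) + b *\<^sub>R dir_deriv k2 n (t u)"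
      "dir_deriv e2 ?n u = c *\<^sub>R dir_deriv k1 n (t u) + d *\<^sub>R dir_deriv k2 n (t u)"
      unfolding dir_deriv_eqI[OF dn] v1_def[symmetric] v2_def[symmetric] unfolding v1 v2
      by (simp_all add: linear_add[OF lin] linear_cmul[OF lin] dir_deriv_def)
    have perp: "lorentz (?n w) (frechet_derivative f (at w) v) = 0" if "w \<in> U" for w v
      unfolding chain[OF that] using that nn by (intro Q.lorentz_normal_tangent) (auto simp: U_def)
    have z: "lorentz (?n u) (dir_deriv X E u) = - lorentz (dir_deriv X ?n u) (E u)"
      if "smooth_on W E" "\<And>w. w \<in> U \<Longrightarrow> lorentz (?n w) (E w) = 0" for X E
    proof -
      have "dir_deriv X (\<lambda>w. lorentz (?n w) (E w)) u = dir_deriv X (\<lambda>w. 0) u"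
        by (rule dir_deriv_cong[OF \<open>open U\<close> uU that(2)])
      then show ?thesis using dir_deriv_lorentz[OF dnu P.diff[OF that(1) uS(1)], of X] by simp
    qed
    have perpE: "lorentz (?n w) (P.E1 w) = 0" "lorentz (?n w) (P.E2 w) = 0" if "w \<in> U" for w
      unfolding P.E1_def P.E2_def push_def by (rule perp[OF that])+
    have "lorentz (?n u) (P.h11 u) = - lorentz (dir_deriv e1 ?n u) (P.E1 u)"
      "lorentz (?n u) (P.h22 u) = - lorentz (dir_deriv e2 ?n u) (P.E2 u)"
      using z[OF P.smooth_E(1) perpE(1), of e1] z[OF P.smooth_E(2) perpE(2), of e2] perpE[OF uU]
      by (simp_all add: P.frame_derivs[OF uS(1)] lorentz_simps)
    then have "2 * lorentz (?n u) (P.Hm u) = - lorentz (dir_deriv e1 ?n u) (P.E1 u) - lorentz (dir_deriv e2 ?n u) (P.E2 u)"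
      by (simp add: P.Hm_def lorentz_simps)
    also have "\<dots> = (a * a + c * c) * lorentz (n (t u)) (Q.h11 (t u)) + 2 * (a * b + c * d) * lorentz (n (t u)) (Q.h12 (t u))
        + (b * b + d * d) * lorentz (n (t u)) (Q.h22 (t u))"
      unfolding Dn E by (simp add: lorentz_simps Q.D_normal_inner[OF uS(3) sn nn] algebra_simps)
    also have "\<dots> = 2 * lorentz (n (t u)) (Q.Hm (t u))"
      unfolding oc by (simp add: Q.Hm_def lorentz_simps)
    finally show ?thesis by simp
  qed
  have E': "Q.E1 (t u) = a *\<^sub>R P.E1 u + c *\<^sub>R P.E2 u" "Q.E2 (t u) = b *\<^sub>R P.E1 u + d *\<^sub>R P.E2 u"
  proof -
    have "a *\<^sub>R P.E1 u + c *\<^sub>R P.E2 u = (a * a + c * c) *\<^sub>R Q.E1 (t u) + (a * b + c * d) *\<^sub>R Q.E2 (t u)"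
      "b *\<^sub>R P.E1 u + d *\<^sub>R P.E2 u = (a * b + c * d) *\<^sub>R Q.E1 (t u) + (b * b + d * d) *\<^sub>R Q.E2 (t u)"
      unfolding E by (simp_all add: algebra_simps)
    then show "Q.E1 (t u) = a *\<^sub>R P.E1 u + c *\<^sub>R P.E2 u" "Q.E2 (t u) = b *\<^sub>R P.E1 u + d *\<^sub>R P.E2 u"
      unfolding oc by simp_all
  qed
  \<comment> \<open>Both mean curvature vectors lie in the same normal plane, where pairing with
    \<open>Q.E3\<close> and \<open>Q.E4\<close> determines a vector.\<close>
  have "Q.normal (t u) (P.Hm u)"
    using P.normal_Hm[OF uS(1)] unfolding Q.normal_def P.normal_def E' by (simp add: lorentz_simps)
  then show ?thesis
    using tr[OF Q.smooth_E34(1) Q.normal_E34(1)] tr[OF Q.smooth_E34(2) Q.normal_E34(2)]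
    by (intro Q.normal_eqI[OF uS(3)] Q.normal_Hm uS) (simp_all add: Q.nc3_def Q.nc4_def lorentz_commute)
qed

section \<open>Surfaces\<close>

lemma chart_transition:
  assumes "oriented_surface M A" "(V, \<psi>) \<in> A" "(V', \<phi>) \<in> A" "u \<in> V" "u' \<in> V'" "\<psi> u = \<phi> u'"
  obtains S t where "open S" "u \<in> S" "smooth_on S t" "t u = u'" "\<And>w. w \<in> S \<Longrightarrow> \<psi> w = \<phi> (t w)"
    "det (matrix (frechet_derivative t (at u))) > 0"
proof
  define S t where "S = V \<inter> \<psi> -` (\<phi> ` V')" and "t = inv_into V' \<phi> \<circ> \<psi>"
  have A: "open V \<and> openin M (\<psi> ` V) \<and> embedding_map (top_of_set V) M \<psi>" if "(V, \<psi>) \<in> A" for V \<psi>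
    using assms(1) that unfolding oriented_surface_def by fastforce
  have "\<forall>(V, \<psi>)\<in>A. \<forall>(W, \<phi>)\<in>A.
        let S = V \<inter> \<psi> -` (\<phi> ` W); \<tau> = inv_into W \<phi> \<circ> \<psi> in
        smooth_on S \<tau> \<and> (\<forall>u\<in>S. det (matrix (frechet_derivative \<tau> (at u))) > 0)"
    using assms(1) unfolding oriented_surface_def by (elim conjE)
  then have T: "smooth_on S t \<and> (\<forall>u\<in>S. det (matrix (frechet_derivative t (at u))) > 0)"
    using assms(2,3) unfolding S_def t_def Let_def by blast
  show uS: "u \<in> S" using assms by (auto simp: S_def)
  show "smooth_on S t" "det (matrix (frechet_derivative t (at u))) > 0" using T uS by auto
  have "continuous_map (top_of_set V) M \<psi>"
    using A[OF assms(2)] unfolding embedding_map_def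
    by (meson homeomorphic_imp_continuous_map continuous_map_in_subtopology)
  then have "openin (top_of_set V) {w \<in> topspace (top_of_set V). \<psi> w \<in> \<phi> ` V'}"
    using A[OF assms(3)] openin_continuous_map_preimage by blast
  moreover have "{w \<in> topspace (top_of_set V). \<psi> w \<in> \<phi> ` V'} = S" by (auto simp: S_def)
  ultimately show "open S" using A[OF assms(2)] openin_open_trans by metis
  have inj: "inj_on \<phi> V'"
    using A[OF assms(3)] homeomorphic_imp_injective_map unfolding embedding_map_def by fastforce
  show "t u = u'" using assms(5,6) inj by (simp add: t_def inv_into_f_f)
  show "\<psi> w = \<phi> (t w)" if "w \<in> S" for w
    using that by (auto simp: S_def t_def f_inv_into_f)
qed

lemma chart_image_open:
  assumes "oriented_surface M A" "(V, \<psi>) \<in> A" "open U" "U \<subseteq> V"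
  shows "openin M (\<psi> ` U)"
proof -
  have A: "open V" "openin M (\<psi> ` V)" "embedding_map (top_of_set V) M \<psi>"
    using assms(1,2) unfolding oriented_surface_def by fastforce+
  have "openin (top_of_set V) U" using assms(3,4) A(1) by (simp add: openin_open_eq)
  then have "openin (subtopology M (\<psi> ` V)) (\<psi> ` U)"
    using A(3) homeomorphic_imp_open_map unfolding embedding_map_def open_map_def by fastforce
  then show ?thesis using A(2) openin_trans_full by blast
qed

locale spacelike_surface =
  fixes M :: "'p topology" and A :: "((real^2) set \<times> (real^2 \<Rightarrow> 'p)) set" and x :: "'p \<Rightarrow> real^4"
  assumes surface: "oriented_surface M A" and immersion: "spacelike_immersion A x"
begin

lemma chart:
  assumes "(V, \<psi>) \<in> A"
  shows chart_open: "open V" and chart_smooth: "smooth_on V (x \<circ> \<psi>)"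
    and "\<And>u. u \<in> V \<Longrightarrow> inj (frechet_derivative (x \<circ> \<psi>) (at u))"
    and "\<And>u v. u \<in> V \<Longrightarrow> v \<in> tangent_space (x \<circ> \<psi>) u \<Longrightarrow> v \<noteq> 0 \<Longrightarrow> lorentz v v > 0"
proof -
  show "open V" using surface assms unfolding oriented_surface_def by fastforce
  have "\<forall>(V, \<psi>)\<in>A. smooth_on V (x \<circ> \<psi>) \<and>
     (\<forall>u\<in>V. inj (frechet_derivative (x \<circ> \<psi>) (at u)) \<and>
            (\<forall>v\<in>tangent_space (x \<circ> \<psi>) u. v \<noteq> 0 \<longrightarrow> lorentz v v > 0))"
    using immersion unfolding spacelike_immersion_def .
  then have i: "smooth_on V (x \<circ> \<psi>) \<and>
     (\<forall>u\<in>V. inj (frechet_derivative (x \<circ> \<psi>) (at u)) \<and>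
            (\<forall>v\<in>tangent_space (x \<circ> \<psi>) u. v \<noteq> 0 \<longrightarrow> lorentz v v > 0))"
    using assms by blast
  then show "smooth_on V (x \<circ> \<psi>)" by blast
  show "inj (frechet_derivative (x \<circ> \<psi>) (at u))" if "u \<in> V" for u using i that by blast
  show "lorentz v v > 0" if "u \<in> V" "v \<in> tangent_space (x \<circ> \<psi>) u" "v \<noteq> 0" for u v using i that by blast
qed

lemma chart_frame:
  assumes "(V, \<psi>) \<in> A"
  obtains e1 e2 where "framed_surface (x \<circ> \<psi>) V e1 e2" "\<And>u. u \<in> V \<Longrightarrow> e1 u $ 1 * e2 u $ 2 - e1 u $ 2 * e2 u $ 1 > 0"
  by (rule spacelike_frame_exists[OF chart(1,2)[OF assms]]; use chart(3,4)[OF assms] that in blast)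

lemma framed:
  "(V, \<psi>) \<in> A \<Longrightarrow> W \<subseteq> V \<Longrightarrow> tangent_frame (x \<circ> \<psi>) W e1 e2 \<Longrightarrow> framed_surface (x \<circ> \<psi>) W e1 e2"
  using chart_smooth smooth_on_subset by (simp add: framed_surface_def) blast

text \<open>Existence of the described value comes from a frame on the whole chart; uniqueness
  compares two charts through the coordinate expression, which transition maps of positive Jacobian
  preserve.\<close>

lemma gauss_map_eq:
  assumes "(V, \<psi>) \<in> A" "u \<in> V"
  shows "gauss_map A x (\<psi> u) = gauss_bivector (x \<circ> \<psi>) u"
  unfolding gauss_map_def
proof (rule the_equality)
  obtain e1 e2 where e: "framed_surface (x \<circ> \<psi>) V e1 e2" "\<And>u. u \<in> V \<Longrightarrow> e1 u $ 1 * e2 u $ 2 - e1 u $ 2 * e2 u $ 1 > 0"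
    using chart_frame[OF assms(1)] by blast
  obtain e3 e4 where o: "oriented_frame (x \<circ> \<psi>) V e1 e2 e3 e4"
    using oriented_frame_exists[OF e] by blast
  have "gauss_bivector (x \<circ> \<psi>) u = wedge (e3 u) (e4 u)"
    using oriented_frame_wedge[OF o chart_smooth[OF assms(1)] assms(2)] by simp
  then have "\<exists>W e1 e2 e3 e4. \<exists>u'\<in>W. W \<subseteq> V \<and> \<psi> u' = \<psi> u \<and>
      oriented_frame (x \<circ> \<psi>) W e1 e2 e3 e4 \<and> gauss_bivector (x \<circ> \<psi>) u = wedge (e3 u') (e4 u')"
    using o assms(2) by blast
  then show "\<exists>(V, \<phi>)\<in>A. \<exists>W e1 e2 e3 e4. \<exists>u'\<in>W. W \<subseteq> V \<and> \<phi> u' = \<psi> u \<and>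
      oriented_frame (x \<circ> \<phi>) W e1 e2 e3 e4 \<and> gauss_bivector (x \<circ> \<psi>) u = wedge (e3 u') (e4 u')"
    using assms(1) by blast
next
  fix \<omega> assume "\<exists>(V, \<phi>)\<in>A. \<exists>W e1 e2 e3 e4. \<exists>u'\<in>W. W \<subseteq> V \<and> \<phi> u' = \<psi> u \<and>
      oriented_frame (x \<circ> \<phi>) W e1 e2 e3 e4 \<and> \<omega> = wedge (e3 u') (e4 u')"
  then obtain V' \<phi> W e1 e2 e3 e4 u' where c: "(V', \<phi>) \<in> A" "u' \<in> W" "W \<subseteq> V'" "\<phi> u' = \<psi> u"
      "oriented_frame (x \<circ> \<phi>) W e1 e2 e3 e4" "\<omega> = wedge (e3 u') (e4 u')"
    by blast
  have u': "u' \<in> V'" using c by blast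
  have "\<omega> = gauss_bivector (x \<circ> \<phi>) u'"
    using oriented_frame_wedge[OF c(5) smooth_on_subset[OF chart_smooth[OF c(1)] c(3)] c(2)] c(6) by simp
  moreover obtain S t where t: "open S" "u \<in> S" "smooth_on S t" "t u = u'" "\<And>w. w \<in> S \<Longrightarrow> \<psi> w = \<phi> (t w)"
    "det (matrix (frechet_derivative t (at u))) > 0"
    using chart_transition[OF surface assms(1) c(1) assms(2) u' c(4)[symmetric]] by blast
  have "gauss_bivector (x \<circ> \<psi>) u = gauss_bivector (x \<circ> \<phi>) (t u)"
  proof (rule gauss_bivector_chart_change[OF t(1,2) _ smooth_on_imp_differentiable[OF t(3,2)] _ t(6)])
    show "(x \<circ> \<phi>) differentiable (at (t u))"
      using smooth_on_imp_differentiable[OF chart_smooth[OF c(1)] u'] t(4) by simp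
  qed (simp add: t(5))
  ultimately show "\<omega> = gauss_bivector (x \<circ> \<psi>) u" using t(4) by simp
qed

lemma Hm_well_defined:
  assumes "(V, \<psi>) \<in> A" "(V', \<phi>) \<in> A" "W \<subseteq> V" "W' \<subseteq> V'" "u \<in> W" "u' \<in> W'" "\<psi> u = \<phi> u'"
    "framed_surface (x \<circ> \<psi>) W e1 e2" "framed_surface (x \<circ> \<phi>) W' k1 k2"
  shows "framed_surface.Hm (x \<circ> \<psi>) e1 e2 u = framed_surface.Hm (x \<circ> \<phi>) k1 k2 u'"
proof -
  obtain S t where t: "open S" "u \<in> S" "smooth_on S t" "t u = u'" "\<And>w. w \<in> S \<Longrightarrow> \<psi> w = \<phi> (t w)"
    using chart_transition[OF surface assms(1,2) _ _ assms(7)] assms(3-6) by blast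
  show ?thesis
    using Hm_chart_change[OF assms(8,9,5) t(2) _ t(1,3)] t(4,5) assms(6) by simp
qed

lemma parallel_nowhere_zero:
  assumes par: "parallel_mean_curvature A x" and nonmax: "\<not> maximal_surface A x"
    and c: "(V, \<psi>) \<in> A" "W \<subseteq> V" "framed_surface (x \<circ> \<psi>) W e1 e2" "u \<in> W"
  shows "framed_surface.Hm (x \<circ> \<psi>) e1 e2 u \<noteq> 0"
proof
  assume zero: "framed_surface.Hm (x \<circ> \<psi>) e1 e2 u = 0"
  \<comment> \<open>Zero and nonzero locus of H on the abstract surface. Membership is witnessed by
    some chart and frame, so their disjointness rests on \<open>Hm_well_defined\<close>.\<close>
  define Z where "Z = (\<Union>{\<psi> ` U | V \<psi> U e1 e2. (V, \<psi>) \<in> A \<and> open U \<and> U \<subseteq> V \<and> framed_surface (x \<circ> \<psi>) U e1 e2 \<and>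
     (\<forall>w\<in>U. framed_surface.Hm (x \<circ> \<psi>) e1 e2 w = 0)})"
  define N where "N = (\<Union>{\<psi> ` U | V \<psi> U e1 e2. (V, \<psi>) \<in> A \<and> open U \<and> U \<subseteq> V \<and> framed_surface (x \<circ> \<psi>) U e1 e2 \<and>
     (\<forall>w\<in>U. framed_surface.Hm (x \<circ> \<psi>) e1 e2 w \<noteq> 0)})"
  have open': "openin M Z" "openin M N" unfolding Z_def N_def
    by (intro openin_Union; use chart_image_open[OF surface] in blast)+
  have inZ: "\<psi> u \<in> Z" if c: "(V, \<psi>) \<in> A" "W \<subseteq> V" "framed_surface (x \<circ> \<psi>) W e1 e2" "u \<in> W"
    and z: "framed_surface.Hm (x \<circ> \<psi>) e1 e2 u = 0" for V \<psi> W e1 e2 u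
  proof -
    interpret framed_surface "x \<circ> \<psi>" W e1 e2 by (rule c(3))
    have "nor w (D1 Hm w) = 0 \<and> nor w (D2 Hm w) = 0" if "w \<in> W" for w
      using par c frame that unfolding parallel_iff[OF that, symmetric] parallel_mean_curvature_def by blast
    then obtain U where U: "open U" "u \<in> U" "U \<subseteq> W" "\<forall>w\<in>U. Hm w = 0"
      using parallel_zero_nbhd[OF _ c(4) z] by blast
    then have "framed_surface (x \<circ> \<psi>) U e1 e2" using framed_surface_restrict c(3) by blast
    then have "\<exists>V e1 e2. (V, \<psi>) \<in> A \<and> open U \<and> U \<subseteq> V \<and> framed_surface (x \<circ> \<psi>) U e1 e2 \<and>
     (\<forall>w\<in>U. framed_surface.Hm (x \<circ> \<psi>) e1 e2 w = 0)" using U c by blast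
    then show ?thesis using U(2) unfolding Z_def by blast
  qed
  have inN: "\<psi> u \<in> N" if c: "(V, \<psi>) \<in> A" "W \<subseteq> V" "framed_surface (x \<circ> \<psi>) W e1 e2" "u \<in> W"
    and z: "framed_surface.Hm (x \<circ> \<psi>) e1 e2 u \<noteq> 0" for V \<psi> W e1 e2 u
  proof -
    interpret framed_surface "x \<circ> \<psi>" W e1 e2 by (rule c(3))
    define U where "U = W \<inter> Hm -` (- {0})"
    have U: "open U" "U \<subseteq> W" "u \<in> U" "\<forall>w\<in>U. Hm w \<noteq> 0"
      using continuous_open_preimage[OF smooth_on_imp_continuous_on[OF smooth_Hm] open_W, of "- {0}"] c(4) z
      by (auto simp: U_def)
    then have "framed_surface (x \<circ> \<psi>) U e1 e2" using framed_surface_restrict c(3) by blast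
    then have "\<exists>V e1 e2. (V, \<psi>) \<in> A \<and> open U \<and> U \<subseteq> V \<and> framed_surface (x \<circ> \<psi>) U e1 e2 \<and>
     (\<forall>w\<in>U. framed_surface.Hm (x \<circ> \<psi>) e1 e2 w \<noteq> 0)" using U c by blast
    then show ?thesis using U(3) unfolding N_def by blast
  qed
  have "Z \<inter> N = {}"
  proof (rule ccontr)
    assume "Z \<inter> N \<noteq> {}"
    then obtain p where "p \<in> Z" "p \<in> N" by blast
    then obtain V \<psi> U e1 e2 w V' \<phi> U' k1 k2 w' where
      1: "(V, \<psi>) \<in> A" "U \<subseteq> V" "framed_surface (x \<circ> \<psi>) U e1 e2" "w \<in> U" "p = \<psi> w" "framed_surface.Hm (x \<circ> \<psi>) e1 e2 w = 0" and
      2: "(V', \<phi>) \<in> A" "U' \<subseteq> V'" "framed_surface (x \<circ> \<phi>) U' k1 k2" "w' \<in> U'" "p = \<phi> w'" "framed_surface.Hm (x \<circ> \<phi>) k1 k2 w' \<noteq> 0"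
      unfolding Z_def N_def by blast
    have "\<psi> w = \<phi> w'" using 1(5) 2(5) by simp
    then show False
      using Hm_well_defined[OF 1(1) 2(1) 1(2) 2(2) 1(4) 2(4) _ 1(3) 2(3)] 1(6) 2(6) by simp
  qed
  moreover have "topspace M \<subseteq> Z \<union> N"
  proof
    fix p assume "p \<in> topspace M"
    moreover have "topspace M = (\<Union>(V, \<psi>)\<in>A. \<psi> ` V)"
      using surface unfolding oriented_surface_def by blast
    ultimately obtain V \<psi> w where w: "(V, \<psi>) \<in> A" "w \<in> V" "p = \<psi> w" by auto
    obtain e1 e2 where "framed_surface (x \<circ> \<psi>) V e1 e2" using chart_frame[OF w(1)] by blast
    then show "p \<in> Z \<union> N" using inZ[OF w(1) order_refl _ w(2)] inN[OF w(1) order_refl _ w(2)] w(3) by blast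
  qed
  moreover have "Z \<noteq> {}" using inZ[OF c zero] by blast
  \<comment> \<open>Non-maximality enters here: it gives a point with H \<noteq> 0, and
    connectedness then excludes zeros.\<close>
  moreover have "N \<noteq> {}"
  proof -
    have "\<not> (\<forall>(V, \<psi>)\<in>A. \<forall>W e1 e2. W \<subseteq> V \<and> tangent_frame (x \<circ> \<psi>) W e1 e2 \<longrightarrow>
        (\<forall>u\<in>W. mean_curvature (x \<circ> \<psi>) e1 e2 u = 0))"
      using nonmax unfolding maximal_surface_def .
    then obtain V \<psi> W e1 e2 w where w: "(V, \<psi>) \<in> A" "W \<subseteq> V" "tangent_frame (x \<circ> \<psi>) W e1 e2" "w \<in> W"
      "mean_curvature (x \<circ> \<psi>) e1 e2 w \<noteq> 0" by blast
    interpret framed_surface "x \<circ> \<psi>" W e1 e2 by (rule framed[OF w(1-3)])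
    show ?thesis
      using inN[OF w(1,2) framed_surface_axioms w(4)] w(5) mean_curvature_eq[OF w(4)] by auto
  qed
  moreover have "connected_space M" using surface unfolding oriented_surface_def by blast
  ultimately show False using open' connected_spaceD by metis
qed

lemma laplacian_gauss_map_zero_iff:
  assumes "(V, \<psi>) \<in> A" "W \<subseteq> V" "framed_surface (x \<circ> \<psi>) W e1 e2" "u \<in> W"
  shows "laplacian (x \<circ> \<psi>) e1 e2 (gauss_map A x \<circ> \<psi>) u = 0 \<longleftrightarrow>
    (\<forall>X. normal_deriv (x \<circ> \<psi>) X (mean_curvature (x \<circ> \<psi>) e1 e2) u = 0) \<and>
    gaussian_curvature (x \<circ> \<psi>) u = 2 * lorentz (mean_curvature (x \<circ> \<psi>) e1 e2 u) (mean_curvature (x \<circ> \<psi>) e1 e2 u) \<and>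
    vol4 (push (x \<circ> \<psi>) e1 u) (push (x \<circ> \<psi>) e2 u)
      (framed_surface.h11 (x \<circ> \<psi>) e1 e2 u - framed_surface.h22 (x \<circ> \<psi>) e1 e2 u) (framed_surface.h12 (x \<circ> \<psi>) e1 e2 u) = 0"
proof -
  interpret framed_surface "x \<circ> \<psi>" W e1 e2 by (rule assms(3))
  have F: "(gauss_map A x \<circ> \<psi>) w = gauss_bivector (x \<circ> \<psi>) w" if "w \<in> W" for w
    using gauss_map_eq[OF assms(1)] assms(2) that by auto
  show ?thesis
    unfolding parallel_iff[OF assms(4)] gaussian_curvature_eq[OF assms(4)]
      mean_curvature_eq[OF assms(4)] E1_def[symmetric] E2_def[symmetric]
    by (subst laplacian_gauss_bivector_zero_iff[OF assms(4)]; use F in auto)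
qed

end

theorem theorem3p9:
  fixes M :: "'p topology"
    and A :: "((real^2) set \<times> (real^2 \<Rightarrow> 'p)) set"
    and x :: "'p \<Rightarrow> real^4"
  assumes "oriented_surface M A"
    and "spacelike_immersion A x"
    and "\<not> maximal_surface A x"
  shows "harmonic_on_surface A x (gauss_map A x) \<longleftrightarrow>
    flat_surface A x \<and> lightlike_mean_curvature A x \<and> parallel_mean_curvature A x"
proof -
  interpret spacelike_surface M A x by (rule spacelike_surface.intro[OF assms(1,2)])
  show ?thesis
  proof (intro iffI conjI)
    assume harm: "harmonic_on_surface A x (gauss_map A x)"
    have lap: "laplacian (x \<circ> \<psi>) e1 e2 (gauss_map A x \<circ> \<psi>) u = 0"
      if "(V, \<psi>) \<in> A" "W \<subseteq> V" "framed_surface (x \<circ> \<psi>) W e1 e2" "u \<in> W" for V \<psi> W e1 e2 u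
      using harm that framed_surface.frame[OF that(3)] unfolding harmonic_on_surface_def by blast
    have null: "lorentz (mean_curvature (x \<circ> \<psi>) e1 e2 u) (mean_curvature (x \<circ> \<psi>) e1 e2 u) = 0"
      if c: "(V, \<psi>) \<in> A" "W \<subseteq> V" "framed_surface (x \<circ> \<psi>) W e1 e2" "u \<in> W" for V \<psi> W e1 e2 u
    proof -
      interpret framed_surface "x \<circ> \<psi>" W e1 e2 by (rule c(3))
      have F: "(gauss_map A x \<circ> \<psi>) w = gauss_bivector (x \<circ> \<psi>) w" if "w \<in> W" for w
        using gauss_map_eq[OF c(1)] c(2) that by auto
      show ?thesis unfolding mean_curvature_eq[OF c(4)]
      proof (rule harmonic_imp_null[OF _ c(4)])
        fix w assume w: "w \<in> W"
        show "nor w (D1 Hm w) = 0 \<and> nor w (D2 Hm w) = 0 \<and> kap w = - 2 * lorentz (Hm w) (Hm w) \<and>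
            vol4 (E1 w) (E2 w) (h11 w - h22 w) (h12 w) = 0"
          by (rule iffD1[OF laplacian_gauss_bivector_zero_iff[OF w] lap[OF c(1-3) w]]) (rule F)
      qed
    qed
    show "flat_surface A x"
      unfolding flat_surface_def
    proof (clarify)
      fix V \<psi> u assume c: "(V, \<psi>) \<in> A" "u \<in> V"
      obtain e1 e2 where e: "framed_surface (x \<circ> \<psi>) V e1 e2" using chart_frame[OF c(1)] by blast
      \<comment> \<open>The criterion gives K = 2 <H, H>, and H has square 0.\<close>
      show "gaussian_curvature (x \<circ> \<psi>) u = 0"
        using laplacian_gauss_map_zero_iff[OF c(1) order_refl e c(2)] lap[OF c(1) order_refl e c(2)]
          null[OF c(1) order_refl e c(2)] by simp
    qed
    show par: "parallel_mean_curvature A x"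
      unfolding parallel_mean_curvature_def
    proof (clarify)
      fix V \<psi> W e1 e2 X u assume c: "(V, \<psi>) \<in> A" "W \<subseteq> V" "tangent_frame (x \<circ> \<psi>) W e1 e2" "u \<in> W"
      note e = framed[OF c(1-3)]
      show "normal_deriv (x \<circ> \<psi>) X (mean_curvature (x \<circ> \<psi>) e1 e2) u = 0"
        using laplacian_gauss_map_zero_iff[OF c(1,2) e c(4)] lap[OF c(1,2) e c(4)] by simp
    qed
    show "lightlike_mean_curvature A x"
      unfolding lightlike_mean_curvature_def
    proof (clarify)
      fix V \<psi> W e1 e2 u assume c: "(V, \<psi>) \<in> A" "W \<subseteq> V" "tangent_frame (x \<circ> \<psi>) W e1 e2" "u \<in> W"
      note e = framed[OF c(1-3)]
      \<comment> \<open>Vanishing of <H, H> alone would allow H = 0 at some points; the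
        connectedness argument rules this out.\<close>
      have "mean_curvature (x \<circ> \<psi>) e1 e2 u \<noteq> 0"
        using parallel_nowhere_zero[OF par assms(3) c(1,2) e c(4)] framed_surface.mean_curvature_eq[OF e c(4)] by simp
      then show "light_like (mean_curvature (x \<circ> \<psi>) e1 e2 u)"
        using null[OF c(1,2) e c(4)] by (simp add: light_like_def)
    qed
  next
    assume a: "flat_surface A x \<and> lightlike_mean_curvature A x \<and> parallel_mean_curvature A x"
    show "harmonic_on_surface A x (gauss_map A x)"
      unfolding harmonic_on_surface_def
    proof (clarify)
      fix V \<psi> W e1 e2 u assume c: "(V, \<psi>) \<in> A" "W \<subseteq> V" "tangent_frame (x \<circ> \<psi>) W e1 e2" "u \<in> W"
      interpret framed_surface "x \<circ> \<psi>" W e1 e2 by (rule framed[OF c(1-3)])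
      have par: "\<forall>X. normal_deriv (x \<circ> \<psi>) X (mean_curvature (x \<circ> \<psi>) e1 e2) w = 0" if "w \<in> W" for w
        using a c that unfolding parallel_mean_curvature_def by blast
      have null: "light_like (mean_curvature (x \<circ> \<psi>) e1 e2 u)"
        using a c unfolding lightlike_mean_curvature_def by blast
      \<comment> \<open>K = 2 <H, H> holds because both sides vanish; the remaining condition,
        proportionality of the traceless coefficients, comes from H being parallel and
        light-like.\<close>
      have "gaussian_curvature (x \<circ> \<psi>) u = 0" using a c unfolding flat_surface_def by blast
      moreover have "vol4 (E1 u) (E2 u) (h11 u - h22 u) (h12 u) = 0"
        using par null mean_curvature_eq[OF c(4)] by (intro Hm_parallel_light_like_dep) (auto simp: parallel_iff c(4))
      ultimately show "laplacian (x \<circ> \<psi>) e1 e2 (gauss_map A x \<circ> \<psi>) u = 0"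
        using laplacian_gauss_map_zero_iff[OF c(1,2) framed_surface_axioms c(4)] par[OF c(4)] null
        by (simp add: light_like_def E1_def E2_def)
    qed
  qed
qed

end
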